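(* Let $w\in\mathbb{C}$ and $z\in\mathbb{C}\setminus\{-1,1\}$. For $\alpha,\beta>0$ such that $\alpha\beta=1$, $$\sqrt{\alpha}\,\Bigg(4\sum_{n=1}^{\infty}\sigma_{-z}(n)n^{\frac z2}e^{-\frac{w^2}{4}}K_{\frac z2,iw}(2n\pi\alpha)-\Gamma\left(\frac z2\right)\zeta(z)\pi^{-\frac z2}\alpha^{\frac z2-1}\,{}_1F_1\left(\frac{1-z}{2};\frac12;\frac{w^2}{4}\right)$$ $$\qquad-\Gamma\left(-\frac z2\right)\zeta(-z)\pi^{\frac z2}\alpha^{-\frac z2-1}\,{}_1F_1\left(\frac{1+z}{2};\frac12;\frac{w^2}{4}\right)\Bigg)$$ $$=\sqrt{\beta}\,\Bigg(4\sum_{n=1}^{\infty}\sigma_{-z}(n)n^{\frac z2}e^{\frac{w^2}{4}}K_{\frac z2,w}(2n\pi\beta)-\Gamma\left(\frac z2\right)\zeta(z)\pi^{-\frac z2}\beta^{\frac z2-1}\,{}_1F_1\left(\frac{1-z}{2};\frac12;-\frac{w^2}{4}\right)$$ $$\qquad-\Gamma\left(-\frac z2\right)\zeta(-z)\pi^{\frac z2}\beta^{-\frac z2-1}\,{}_1F_1\left(\frac{1+z}{2};\frac12;-\frac{w^2}{4}\right)\Bigg).$$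
   Context: The generalized modified Bessel function is defined, for $z,w\in\mathbb{C}$, by $$K_{z,w}(x):=\frac{1}{2\pi i}\int_{c-i\infty}^{c+i\infty}\Gamma\left(\tfrac{s-z}{2}\right)\Gamma\left(\tfrac{s+z}{2}\right)\,{}_1F_1\left(\tfrac{s-z}{2};\tfrac12;-\tfrac{w^2}{4}\right){}_1F_1\left(\tfrac{s+z}{2};\tfrac12;-\tfrac{w^2}{4}\right)2^{s-2}x^{-s}\,ds,$$ where $c=\mathrm{Re}(s)>|\mathrm{Re}(z)|$. Here ${}_1F_1(a;c;u)=\sum_{n\ge0}\frac{(a)_n u^n}{(c)_n n!}$ with $(a)_n=a(a+1)\cdots(a+n-1)$. $\zeta$ is the Riemann zeta function and $\sigma_{-z}(n)=\sum_{d\mid n}d^{-z}$. At even integers $z$ (where gamma factors have poles) both sides have removable singularities as functions of $z$ and are understood as limits. *)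

theory Defs
  imports "HOL-Complex_Analysis.Complex_Analysis"
begin

(* The analytic continuation of the Dirichlet series to the complement of 1.  It is unique
   there by the identity theorem; the value at the pole is fixed to 0 by convention. *)
definition riemann_zeta :: "complex \<Rightarrow> complex" where
  "riemann_zeta = (THE f. f holomorphic_on (- {1}) \<and>
      (\<forall>s. Re s > 1 \<longrightarrow> f s = (\<Sum>n. 1 / of_nat (Suc n) powr s)) \<and> f 1 = 0)"

definition divisor_sigma :: "complex \<Rightarrow> nat \<Rightarrow> complex" where
  "divisor_sigma a n = (\<Sum>d | d dvd n. of_nat d powr a)"

definition hyp1F1 :: "complex \<Rightarrow> complex \<Rightarrow> complex \<Rightarrow> complex" where
  "hyp1F1 a c u = (\<Sum>n. pochhammer a n * u ^ n / (pochhammer c n * fact n))"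

definition bessel_integrand :: "complex \<Rightarrow> complex \<Rightarrow> real \<Rightarrow> complex \<Rightarrow> complex" where
  "bessel_integrand z w x s =
     Gamma ((s - z) / 2) * Gamma ((s + z) / 2) *
     hyp1F1 ((s - z) / 2) (1 / 2) (- w\<^sup>2 / 4) * hyp1F1 ((s + z) / 2) (1 / 2) (- w\<^sup>2 / 4) *
     2 powr (s - 2) * of_real x powr (- s)"

(* The integral along the vertical line Re s = c is parametrised by s = c + it, ds = i dt.
   It does not depend on the abscissa c > |Re z|, so the value is described as the common
   value of these integrals. *)
definition gen_bessel_K :: "complex \<Rightarrow> complex \<Rightarrow> real \<Rightarrow> complex" where
  "gen_bessel_K z w x = (THE v. \<forall>c::real. c > \<bar>Re z\<bar> \<longrightarrow>
     (\<exists>I. ((\<lambda>t::real. bessel_integrand z w x (Complex c t) * \<i>) has_integral I) UNIV \<and>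
          v = 1 / (2 * of_real pi * \<i>) * I))"

(* The n-th terms (n \<ge> 1) of the series on the two sides of the transformation formula. *)
definition left_term :: "complex \<Rightarrow> real \<Rightarrow> complex \<Rightarrow> nat \<Rightarrow> complex" where
  "left_term w \<alpha> z n = divisor_sigma (- z) n * of_nat n powr (z / 2) * exp (- w\<^sup>2 / 4) *
     gen_bessel_K (z / 2) (\<i> * w) (2 * real n * pi * \<alpha>)"

definition right_term :: "complex \<Rightarrow> real \<Rightarrow> complex \<Rightarrow> nat \<Rightarrow> complex" where
  "right_term w \<beta> z n = divisor_sigma (- z) n * of_nat n powr (z / 2) * exp (w\<^sup>2 / 4) *
     gen_bessel_K (z / 2) w (2 * real n * pi * \<beta>)"

(* At even integers z the expressions below do not have their intended value, since Gamma is
   totalised by 0 at its poles; there one has to take the limit in z. *)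
definition left_side :: "complex \<Rightarrow> real \<Rightarrow> complex \<Rightarrow> complex" where
  "left_side w \<alpha> z = of_real (sqrt \<alpha>) *
     (4 * (\<Sum>n. left_term w \<alpha> z (Suc n))
      - Gamma (z / 2) * riemann_zeta z * of_real pi powr (- z / 2) * of_real \<alpha> powr (z / 2 - 1) *
          hyp1F1 ((1 - z) / 2) (1 / 2) (w\<^sup>2 / 4)
      - Gamma (- z / 2) * riemann_zeta (- z) * of_real pi powr (z / 2) * of_real \<alpha> powr (- z / 2 - 1) *
          hyp1F1 ((1 + z) / 2) (1 / 2) (w\<^sup>2 / 4))"

definition right_side :: "complex \<Rightarrow> real \<Rightarrow> complex \<Rightarrow> complex" where
  "right_side w \<beta> z = of_real (sqrt \<beta>) *
     (4 * (\<Sum>n. right_term w \<beta> z (Suc n))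
      - Gamma (z / 2) * riemann_zeta z * of_real pi powr (- z / 2) * of_real \<beta> powr (z / 2 - 1) *
          hyp1F1 ((1 - z) / 2) (1 / 2) (- w\<^sup>2 / 4)
      - Gamma (- z / 2) * riemann_zeta (- z) * of_real pi powr (z / 2) * of_real \<beta> powr (- z / 2 - 1) *
          hyp1F1 ((1 + z) / 2) (1 / 2) (- w\<^sup>2 / 4))"

end

theory Submission
  imports Defs "HOL-Probability.Sinc_Integral"
    "HOL-Probability.Characteristic_Functions" "HOL-Real_Asymp.Real_Asymp"
begin

text \<open>
  Both sides of the formula are the same regularised Mellin transform of a product of two
  theta functions, and the substitution \<open>\<alpha> \<leftrightarrow> \<beta>\<close>, \<open>w \<leftrightarrow> \<i> w\<close> is the modular transformation of that
  product.

  Write \<open>f\<^sub>w(u) = exp (- \<pi> u\<^sup>2) cos (\<surd>\<pi> w u)\<close>, let \<open>\<psi>\<^sub>w(y)\<close> be the sum of \<open>f\<^sub>w(n y)\<close> over \<open>n \<ge> 1\<close>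
  (\<open>theta_tail\<close>) and \<open>\<theta>\<^sub>w = 1 + 2 \<psi>\<^sub>w\<close>, which is the sum of \<open>f\<^sub>w(n y)\<close> over all integers.  The Mellin
  transform of \<open>f\<^sub>w\<close> at \<open>s\<close> is \<open>\<pi>\<close> to the power \<open>- s / 2\<close> times \<open>\<Gamma>(s/2) \<^sub>1F\<^sub>1(s/2; 1/2; - w\<^sup>2/4) / 2\<close>
  (\<open>mellin_gauss_cos\<close>).  The integrand that defines the generalized Bessel function is
  therefore a product of two such transforms, and by Mellin inversion the function itself is a
  multiplicative convolution of \<open>f\<^sub>w\<close> with itself (\<open>gen_bessel_K_eq\<close>).  Writing every \<open>n\<close> as
  \<open>d * m\<close> then turns the divisor series, up to a factor \<open>exp (w\<^sup>2/4)\<close>,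
  into \<open>\<integral> \<psi>\<^sub>w(c v) \<psi>\<^sub>w(c / v) v\<^sup>z dv / v\<close> over \<open>v > 0\<close>, with
  \<open>c = \<surd>\<beta>\<close> (\<open>right_term_sums\<close>).  Each factor is rapidly decreasing at
  one end and of polynomial growth at the other, so this integral is entire in \<open>z\<close>.

  Poisson summation gives \<open>\<theta>\<^sub>w(y) = exp (- w\<^sup>2/4) / y \<theta>\<^bsub>\<i>w\<^esub>(1/y)\<close> (\<open>theta_transformation\<close>).  Hence
  \<open>c exp (w\<^sup>2/4) \<theta>\<^sub>w(c v) \<theta>\<^sub>w(c / v)\<close> does not change under \<open>w \<mapsto> \<i> w\<close>, \<open>c \<mapsto> 1 / c\<close>.  Expand
  \<open>\<psi> = (\<theta> - 1) / 2\<close> in the two integrands: the products of theta functions cancel, and the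
  difference is linear in \<open>\<psi>\<^sub>w(c v)\<close> and \<open>\<psi>\<^bsub>\<i>w\<^esub>(v / c)\<close> (\<open>theta_product_difference\<close>).  For \<open>Re z > 1\<close> the
  linear terms can be integrated one by one.  This produces Mellin transforms of \<open>\<psi>\<close>, that is,
  values of an entire function \<open>\<xi>\<^sub>w\<close> (\<open>xi\<close>), which Riemann's splitting of the integral constructs
  together with \<open>\<xi>\<^sub>w(s) = exp (- w\<^sup>2/4) \<xi>\<^bsub>\<i>w\<^esub>(1 - s)\<close>.  The identity theorem carries the resulting relation to all
  \<open>z\<close> (\<open>theta_product_functional_equation\<close>).

  It remains to recognise the subtracted terms.  The identity theorem also gives
  \<open>\<xi>\<^sub>w(s) = \<^sub>1F\<^sub>1(s/2; 1/2; - w\<^sup>2/4) \<xi>\<^sub>0(s)\<close> for all \<open>s\<close>, and \<open>\<xi>\<^sub>0\<close> is, up to elementary factors, Riemann's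
  completed zeta function; this provides the analytic continuation of \<open>\<zeta>\<close>.  Comparing the two
  descriptions of \<open>\<xi>\<^sub>w(1 - z)\<close> plays the part of Kummer's transformation of \<open>\<^sub>1F\<^sub>1\<close>.  Each side of
  the formula becomes an entire function minus \<open>R(z) / (z (z - 1) (z + 1))\<close> with \<open>R\<close> entire
  (\<open>right_side_eq\<close>), and \<open>R(0) = 0\<close>; so the even integers are removable singularities and only
  \<open>z = 1\<close> and \<open>z = - 1\<close> have to be excluded.

  All integrals over \<open>v > 0\<close> are written over the whole line with \<open>v = exp r\<close>: scaling then is
  translation, and a Mellin transform on a vertical line is literally a Fourier transform.
\<close>

section \<open>Integrals over the real line\<close>

lemma integrable_majorant:
  fixes f :: "'a \<Rightarrow> 'b :: {banach, second_countable_topology}" and g :: "'a \<Rightarrow> real"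
  assumes "integrable M g" "f \<in> borel_measurable M" "\<And>x. norm (f x) \<le> g x"
  shows "integrable M f"
proof (rule Bochner_Integration.integrable_bound[OF assms(1,2)])
  have "norm (f x) \<le> norm (g x)" for x
    using assms(3)[of x] by simp
  then show "AE x in M. norm (f x) \<le> norm (g x)" by simp
qed

text \<open>
  Comparison with \<open>1 / (1 + t\<^sup>2)\<close>.  In this form the integrability of a concrete function is left
  to the asymptotic expansion of its two limits.
\<close>
lemma integrable_of_decay:
  fixes g :: "real \<Rightarrow> real"
  assumes cont: "continuous_on UNIV g"
    and top: "((\<lambda>t. g t * (1 + t\<^sup>2)) \<longlongrightarrow> 0) at_top"
    and bot: "((\<lambda>t. g t * (1 + t\<^sup>2)) \<longlongrightarrow> 0) at_bot"
  shows "integrable lborel g"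
proof -
  have "\<forall>\<^sub>F t in at_top. dist (g t * (1 + t\<^sup>2)) 0 < 1" "\<forall>\<^sub>F t in at_bot. dist (g t * (1 + t\<^sup>2)) 0 < 1"
    using tendstoD[OF top, of 1] tendstoD[OF bot, of 1] by auto
  then obtain N M where N: "\<And>t. t \<ge> N \<Longrightarrow> \<bar>g t * (1 + t\<^sup>2)\<bar> < 1" and M: "\<And>t. t \<le> M \<Longrightarrow> \<bar>g t * (1 + t\<^sup>2)\<bar> < 1"
    unfolding eventually_at_top_linorder eventually_at_bot_linorder by auto
  have "continuous_on {M..N} (\<lambda>t. g t * (1 + t\<^sup>2))"
    by (intro continuous_intros continuous_on_subset[OF cont]) auto
  then have "bounded ((\<lambda>t. g t * (1 + t\<^sup>2)) ` {M..N})"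
    by (intro compact_imp_bounded compact_continuous_image) auto
  then have "\<exists>B. \<forall>t\<in>{M..N}. \<bar>g t * (1 + t\<^sup>2)\<bar> \<le> B"
    unfolding bounded_iff by simp
  then obtain B where B: "\<And>t. t \<in> {M..N} \<Longrightarrow> \<bar>g t * (1 + t\<^sup>2)\<bar> \<le> B"
    by blast
  have *: "\<bar>g t * (1 + t\<^sup>2)\<bar> \<le> max B 1" for t
    using B[of t] N[of t] M[of t] by (cases "t \<ge> N"; cases "t \<le> M") (auto simp: max_def)
  have pos: "(0::real) < 1 + t\<^sup>2" for t :: real
    by (simp add: add_pos_nonneg)
  have bound: "norm (g t) \<le> max B 1 * inverse (1 + t\<^sup>2)" for t
    using *[of t] pos[of t] by (simp add: abs_mult field_simps)
  have "integrable lborel (\<lambda>t::real. max B 1 * inverse (1 + t\<^sup>2))"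
    using integrable_inverse_1_plus_square by (simp add: set_integrable_def)
  then show ?thesis
    by (rule integrable_majorant) (use bound borel_measurable_continuous_onI[OF cont] in auto)
qed

lemma integrable_one_sided_majorant:
  fixes \<sigma> c :: real
  assumes "\<sigma> > 0" "c > 0"
  shows "integrable lborel (\<lambda>r. exp (- c * exp (2 * r)) * exp (\<sigma> * r))"
proof (rule integrable_of_decay)
  show "((\<lambda>t. exp (- c * exp (2 * t)) * exp (\<sigma> * t) * (1 + t\<^sup>2)) \<longlongrightarrow> 0) at_top"
    using assms by real_asymp
  show "((\<lambda>t. exp (- c * exp (2 * t)) * exp (\<sigma> * t) * (1 + t\<^sup>2)) \<longlongrightarrow> 0) at_bot"
    using assms by real_asymp
qed (intro continuous_intros)

lemma integrable_two_sided_majorant: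
  fixes \<sigma> c :: real
  assumes "c > 0"
  shows "integrable lborel (\<lambda>r. exp (- c * exp (2 * r)) * exp (- c * exp (- 2 * r)) * exp (\<sigma> * r))"
proof (rule integrable_of_decay)
  show "((\<lambda>t. exp (- c * exp (2 * t)) * exp (- c * exp (- 2 * t)) * exp (\<sigma> * t) * (1 + t\<^sup>2)) \<longlongrightarrow> 0) at_top"
    using assms by real_asymp
  show "((\<lambda>t. exp (- c * exp (2 * t)) * exp (- c * exp (- 2 * t)) * exp (\<sigma> * t) * (1 + t\<^sup>2)) \<longlongrightarrow> 0) at_bot"
    using assms by real_asymp
qed (intro continuous_intros)

text \<open>
  Expanding \<open>exp (s r)\<close> in powers of \<open>s\<close> under the integral, with majorant
  \<open>norm (h r) * exp (norm s * \<bar>r\<bar>)\<close>, exhibits the transform as a power series that converges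
  everywhere.  This avoids any differentiation under the integral sign.
\<close>
lemma bilateral_laplace:
  fixes h :: "real \<Rightarrow> complex"
  assumes int: "\<And>\<sigma>::real. integrable lborel (\<lambda>r. h r * of_real (exp (\<sigma> * r)))"
  shows bilateral_laplace_integrable: "integrable lborel (\<lambda>r. h r * exp (s * of_real r))"
    and bilateral_laplace_entire: "(\<lambda>s. LBINT r. h r * exp (s * of_real r)) holomorphic_on UNIV"
proof -
  have [measurable]: "h \<in> borel_measurable borel"
    using int[of 0] by simp
  show *: "integrable lborel (\<lambda>r. h r * exp (s * of_real r))" for s
    by (rule Bochner_Integration.integrable_bound[OF int[of "Re s"]]) (auto simp: norm_mult)
  have sums: "(\<lambda>n. (LBINT r. h r * of_real r ^ n) / fact n * (s - 0) ^ n) sums (LBINT r. h r * exp (s * of_real r))" for s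
  proof -
    define W where "W = (\<lambda>r. norm (h r) * exp (norm s * r) + norm (h r) * exp (- norm s * r))"
    have W: "integrable lborel W"
      using integrable_norm[OF int[of "norm s"]] integrable_norm[OF int[of "- norm s"]]
      unfolding W_def by (intro Bochner_Integration.integrable_add) (auto simp: norm_mult)
    have expW: "norm (h r) * exp (norm s * \<bar>r\<bar>) \<le> W r" for r
      unfolding W_def by (cases "r \<ge> 0") auto
    have sum_le: "(\<Sum>n\<in>F. norm (h r * (s * of_real r) ^ n /\<^sub>R fact n)) \<le> W r" if "finite F" for F r
    proof -
      have "(\<Sum>n\<in>F. (norm s * \<bar>r\<bar>) ^ n /\<^sub>R fact n) \<le> exp (norm s * \<bar>r\<bar>)"
        unfolding exp_def by (rule sum_le_suminf[OF _ that]) (auto simp: summable_exp)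
      then have "norm (h r) * (\<Sum>n\<in>F. (norm s * \<bar>r\<bar>) ^ n /\<^sub>R fact n) \<le> norm (h r) * exp (norm s * \<bar>r\<bar>)"
        by (intro mult_left_mono) auto
      also have "norm (h r) * (\<Sum>n\<in>F. (norm s * \<bar>r\<bar>) ^ n /\<^sub>R fact n) = (\<Sum>n\<in>F. norm (h r * (s * of_real r) ^ n /\<^sub>R fact n))"
        unfolding sum_distrib_left by (intro sum.cong) (auto simp: norm_mult norm_power)
      finally show ?thesis
        using expW[of r] by (rule order_trans)
    qed
    have term_le: "norm (h r * (s * of_real r) ^ n /\<^sub>R fact n) \<le> W r" for n r
      using sum_le[of "{n}" r] by simp
    have part_le: "norm (\<Sum>n<N. h r * (s * of_real r) ^ n /\<^sub>R fact n) \<le> W r" for N r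
      by (rule order_trans[OF norm_sum sum_le]) simp
    have intn: "integrable lborel (\<lambda>r. h r * (s * of_real r) ^ n /\<^sub>R fact n)" for n
      by (rule integrable_majorant[OF W _ term_le]) simp
    have "(\<lambda>N. LBINT r. (\<Sum>n<N. h r * (s * of_real r) ^ n /\<^sub>R fact n)) \<longlonglongrightarrow> (LBINT r. h r * exp (s * of_real r))"
    proof (rule integral_dominated_convergence[OF _ _ W])
      have "(\<lambda>n. h r * ((s * of_real r) ^ n /\<^sub>R fact n)) sums (h r * exp (s * of_real r))" for r
        by (intro sums_mult exp_converges)
      then show "AE r in lborel. (\<lambda>N. \<Sum>n<N. h r * (s * of_real r) ^ n /\<^sub>R fact n) \<longlonglongrightarrow> h r * exp (s * of_real r)"
        by (simp add: sums_def)
    qed (use part_le in auto)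
    then have "(\<lambda>n. LBINT r. h r * (s * of_real r) ^ n /\<^sub>R fact n) sums (LBINT r. h r * exp (s * of_real r))"
      unfolding sums_def using intn by (subst (asm) Bochner_Integration.integral_sum) auto
    moreover have "(LBINT r. h r * (s * of_real r) ^ n /\<^sub>R fact n) = (LBINT r. h r * of_real r ^ n) / fact n * s ^ n" for n
    proof -
      have "(LBINT r. h r * (s * of_real r) ^ n /\<^sub>R fact n) = (LBINT r. (s ^ n / fact n) * (h r * of_real r ^ n))"
        by (intro Bochner_Integration.integral_cong) (auto simp: power_mult_distrib scaleR_conv_of_real field_simps)
      then show ?thesis by simp
    qed
    ultimately show ?thesis by simp
  qed
  have "(\<lambda>s. LBINT r. h r * exp (s * of_real r)) holomorphic_on ball 0 r" for r
    by (rule power_series_holomorphic[OF sums])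
  then have "(\<lambda>s. LBINT r. h r * exp (s * of_real r)) field_differentiable at z" for z
    by (rule holomorphic_on_imp_differentiable_at[of _ "ball 0 (norm z + 1)"]) auto
  then show "(\<lambda>s. LBINT r. h r * exp (s * of_real r)) holomorphic_on UNIV"
    by (simp add: holomorphic_on_def)
qed

section \<open>Fourier inversion\<close>

lemma integrable_pair_mult:
  fixes f g :: "real \<Rightarrow> complex"
  assumes f: "integrable lborel f" and g: "integrable lborel g"
  shows "integrable (lborel \<Otimes>\<^sub>M lborel) (\<lambda>(x, y). f x * g y)"
proof (rule lborel_pair.Fubini_integrable)
  have [measurable]: "f \<in> borel_measurable borel" "g \<in> borel_measurable borel"
    using f g by auto
  show "(\<lambda>(x, y). f x * g y) \<in> borel_measurable (lborel \<Otimes>\<^sub>M lborel)"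
    by measurable
  show "integrable lborel (\<lambda>x. LBINT y. norm (case (x, y) of (x, y) \<Rightarrow> f x * g y))"
    using f by (simp add: norm_mult)
  show "AE x in lborel. integrable lborel (\<lambda>y. case (x, y) of (x, y) \<Rightarrow> f x * g y)"
    using g by simp
qed

lemma gaussian_fourier:
  fixes a :: real
  shows "integrable lborel (\<lambda>t. exp (- (of_real t)\<^sup>2 / 2) * cis (t * a))" (is ?A)
    and "(LBINT t. exp (- (of_real t)\<^sup>2 / 2) * cis (t * a)) = of_real (sqrt (2 * pi)) * exp (- (of_real a)\<^sup>2 / 2)" (is ?B)
proof -
  have eq: "exp (- (of_real t)\<^sup>2 / 2) = complex_of_real (sqrt (2 * pi) * std_normal_density t)" for t :: real
    by (simp add: std_normal_density_def exp_of_real[symmetric])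
  have 0: "integrable lborel (\<lambda>t. complex_of_real (std_normal_density t) * cis (t * a))"
    by (rule Bochner_Integration.integrable_bound[of _ "std_normal_density"]) (auto simp: norm_mult cis_conv_exp)
  have "char std_normal_distribution a = (LBINT t. std_normal_density t *\<^sub>R iexp (a * t))"
    unfolding char_def by (subst integral_density) auto
  also have "\<dots> = (LBINT t. complex_of_real (std_normal_density t) * cis (t * a))"
    by (simp add: cis_conv_exp scaleR_conv_of_real mult_ac)
  finally have 1: "(LBINT t. complex_of_real (std_normal_density t) * cis (t * a)) = exp (- (of_real a)\<^sup>2 / 2)"
    by (simp add: char_std_normal_distribution exp_of_real[symmetric])
  show ?A using integrable_mult_right[OF 0, of "of_real (sqrt (2 * pi))"] unfolding eq by (simp add: mult_ac)
  show ?B using 1 unfolding eq[of "_"] by (simp add: mult.assoc eq[symmetric])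
qed

text \<open>
  Gaussian regularisation.  Multiplying the transform by \<open>exp (- (\<epsilon> t)\<^sup>2 / 2)\<close> makes Fubini's theorem
  applicable and replaces \<open>\<phi> x\<close> by an average of \<open>\<phi>\<close> against a Gaussian of width \<open>\<epsilon>\<close> around
  \<open>x\<close>; both sides converge as \<open>\<epsilon> \<rightarrow> 0\<close>, by domination with the transform itself and with the
  bound \<open>B\<close>.
\<close>
lemma fourier_inversion:
  fixes \<phi> :: "real \<Rightarrow> complex" and x :: real
  assumes cont: "continuous_on UNIV \<phi>" and int: "integrable lborel \<phi>"
    and bdd: "\<And>r. norm (\<phi> r) \<le> B"
    and int': "integrable lborel (\<lambda>t. LBINT r. \<phi> r * cis (t * r))"
  shows "(LBINT t. (LBINT r. \<phi> r * cis (t * r)) * cis (- t * x)) = of_real (2 * pi) * \<phi> x"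
proof -
  define \<Phi> where "\<Phi> = (\<lambda>t. LBINT r. \<phi> r * cis (t * r))"
  have [measurable]: "\<phi> \<in> borel_measurable borel"
    using cont by (rule borel_measurable_continuous_onI)
  have [measurable]: "\<Phi> \<in> borel_measurable borel"
    using int' unfolding \<Phi>_def by auto
  have mcis[measurable]: "cis \<in> borel_measurable borel"
    by (rule borel_measurable_continuous_onI) (auto simp: cis_conv_exp intro!: continuous_intros)
  define G where "G = (\<lambda>t::real. exp (- (complex_of_real t)\<^sup>2 / 2))"
  have [measurable]: "G \<in> borel_measurable borel"
    unfolding G_def by (rule borel_measurable_continuous_onI) (auto intro!: continuous_intros)
  have G_norm: "norm (G t) \<le> 1" for t
    unfolding G_def by simp
  have intG: "integrable lborel G"
    using gaussian_fourier(1)[of 0] by (simp add: G_def)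
  have smooth: "(LBINT t. \<Phi> t * cis (- t * x) * G (\<epsilon> * t)) =
      of_real (sqrt (2 * pi)) * (LBINT \<sigma>. \<phi> (x + \<epsilon> * \<sigma>) * G \<sigma>)" if "\<epsilon> > 0" for \<epsilon>
  proof -
    have intGe: "integrable lborel (\<lambda>t. G (\<epsilon> * t))"
      using lborel_integrable_real_affine[OF intG, of \<epsilon> 0] that by simp
    let ?K = "\<lambda>t. cis (- t * x) * G (\<epsilon> * t)"
    have "(LBINT t. \<Phi> t * cis (- t * x) * G (\<epsilon> * t)) =
       (LBINT t. LBINT r. \<phi> r * cis (t * r) * ?K t)"
      proof (rule Bochner_Integration.integral_cong[OF refl])
      fix t :: real
      show "\<Phi> t * cis (- t * x) * G (\<epsilon> * t) = (LBINT r. \<phi> r * cis (t * r) * ?K t)"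
        unfolding \<Phi>_def integral_mult_left_zero by (rule mult.assoc)
    qed
    also have "\<dots> = (LBINT r. LBINT t. \<phi> r * cis (t * r) * ?K t)"
    proof (rule lborel_pair.Fubini_integral)
      show "integrable (lborel \<Otimes>\<^sub>M lborel) (\<lambda>(r, t). \<phi> r * cis (t * r) * ?K t)"
        by (rule Bochner_Integration.integrable_bound[OF integrable_pair_mult[OF int intGe]])
          (auto simp: norm_mult)
    qed
    also have "\<dots> = (LBINT r. \<phi> r * (of_real (sqrt (2 * pi) / \<epsilon>) * G ((r - x) / \<epsilon>)))"
    proof (rule Bochner_Integration.integral_cong[OF refl])
      fix r :: real
      have "(LBINT t. cis (t * (r - x)) * G (\<epsilon> * t)) =
          of_real (1 / \<epsilon>) * (LBINT t. G t * cis (t * ((r - x) / \<epsilon>)))"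
        using lborel_integral_real_affine[of "1 / \<epsilon>" "\<lambda>t. cis (t * (r - x)) * G (\<epsilon> * t)" 0] that
        by (simp add: mult_ac scaleR_conv_of_real)
      also have "\<dots> = of_real (sqrt (2 * pi) / \<epsilon>) * G ((r - x) / \<epsilon>)"
        using gaussian_fourier(2)[of "(r - x) / \<epsilon>"] by (simp add: G_def)
      finally have *: "(LBINT t. cis (t * (r - x)) * G (\<epsilon> * t)) = of_real (sqrt (2 * pi) / \<epsilon>) * G ((r - x) / \<epsilon>)" .
      have "\<phi> r * cis (t * r) * ?K t = \<phi> r * (cis (t * (r - x)) * G (\<epsilon> * t))" for t
      proof -
        have "cis (t * (r - x)) = cis (t * r) * cis (- t * x)"
          by (simp add: cis_mult right_diff_distrib)
        then show ?thesis by (simp only: mult.assoc)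
      qed
      then show "(LBINT t. \<phi> r * cis (t * r) * ?K t) =
          \<phi> r * (of_real (sqrt (2 * pi) / \<epsilon>) * G ((r - x) / \<epsilon>))"
        by (simp only: integral_mult_right_zero *)
    qed
    also have "\<dots> = of_real (sqrt (2 * pi)) * (LBINT \<sigma>. \<phi> (x + \<epsilon> * \<sigma>) * G \<sigma>)"
    proof -
      have "(\<lambda>\<sigma>. \<phi> (x + \<epsilon> * \<sigma>) * (of_real (sqrt (2 * pi) / \<epsilon>) * G ((x + \<epsilon> * \<sigma> - x) / \<epsilon>))) =
          (\<lambda>\<sigma>. of_real (sqrt (2 * pi) / \<epsilon>) * (\<phi> (x + \<epsilon> * \<sigma>) * G \<sigma>))"
        using that by (intro ext) simp
      then show ?thesis
        using lborel_integral_real_affine[of \<epsilon> "\<lambda>r. \<phi> r * (of_real (sqrt (2 * pi) / \<epsilon>) * G ((r - x) / \<epsilon>))" x] that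
        by (simp add: scaleR_conv_of_real)
    qed
    finally show ?thesis .
  qed
  define \<epsilon> where "\<epsilon> = (\<lambda>n. 1 / real (Suc n))"
  have \<epsilon>: "\<epsilon> n > 0" "\<epsilon> \<longlonglongrightarrow> 0" for n
    unfolding \<epsilon>_def by simp (real_asymp)
  have "(\<lambda>n. LBINT t. \<Phi> t * cis (- t * x) * G (\<epsilon> n * t)) \<longlonglongrightarrow> (LBINT t. \<Phi> t * cis (- t * x))"
  proof (rule integral_dominated_convergence[where w="\<lambda>t. norm (\<Phi> t)"])
    show "integrable lborel (\<lambda>t. norm (\<Phi> t))"
      using int' unfolding \<Phi>_def by (rule integrable_norm)
    have "(\<lambda>n. G (\<epsilon> n * t)) \<longlonglongrightarrow> exp (- (complex_of_real (0 * t))\<^sup>2 / 2)" for t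
      unfolding G_def by (intro tendsto_intros \<epsilon>) auto
    then have "(\<lambda>n. \<Phi> t * cis (- t * x) * G (\<epsilon> n * t)) \<longlonglongrightarrow> \<Phi> t * cis (- t * x) * 1" for t
      by (intro tendsto_mult tendsto_const) simp
    then show "AE t in lborel. (\<lambda>n. \<Phi> t * cis (- t * x) * G (\<epsilon> n * t)) \<longlonglongrightarrow> \<Phi> t * cis (- t * x)"
      by simp
    show "AE t in lborel. norm (\<Phi> t * cis (- t * x) * G (\<epsilon> n * t)) \<le> norm (\<Phi> t)" for n
      using mult_left_mono[OF G_norm norm_ge_zero] by (auto simp: norm_mult)
  qed auto
  moreover have "(\<lambda>n. LBINT \<sigma>. \<phi> (x + \<epsilon> n * \<sigma>) * G \<sigma>) \<longlonglongrightarrow> (LBINT \<sigma>. \<phi> x * G \<sigma>)"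
  proof (rule integral_dominated_convergence[where w="\<lambda>\<sigma>. B * norm (G \<sigma>)"])
    show "integrable lborel (\<lambda>\<sigma>. B * norm (G \<sigma>))"
      using intG by simp
    have "(\<lambda>n. \<phi> (x + \<epsilon> n * \<sigma>)) \<longlonglongrightarrow> \<phi> x" for \<sigma>
    proof -
      have "(\<lambda>n. x + \<epsilon> n * \<sigma>) \<longlonglongrightarrow> x + 0 * \<sigma>"
        by (intro tendsto_intros \<epsilon>)
      then show ?thesis
        using continuous_on_tendsto_compose[OF cont] by auto
    qed
    then show "AE \<sigma> in lborel. (\<lambda>n. \<phi> (x + \<epsilon> n * \<sigma>) * G \<sigma>) \<longlonglongrightarrow> \<phi> x * G \<sigma>"
      by (auto intro!: tendsto_intros)
    show "AE \<sigma> in lborel. norm (\<phi> (x + \<epsilon> n * \<sigma>) * G \<sigma>) \<le> B * norm (G \<sigma>)" for n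
      using bdd by (auto simp: norm_mult intro!: mult_right_mono)
  qed auto
  then have "(\<lambda>n. of_real (sqrt (2 * pi)) * (LBINT \<sigma>. \<phi> (x + \<epsilon> n * \<sigma>) * G \<sigma>)) \<longlonglongrightarrow>
      of_real (sqrt (2 * pi)) * (LBINT \<sigma>. \<phi> x * G \<sigma>)"
    by (intro tendsto_intros)
  ultimately have "(LBINT t. \<Phi> t * cis (- t * x)) = of_real (sqrt (2 * pi)) * (LBINT \<sigma>. \<phi> x * G \<sigma>)"
    unfolding smooth[OF \<epsilon>(1)] by (rule LIMSEQ_unique)
  also have "(LBINT \<sigma>. \<phi> x * G \<sigma>) = \<phi> x * (LBINT \<sigma>. G \<sigma>)"
    by simp
  also have "(LBINT \<sigma>. G \<sigma>) = of_real (sqrt (2 * pi))"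
    using gaussian_fourier(2)[of 0] by (simp add: G_def)
  finally show ?thesis
    unfolding \<Phi>_def by (simp add: mult_ac flip: of_real_mult)
qed

section \<open>Complex powers, the Gamma function and Kummer functions\<close>

lemma powr_of_real_eq_exp:
  fixes c :: real and s :: complex
  assumes "c > 0"
  shows "of_real c powr s = exp (s * of_real (ln c))"
  using assms by (simp add: powr_def Ln_of_real)

lemma powr_square:
  fixes c :: real and s :: complex
  assumes "c > 0"
  shows "of_real (c\<^sup>2) powr s = of_real c powr (2 * s)"
proof -
  have "c\<^sup>2 > 0" using assms by simp
  then show ?thesis
    using assms by (simp only: powr_of_real_eq_exp) (simp add: ln_realpow mult_ac)
qed

lemma powr_reciprocal:
  fixes c :: real and s :: complex
  assumes "c > 0"
  shows "of_real (1 / c) powr s = of_real c powr (- s)"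
proof -
  have "1 / c > 0" using assms by simp
  then show ?thesis
    using assms by (simp only: powr_of_real_eq_exp) (simp add: ln_div)
qed

lemma Re_pos_not_nonpos_Int: "Re z > 0 \<Longrightarrow> z \<notin> \<int>\<^sub>\<le>\<^sub>0"
  by (auto elim!: nonpos_Ints_cases)

lemma Gamma_mult_rGamma_plus1:
  assumes "a \<notin> \<int>\<^sub>\<le>\<^sub>0"
  shows "Gamma a * rGamma (a + 1) = 1 / (a :: complex)"
proof -
  have "a \<noteq> 0" using assms by auto
  then show ?thesis
    using Gamma_plus1[of a] assms by (simp add: rGamma_inverse_Gamma Gamma_eq_zero_iff field_simps)
qed

text \<open>
  On \<open>norm a \<le> R\<close> the terms are dominated by those with parameter \<open>R\<close>, whose ratios tend to 0.
\<close>
lemma hyp1F1_entire: "(\<lambda>a. hyp1F1 a (1 / 2) u) holomorphic_on A"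
proof -
  define f where "f = (\<lambda>n a. pochhammer a n * u ^ n / (pochhammer (1 / 2) n * fact n) :: complex)"
  have half: "norm (pochhammer (1 / 2 :: complex) n) = pochhammer (1 / 2) n" for n
  proof -
    have "pochhammer (1 / 2 :: complex) n = of_real (pochhammer (1 / 2) n)"
      using pochhammer_of_real[of "1 / 2" n, where 'a = complex] by simp
    then show ?thesis by (simp add: pochhammer_nonneg)
  qed
  have poch_le: "norm (pochhammer a n) \<le> pochhammer R n" if "norm a \<le> R" for a :: complex and R n
    unfolding pochhammer_prod prod_norm[symmetric]
  proof (rule prod_mono, intro conjI)
    show "norm (a + of_nat i) \<le> R + of_nat i" for i
      using norm_triangle_ineq[of a "of_nat i"] that by simp
  qed auto
  have unif: "uniform_limit (cball 0 R) (\<lambda>N a. \<Sum>n<N. f n a) (\<lambda>a. \<Sum>n. f n a) sequentially" if R: "R > 0" for R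
  proof (rule Weierstrass_m_test)
    define M where "M = (\<lambda>n. pochhammer R n * norm u ^ n / (pochhammer (1 / 2) n * fact n))"
    show "norm (f n a) \<le> M n" if "a \<in> cball 0 R" for n a
      using that poch_le[of a R n] unfolding f_def M_def
      by (auto simp: norm_mult norm_divide norm_power half intro!: divide_right_mono mult_right_mono pochhammer_nonneg mult_nonneg_nonneg)
    show "summable M"
    proof -
      have pos: "pochhammer (1 / 2 :: real) n > 0" for n by (rule pochhammer_pos) simp
      \<comment> \<open>\<open>q\<close> is the ratio of consecutive terms of \<open>M\<close>.\<close>
      define q where "q = (\<lambda>n. (R + real n) * norm u / ((1 / 2 + real n) * (real n + 1)))"
      have "q \<longlonglongrightarrow> 0"
        unfolding q_def by real_asymp
      then have "\<forall>\<^sub>F n in sequentially. q n < 1 / 2"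
        by (rule order_tendstoD) simp
      then obtain N where N: "\<And>n. n \<ge> N \<Longrightarrow> q n < 1 / 2"
        unfolding eventually_sequentially by blast
      have step: "M (Suc n) = q n * M n" for n
        unfolding M_def q_def pochhammer_Suc power_Suc fact_Suc using pos[of n] by (simp add: field_simps)
      have q0: "q n \<ge> 0" for n
        using R by (simp add: q_def)
      show ?thesis
      proof (rule summable_ratio_test)
        show "norm (M (Suc n)) \<le> 1 / 2 * norm (M n)" if "n \<ge> N" for n
          unfolding step norm_mult using N[OF that] q0[of n] by (intro mult_right_mono) auto
      qed simp
    qed
  qed
  have "(\<lambda>a. \<Sum>n. f n a) holomorphic_on UNIV"
  proof (rule holomorphic_uniform_sequence)
    show "(\<lambda>a. \<Sum>n<N. f n a) holomorphic_on UNIV" for N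
      unfolding f_def pochhammer_prod by (intro holomorphic_intros) (auto simp: pochhammer_eq_0_iff pochhammer_prod[symmetric])
    show "\<exists>d>0. cball z d \<subseteq> UNIV \<and> uniform_limit (cball z d) (\<lambda>N a. \<Sum>n<N. f n a) (\<lambda>a. \<Sum>n. f n a) sequentially" for z
    proof (intro exI[of _ 1] conjI)
      have "cball z 1 \<subseteq> cball 0 (norm z + 1)"
        unfolding cball_subset_cball_iff by (simp add: dist_norm)
      then show "uniform_limit (cball z 1) (\<lambda>N a. \<Sum>n<N. f n a) (\<lambda>a. \<Sum>n. f n a) sequentially"
        by (rule uniform_limit_on_subset[OF unif, rotated]) (simp add: add_nonneg_pos)
    qed auto
  qed auto
  then show ?thesis
    unfolding hyp1F1_def f_def by (rule holomorphic_on_subset) simp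
qed

lemma hyp1F1_zero: "hyp1F1 a c 0 = 1"
proof -
  have "(\<Sum>n. pochhammer a n * 0 ^ n / (pochhammer c n * fact n)) = (\<Sum>n\<in>{0}. pochhammer a n * 0 ^ n / (pochhammer c n * fact n))"
    by (rule suminf_finite) auto
  then show ?thesis by (simp add: hyp1F1_def)
qed

text \<open>
  Every relation below is first proved where the Dirichlet series converges, and then holds
  everywhere once its poles have been multiplied away.
\<close>
lemma right_half_plane_identity:
  assumes "f holomorphic_on UNIV" "g holomorphic_on UNIV" "\<And>s. Re s > 1 \<Longrightarrow> f s = g s"
  shows "f s = g s"
proof (rule analytic_continuation_open[of "{s. Re s > 1}" UNIV f g])
  show "{s. Re s > 1} \<noteq> {}" by (auto intro: exI[of _ 2])
qed (use assms in \<open>auto simp: open_halfspace_Re_gt\<close>)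

section \<open>The Mellin transform of a Gaussian times a cosine\<close>

text \<open>
  The usual Mellin transform, the integral of \<open>f(u)\<close> times the power \<open>s - 1\<close> of \<open>u\<close> over \<open>u > 0\<close>,
  after the substitution \<open>u = exp r\<close>.
\<close>
definition mellin :: "(real \<Rightarrow> complex) \<Rightarrow> complex \<Rightarrow> complex" where
  "mellin f s = (LBINT r. f (exp r) * exp (s * of_real r))"

lemma mellin_integrable:
  fixes f :: "real \<Rightarrow> complex"
  assumes [measurable]: "f \<in> borel_measurable borel"
    and bound: "\<And>u. norm (f u) \<le> C * exp (- 2 * u\<^sup>2)" and s: "Re s > 0"
  shows "integrable lborel (\<lambda>r. f (exp r) * exp (s * of_real r))"
proof (rule integrable_majorant)
  show "integrable lborel (\<lambda>r. C * exp (- 2 * exp (2 * r)) * exp (Re s * r))"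
    using integrable_one_sided_majorant[of "Re s" 2] s by (simp add: mult.assoc)
  show "norm (f (exp r) * exp (s * of_real r)) \<le> C * exp (- 2 * exp (2 * r)) * exp (Re s * r)" for r
    using mult_right_mono[OF bound[of "exp r"], of "exp (Re s * r)"] by (simp add: norm_mult exp_double)
qed simp

text \<open>
  Integration by parts; the boundary terms vanish at \<open>- \<infinity>\<close> because \<open>Re s > 0\<close> and at \<open>\<infinity>\<close> by the
  Gaussian decay of \<open>f\<close>.
\<close>
lemma mellin_derivative:
  fixes f f' :: "real \<Rightarrow> complex"
  assumes deriv: "\<And>u. (f has_vector_derivative f' u) (at u)" and cont: "continuous_on UNIV f'"
    and bound: "\<And>u. norm (f u) \<le> C * exp (- 2 * u\<^sup>2)" and bound': "\<And>u. norm (f' u) \<le> C' * exp (- 2 * u\<^sup>2)"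
    and s: "Re s > 0"
  shows "s * mellin f s = - mellin f' (s + 1)"
proof -
  have contf: "continuous_on UNIV f"
    using deriv has_vector_derivative_continuous by (force simp: continuous_on_eq_continuous_at)
  have [measurable]: "f \<in> borel_measurable borel" "f' \<in> borel_measurable borel"
    using contf cont by (auto intro: borel_measurable_continuous_onI)
  define F where "F = (\<lambda>r::real. f (exp r) * exp (s * of_real r))"
  define F' where "F' = (\<lambda>r::real. f' (exp r) * exp ((s + 1) * of_real r) + s * (f (exp r) * exp (s * of_real r)))"
  have "((\<lambda>r. f (exp r)) has_vector_derivative (exp r *\<^sub>R f' (exp r))) (at r)" for r :: real
    using vector_diff_chain_at[of exp "exp r" r f "f' (exp r)"] deriv
    by (simp add: o_def DERIV_exp has_real_derivative_iff_has_vector_derivative[symmetric])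
  then have dF: "(F has_vector_derivative F' r) (at r)" for r
    unfolding F_def F'_def
    by (auto intro!: derivative_eq_intros has_vector_derivative_real_field
        simp: scaleR_conv_of_real exp_of_real[symmetric] exp_add algebra_simps)
  have contF': "isCont F' r" for r
    unfolding F'_def using contf cont
    by (auto intro!: continuous_intros isCont_o2[of _ exp] simp: continuous_on_eq_continuous_at)
  have i1: "integrable lborel (\<lambda>r. f' (exp r) * exp ((s + 1) * of_real r))"
    by (rule mellin_integrable[OF _ bound']) (use s in auto)
  have i2: "integrable lborel (\<lambda>r. f (exp r) * exp (s * of_real r))"
    by (rule mellin_integrable[OF _ bound]) (use s in auto)
  have iF': "integrable lborel F'"
    unfolding F'_def using i1 i2 by (intro Bochner_Integration.integrable_add integrable_mult_right)
  have C: "norm (F r) \<le> C * (exp (- 2 * exp (2 * r)) * exp (Re s * r))" for r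
  proof -
    have "norm (f (exp r)) * exp (Re s * r) \<le> (C * exp (- 2 * exp (2 * r))) * exp (Re s * r)"
      using bound[of "exp r"] by (intro mult_right_mono) (auto simp: exp_double)
    then show ?thesis by (simp add: F_def norm_mult mult.assoc)
  qed
  have "((\<lambda>r. C * (exp (- 2 * exp (2 * r)) * exp (Re s * r))) \<longlongrightarrow> C * 0) at_top"
    by (intro tendsto_intros) (use s in real_asymp)
  then have top: "(F \<longlongrightarrow> 0) at_top"
    using Lim_null_comparison[OF always_eventually[OF allI[OF C]]] by (simp only: mult_zero_right)
  have "((\<lambda>r. C * (exp (- 2 * exp (2 * r)) * exp (Re s * r))) \<longlongrightarrow> C * 0) at_bot"
    by (intro tendsto_intros) (use s in real_asymp)
  then have bot: "(F \<longlongrightarrow> 0) at_bot"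
    using Lim_null_comparison[OF always_eventually[OF allI[OF C]]] by (simp only: mult_zero_right)
  have "(LBINT r=-\<infinity>..\<infinity>. F' r) = 0 - 0"
    by (rule interval_integral_FTC_integrable[OF _ dF contF'])
      (use iF' top bot in \<open>auto simp: set_integrable_def ereal_tendsto_simps\<close>)
  then have "(LBINT r. F' r) = 0"
    by (simp add: interval_lebesgue_integral_def set_lebesgue_integral_def)
  then have "mellin f' (s + 1) + s * mellin f s = 0"
    using i1 i2 unfolding F'_def mellin_def by simp
  then show ?thesis by (simp add: eq_neg_iff_add_eq_0 add.commute)
qed

lemma gaussian_absorbs_linear:
  fixes u m :: real
  shows "exp (- (pi * u\<^sup>2) + m * \<bar>u\<bar>) \<le> exp (m\<^sup>2 / 4) * exp (- 2 * u\<^sup>2)"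
proof -
  have "(pi - 3) * u\<^sup>2 \<ge> 0"
    using pi_gt3 by simp
  moreover have "(\<bar>u\<bar> - m / 2)\<^sup>2 \<ge> 0" by simp
  ultimately show ?thesis
    by (simp add: power2_diff algebra_simps flip: exp_add) (simp add: power2_eq_square)
qed

definition gauss_exp :: "complex \<Rightarrow> real \<Rightarrow> complex" where
  "gauss_exp k u = exp (- of_real (pi * u\<^sup>2) + \<i> * k * of_real u)"

lemma norm_gauss_exp_le: "norm (gauss_exp k u) \<le> exp (- (pi * u\<^sup>2) + norm k * \<bar>u\<bar>)"
proof -
  have "Re (\<i> * k * of_real u) \<le> norm k * \<bar>u\<bar>"
    using complex_Re_le_cmod[of "\<i> * k * of_real u"] by (simp add: norm_mult)
  then show ?thesis by (simp add: gauss_exp_def)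
qed

text \<open>
  The decay \<open>exp (- 2 u\<^sup>2)\<close> is weaker than that of \<open>exp (- \<pi> u\<^sup>2)\<close>.  Since \<open>\<pi> \<ge> 3\<close>, the
  difference absorbs the linear term in the exponent as well as the polynomial factors that
  come with the first two derivatives.
\<close>
lemma gauss_exp_bounds:
  obtains C where
    "\<And>u. norm (gauss_exp k u) \<le> C * exp (- 2 * u\<^sup>2)"
    "\<And>u. norm ((\<i> * k - of_real (2 * pi * u)) * gauss_exp k u) \<le> C * exp (- 2 * u\<^sup>2)"
    "\<And>u. norm (((\<i> * k - of_real (2 * pi * u))\<^sup>2 - of_real (2 * pi)) * gauss_exp k u) \<le> C * exp (- 2 * u\<^sup>2)"
proof -
  define A where "A = (norm k + 2 * pi)\<^sup>2 + 2 * pi"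
  define C where "C = A * exp ((norm k + 2)\<^sup>2 / 4)"
  have A1: "1 \<le> A" "norm k + 2 * pi \<le> A"
  proof -
    have "1 \<le> norm k + 2 * pi" using pi_gt3 norm_ge_zero[of k] by linarith
    then have "norm k + 2 * pi \<le> (norm k + 2 * pi)\<^sup>2" "1 \<le> (norm k + 2 * pi)\<^sup>2"
      by (auto simp: power2_eq_square mult_le_cancel_left1 intro: order_trans)
    then show "1 \<le> A" "norm k + 2 * pi \<le> A" unfolding A_def using pi_gt_zero by linarith+
  qed
  have main: "norm (p * gauss_exp k u) \<le> C * exp (- 2 * u\<^sup>2)" if p: "norm p \<le> A * exp (2 * \<bar>u\<bar>)" for p and u :: real
  proof -
    have "norm (p * gauss_exp k u) \<le> (A * exp (2 * \<bar>u\<bar>)) * exp (- (pi * u\<^sup>2) + norm k * \<bar>u\<bar>)"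
      unfolding norm_mult using p norm_gauss_exp_le A1 by (intro mult_mono) auto
    also have "\<dots> = A * exp (- (pi * u\<^sup>2) + (norm k + 2) * \<bar>u\<bar>)"
      by (simp add: algebra_simps flip: exp_add)
    also have "\<dots> \<le> A * (exp ((norm k + 2)\<^sup>2 / 4) * exp (- 2 * u\<^sup>2))"
      using A1 gaussian_absorbs_linear by (intro mult_left_mono) auto
    finally show ?thesis by (simp add: C_def)
  qed
  have lin: "norm (\<i> * k - of_real (2 * pi * u)) \<le> (norm k + 2 * pi) * exp \<bar>u\<bar>" for u :: real
  proof -
    have "norm (\<i> * k - of_real (2 * pi * u)) \<le> norm k + 2 * pi * \<bar>u\<bar>"
      by (rule order_trans[OF norm_triangle_ineq4]) (simp add: norm_mult abs_mult)
    also have "\<dots> \<le> norm k * exp \<bar>u\<bar> + 2 * pi * exp \<bar>u\<bar>"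
    proof (intro add_mono mult_left_mono)
      show "\<bar>u\<bar> \<le> exp \<bar>u\<bar>" using exp_ge_add_one_self[of "\<bar>u\<bar>"] by linarith
      show "norm k \<le> norm k * exp \<bar>u\<bar>" by (simp add: mult_le_cancel_left1)
    qed auto
    finally show ?thesis by (simp add: algebra_simps)
  qed
  have e2: "exp \<bar>u\<bar> \<le> exp (2 * \<bar>u\<bar>)" "1 \<le> exp (2 * \<bar>u\<bar>)" for u :: real by auto
  show ?thesis
  proof (rule that)
    fix u :: real
    have "(1::real) * 1 \<le> A * exp (2 * \<bar>u\<bar>)" using A1 e2 by (intro mult_mono) auto
    then show "norm (gauss_exp k u) \<le> C * exp (- 2 * u\<^sup>2)" using main[of 1 u] by simp
    have "(norm k + 2 * pi) * exp \<bar>u\<bar> \<le> A * exp (2 * \<bar>u\<bar>)" using A1 e2 by (intro mult_mono) auto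
    then show "norm ((\<i> * k - of_real (2 * pi * u)) * gauss_exp k u) \<le> C * exp (- 2 * u\<^sup>2)"
      using main lin order_trans by blast
    have "norm ((\<i> * k - of_real (2 * pi * u))\<^sup>2 - of_real (2 * pi)) \<le> (norm (\<i> * k - of_real (2 * pi * u)))\<^sup>2 + 2 * pi"
      by (rule order_trans[OF norm_triangle_ineq4]) (simp add: norm_mult norm_power)
    also have "\<dots> \<le> ((norm k + 2 * pi) * exp \<bar>u\<bar>)\<^sup>2 + 2 * pi * exp (2 * \<bar>u\<bar>)"
      using lin e2 by (intro add_mono power_mono) auto
    also have "\<dots> = A * exp (2 * \<bar>u\<bar>)"
      unfolding A_def power_mult_distrib exp_double by (rule distrib_right[symmetric])
    finally show "norm (((\<i> * k - of_real (2 * pi * u))\<^sup>2 - of_real (2 * pi)) * gauss_exp k u) \<le> C * exp (- 2 * u\<^sup>2)"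
      by (rule main)
  qed
qed

lemma gauss_exp_continuous: "continuous_on A (gauss_exp k)"
  unfolding gauss_exp_def[abs_def] by (intro continuous_intros)

lemma gauss_exp_derivative:
  "(gauss_exp k has_vector_derivative (\<i> * k - of_real (2 * pi * u)) * gauss_exp k u) (at u)"
  "((\<lambda>u. (\<i> * k - of_real (2 * pi * u)) * gauss_exp k u) has_vector_derivative
     ((\<i> * k - of_real (2 * pi * u))\<^sup>2 - of_real (2 * pi)) * gauss_exp k u) (at u)"
proof -
  define E where "E = (\<lambda>z. exp (- (of_real pi * z\<^sup>2) + \<i> * k * z))"
  have 1: "(E has_field_derivative (\<i> * k - 2 * of_real pi * z) * E z) (at z)" for z
    unfolding E_def by (auto intro!: derivative_eq_intros simp: algebra_simps)
  have 2: "((\<lambda>z. (\<i> * k - 2 * of_real pi * z) * E z) has_field_derivative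
       ((\<i> * k - 2 * of_real pi * z)\<^sup>2 - 2 * of_real pi) * E z) (at z)" for z
    by (rule derivative_eq_intros 1 | simp add: algebra_simps power2_eq_square)+
  show "(gauss_exp k has_vector_derivative (\<i> * k - of_real (2 * pi * u)) * gauss_exp k u) (at u)"
    using has_vector_derivative_real_field[OF 1] by (simp add: E_def gauss_exp_def[abs_def])
  show "((\<lambda>u. (\<i> * k - of_real (2 * pi * u)) * gauss_exp k u) has_vector_derivative
     ((\<i> * k - of_real (2 * pi * u))\<^sup>2 - of_real (2 * pi)) * gauss_exp k u) (at u)"
    using has_vector_derivative_real_field[OF 2] by (simp add: E_def gauss_exp_def[abs_def])
qed

text \<open>
  Two integrations by parts give \<open>s (s + 1) M(s) = N(s + 2)\<close> for the Mellin transforms of the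
  function and of its second derivative, and \<open>N\<close> is bounded on vertical lines.  Quadratic decay
  is what makes the integral over a vertical line absolutely convergent.
\<close>
lemma mellin_gauss_exp_decay:
  assumes "\<sigma> > 0"
  obtains K where "\<And>s. Re s = \<sigma> \<Longrightarrow> norm (mellin (gauss_exp k) s) \<le> K / (norm s)\<^sup>2"
proof -
  define f' where "f' = (\<lambda>u::real. (\<i> * k - of_real (2 * pi * u)) * gauss_exp k u)"
  define f'' where "f'' = (\<lambda>u::real. ((\<i> * k - of_real (2 * pi * u))\<^sup>2 - of_real (2 * pi)) * gauss_exp k u)"
  obtain C where C: "\<And>u. norm (gauss_exp k u) \<le> C * exp (- 2 * u\<^sup>2)"
    "\<And>u. norm (f' u) \<le> C * exp (- 2 * u\<^sup>2)" "\<And>u. norm (f'' u) \<le> C * exp (- 2 * u\<^sup>2)"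
    unfolding f'_def f''_def by (rule gauss_exp_bounds[of k]) blast
  have cont: "continuous_on UNIV f'" "continuous_on UNIV f''"
    unfolding f'_def f''_def by (intro continuous_intros gauss_exp_continuous)+
  have [measurable]: "f'' \<in> borel_measurable borel"
    using cont by (auto intro: borel_measurable_continuous_onI)
  define K where "K = (LBINT r. norm (f'' (exp r)) * exp ((\<sigma> + 2) * r))"
  have "norm (mellin (gauss_exp k) s) \<le> K / (norm s)\<^sup>2" if s: "Re s = \<sigma>" for s
  proof -
    have "s * (s + 1) * mellin (gauss_exp k) s = mellin f'' (s + 1 + 1)"
    proof -
      have "(gauss_exp k has_vector_derivative f' u) (at u)" "(f' has_vector_derivative f'' u) (at u)" for u
        unfolding f'_def f''_def by (rule gauss_exp_derivative)+
      then have "s * mellin (gauss_exp k) s = - mellin f' (s + 1)"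
        "(s + 1) * mellin f' (s + 1) = - mellin f'' (s + 1 + 1)"
        using mellin_derivative[of "gauss_exp k" f' C C s] mellin_derivative[of f' f'' C C "s + 1"] cont C s assms
        by auto
      then show ?thesis
        by (metis (no_types, opaque_lifting) minus_mult_right mult.assoc mult.commute verit_minus_simplify(4))
    qed
    then have "norm s * norm (s + 1) * norm (mellin (gauss_exp k) s) = norm (mellin f'' (s + 1 + 1))"
      by (metis norm_mult)
    also have "\<dots> \<le> K"
      unfolding mellin_def K_def
      by (rule order_trans[OF integral_norm_bound]) (simp add: norm_mult s algebra_simps)
    finally have K: "norm s * norm (s + 1) * norm (mellin (gauss_exp k) s) \<le> K" .
    have "norm s \<le> norm (s + 1)"
      using s assms by (auto simp: cmod_def intro!: real_sqrt_le_mono power_mono)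
    then have "(norm s)\<^sup>2 \<le> norm s * norm (s + 1)"
      by (simp add: power2_eq_square mult_left_mono)
    then have "(norm s)\<^sup>2 * norm (mellin (gauss_exp k) s) \<le> K"
      using K by (meson mult_right_mono norm_ge_zero order_trans)
    moreover have "norm s > 0" using s assms by auto
    ultimately show ?thesis by (simp add: field_simps)
  qed
  then show ?thesis by (rule that)
qed

text \<open>
  The factor \<open>\<surd>\<pi>\<close> in the cosine makes the theta series built from this function transform
  under \<open>y \<mapsto> 1 / y\<close> without further constants, and turns \<open>w\<close> into \<open>\<i> w\<close>.
\<close>
definition gauss_cos :: "complex \<Rightarrow> real \<Rightarrow> complex" where
  "gauss_cos w u = exp (- of_real (pi * u\<^sup>2)) * cos (of_real (sqrt pi) * w * of_real u)"

lemma gauss_cos_conv_exp: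
  "gauss_cos w u = (gauss_exp (of_real (sqrt pi) * w) u + gauss_exp (- (of_real (sqrt pi) * w)) u) / 2"
  unfolding gauss_cos_def gauss_exp_def cos_exp_eq exp_add by (simp add: algebra_simps)

lemma gauss_cos_continuous: "continuous_on A (gauss_cos w)"
  unfolding gauss_cos_def[abs_def] by (intro continuous_intros)

lemma gauss_cos_measurable [measurable]: "gauss_cos w \<in> borel_measurable borel"
  by (intro borel_measurable_continuous_onI gauss_cos_continuous)

lemma gauss_cos_bound:
  obtains C where "C > 0" "\<And>u. norm (gauss_cos w u) \<le> C * exp (- 2 * u\<^sup>2)"
proof -
  let ?k = "of_real (sqrt pi) * w"
  obtain C1 where C1: "\<And>u. norm (gauss_exp ?k u) \<le> C1 * exp (- 2 * u\<^sup>2)"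
    by (rule gauss_exp_bounds[of ?k]) blast
  obtain C2 where C2: "\<And>u. norm (gauss_exp (- ?k) u) \<le> C2 * exp (- 2 * u\<^sup>2)"
    by (rule gauss_exp_bounds[of "- ?k"]) blast
  have "norm (gauss_cos w u) \<le> (\<bar>C1\<bar> + \<bar>C2\<bar> + 1) * exp (- 2 * u\<^sup>2)" for u
  proof -
    have "norm (gauss_cos w u) \<le> norm (gauss_exp ?k u) + norm (gauss_exp (- ?k) u)"
    proof -
      have "norm (gauss_cos w u) = norm (gauss_exp ?k u + gauss_exp (- ?k) u) / 2"
        unfolding gauss_cos_conv_exp by (simp add: norm_divide)
      then show ?thesis
        using norm_triangle_ineq[of "gauss_exp ?k u" "gauss_exp (- ?k) u"]
          norm_ge_zero[of "gauss_exp ?k u + gauss_exp (- ?k) u"] by linarith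
    qed
    also have "\<dots> \<le> (C1 + C2) * exp (- 2 * u\<^sup>2)"
      using C1[of u] C2[of u] by (simp add: algebra_simps)
    also have "\<dots> \<le> (\<bar>C1\<bar> + \<bar>C2\<bar> + 1) * exp (- 2 * u\<^sup>2)"
      by (intro mult_right_mono) auto
    finally show ?thesis .
  qed
  then show ?thesis by (rule that[rotated]) auto
qed

lemma gauss_cos_mellin_integrable:
  "Re s > 0 \<Longrightarrow> integrable lborel (\<lambda>r. gauss_cos w (exp r) * exp (s * of_real r))"
  by (metis gauss_cos_bound gauss_cos_measurable mellin_integrable)

lemma mellin_gauss_cos_conv_exp:
  assumes "Re s > 0"
  shows "mellin (gauss_cos w) s =
    (mellin (gauss_exp (of_real (sqrt pi) * w)) s + mellin (gauss_exp (- (of_real (sqrt pi) * w))) s) / 2"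
proof -
  have "integrable lborel (\<lambda>r. gauss_exp k (exp r) * exp (s * of_real r))" for k
  proof -
    obtain C where C: "\<And>u. norm (gauss_exp k u) \<le> C * exp (- 2 * u\<^sup>2)"
      by (rule gauss_exp_bounds[of k]) blast
    show ?thesis
      by (rule mellin_integrable[OF _ C assms]) (intro borel_measurable_continuous_onI gauss_exp_continuous)
  qed
  then show ?thesis
    unfolding mellin_def gauss_cos_conv_exp by (simp add: distrib_right add_divide_distrib)
qed

lemma mellin_gauss_cos_vertical_integrable:
  assumes "\<sigma> > 0"
  shows "integrable lborel (\<lambda>t. mellin (gauss_cos w) (Complex \<sigma> t))"
proof -
  have meas: "(\<lambda>t. mellin (gauss_cos w) (Complex \<sigma> t)) \<in> borel_measurable borel"
    unfolding mellin_def Complex_eq by measurable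
  obtain K1 where K1: "\<And>s. Re s = \<sigma> \<Longrightarrow> norm (mellin (gauss_exp (of_real (sqrt pi) * w)) s) \<le> K1 / (norm s)\<^sup>2"
    using mellin_gauss_exp_decay[OF assms] by blast
  obtain K2 where K2: "\<And>s. Re s = \<sigma> \<Longrightarrow> norm (mellin (gauss_exp (- (of_real (sqrt pi) * w))) s) \<le> K2 / (norm s)\<^sup>2"
    using mellin_gauss_exp_decay[OF assms] by blast
  \<comment> \<open>\<open>m (1 + t\<^sup>2)\<close> is a lower bound for \<open>norm (Complex \<sigma> t)\<close> squared.\<close>
  define m where "m = min (\<sigma>\<^sup>2) 1"
  have m: "m > 0" using assms by (simp add: m_def)
  have bd: "norm (mellin (gauss_cos w) (Complex \<sigma> t)) \<le> (\<bar>K1\<bar> + \<bar>K2\<bar>) / m * inverse (1 + t\<^sup>2)" for t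
  proof -
    let ?s = "Complex \<sigma> t"
    have "norm (mellin (gauss_cos w) ?s) \<le>
       norm (mellin (gauss_exp (of_real (sqrt pi) * w)) ?s) + norm (mellin (gauss_exp (- (of_real (sqrt pi) * w))) ?s)"
    proof -
      let ?A = "mellin (gauss_exp (of_real (sqrt pi) * w)) ?s" and ?B = "mellin (gauss_exp (- (of_real (sqrt pi) * w))) ?s"
      have "norm (mellin (gauss_cos w) ?s) = norm (?A + ?B) / 2"
        using assms by (simp add: mellin_gauss_cos_conv_exp norm_divide)
      then show ?thesis
        using norm_triangle_ineq[of ?A ?B] norm_ge_zero[of "?A + ?B"] by linarith
    qed
    also have "\<dots> \<le> (\<bar>K1\<bar> + \<bar>K2\<bar>) / (norm ?s)\<^sup>2"
      using K1[of ?s] K2[of ?s] assms unfolding add_divide_distrib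
      by (intro add_mono) (auto elim!: order_trans intro!: divide_right_mono)
    also have "(norm ?s)\<^sup>2 = \<sigma>\<^sup>2 + t\<^sup>2" by (simp add: cmod_power2)
    also have "(\<bar>K1\<bar> + \<bar>K2\<bar>) / (\<sigma>\<^sup>2 + t\<^sup>2) \<le> (\<bar>K1\<bar> + \<bar>K2\<bar>) / (m * (1 + t\<^sup>2))"
    proof (rule divide_left_mono)
      have "m * t\<^sup>2 \<le> 1 * t\<^sup>2" by (intro mult_right_mono) (auto simp: m_def)
      then show "m * (1 + t\<^sup>2) \<le> \<sigma>\<^sup>2 + t\<^sup>2" by (simp add: algebra_simps m_def)
      show "0 < (\<sigma>\<^sup>2 + t\<^sup>2) * (m * (1 + t\<^sup>2))"
        using m assms by (intro mult_pos_pos) (auto simp: add_pos_nonneg)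
    qed auto
    also have "\<dots> = (\<bar>K1\<bar> + \<bar>K2\<bar>) / m * inverse (1 + t\<^sup>2)"
      by (simp add: field_simps)
    finally show ?thesis .
  qed
  have "integrable lborel (\<lambda>t::real. (\<bar>K1\<bar> + \<bar>K2\<bar>) / m * inverse (1 + t\<^sup>2))"
    using integrable_inverse_1_plus_square by (simp add: set_integrable_def)
  then show ?thesis
    by (rule integrable_majorant) (use bd meas in auto)
qed

text \<open>
  Euler's integral for \<open>\<Gamma>(s/2)\<close> after the substitution \<open>t = \<pi> exp (2 r)\<close>.
\<close>
lemma mellin_gaussian:
  assumes s: "Re s > 0"
  shows "mellin (\<lambda>u. exp (- of_real (pi * u\<^sup>2))) s = of_real pi powr (- s / 2) * Gamma (s / 2) / 2"
proof -
  define f where "f = (\<lambda>t::real. of_real t powr (s / 2 - 1) / of_real (exp t) :: complex)"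
  define h where "h = (\<lambda>r::real. exp (- complex_of_real (pi * (exp r)\<^sup>2)) * exp (s * of_real r))"
  have subst_eq: "(2 * pi * exp (2 * r)) *\<^sub>R f (pi * exp (2 * r)) = 2 * of_real pi powr (s / 2) * h r" for r
  proof -
    have Ln: "Ln (of_real (pi * exp (2 * r))) = of_real (ln pi + 2 * r)"
      by (subst Ln_of_real) (auto simp: ln_mult)
    have "(2 * pi * exp (2 * r)) *\<^sub>R f (pi * exp (2 * r)) =
        2 * (of_real (pi * exp (2 * r)) * of_real (pi * exp (2 * r)) powr (s / 2 - 1)) / of_real (exp (pi * exp (2 * r)))"
      by (simp add: f_def scaleR_conv_of_real)
    also have "of_real (pi * exp (2 * r)) * of_real (pi * exp (2 * r)) powr (s / 2 - 1) = of_real (pi * exp (2 * r)) powr (s / 2)"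
      using powr_add[of "complex_of_real (pi * exp (2 * r))" 1 "s / 2 - 1"] by simp
    also have "\<dots> = exp (s / 2 * of_real (ln pi + 2 * r))"
      unfolding powr_def Ln by simp
    also have "\<dots> = of_real pi powr (s / 2) * exp (s * of_real r)"
      by (simp add: powr_def Ln_of_real distrib_left exp_add)
    finally have "(2 * pi * exp (2 * r)) *\<^sub>R f (pi * exp (2 * r)) =
        2 * (of_real pi powr (s / 2) * exp (s * of_real r)) / of_real (exp (pi * exp (2 * r)))" .
    moreover have "exp (- complex_of_real (pi * (exp r)\<^sup>2)) = of_real (exp (- (pi * exp (2 * r))))"
      by (subst exp_of_real[symmetric]) (simp add: exp_double)
    ultimately show ?thesis
      by (simp add: h_def exp_minus field_simps)
  qed
  have int_h: "integrable lborel h"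
    unfolding h_def
  proof (rule mellin_integrable[where C = 1])
    show "norm (exp (- complex_of_real (pi * u\<^sup>2))) \<le> 1 * exp (- 2 * u\<^sup>2)" for u
      using pi_gt3 by (auto intro!: mult_right_mono)
  qed (use s in auto)
  have f_meas: "f \<in> borel_measurable borel"
    unfolding f_def by measurable
  have int_f: "set_integrable lborel {0<..} f"
  proof -
    have "integrable lebesgue (\<lambda>t. indicator {0<..} t *\<^sub>R f t)"
      using absolutely_integrable_Gamma_integral'[of "s / 2"] s
      by (simp add: set_integrable_def f_def)
    then show ?thesis
      unfolding set_integrable_def by (subst (asm) integrable_completion) (use f_meas in auto)
  qed
  have "(LBINT t=0..\<infinity>. f t) = (LBINT r=-\<infinity>..\<infinity>. (2 * pi * exp (2 * r)) *\<^sub>R f (pi * exp (2 * r)))"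
  proof (rule interval_integral_substitution_integrable)
    show "((\<lambda>r. pi * exp (2 * r)) has_real_derivative 2 * pi * exp (2 * r)) (at r)" for r
      by (auto intro!: derivative_eq_intros)
    show "isCont f (pi * exp (2 * r))" for r
      unfolding f_def by (intro continuous_intros) (auto simp: complex_nonpos_Reals_iff)
    have "((\<lambda>r::real. pi * exp (2 * r)) \<longlongrightarrow> 0) at_bot" by real_asymp
    then show "((ereal \<circ> (\<lambda>r. pi * exp (2 * r)) \<circ> real_of_ereal) \<longlongrightarrow> 0) (at_right (- \<infinity>))"
      by (simp add: o_assoc[symmetric] zero_ereal_def ereal_tendsto_simps)
    have "filterlim (\<lambda>r::real. pi * exp (2 * r)) at_top at_top" by real_asymp
    then show "((ereal \<circ> (\<lambda>r. pi * exp (2 * r)) \<circ> real_of_ereal) \<longlongrightarrow> \<infinity>) (at_left \<infinity>)"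
      by (simp add: ereal_tendsto_simps)
    show "set_integrable lborel (einterval (- \<infinity>) \<infinity>) (\<lambda>r. (2 * pi * exp (2 * r)) *\<^sub>R f (pi * exp (2 * r)))"
      unfolding subst_eq using int_h by (simp add: set_integrable_def)
    show "set_integrable lborel (einterval 0 \<infinity>) f"
      using int_f by (simp add: einterval_def zero_ereal_def greaterThan_def)
  qed (auto intro!: continuous_intros)
  moreover have "(LBINT t=0..\<infinity>. f t) = Gamma (s / 2)"
  proof -
    have "(LBINT t=0..\<infinity>. f t) = (LBINT t:{0<..}. f t)"
      by (simp add: interval_lebesgue_integral_def einterval_def zero_ereal_def greaterThan_def)
    also have "\<dots> = integral {0<..} f"
      using set_borel_integral_eq_integral(2)[OF int_f] .
    also have "\<dots> = Gamma (s / 2)"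
      unfolding f_def using Gamma_integral_complex'[of "s / 2"] s by (intro integral_unique) auto
    finally show ?thesis .
  qed
  ultimately have "Gamma (s / 2) = (LBINT r. 2 * of_real pi powr (s / 2) * h r)"
    by (simp add: interval_lebesgue_integral_def set_lebesgue_integral_def subst_eq)
  also have "\<dots> = 2 * of_real pi powr (s / 2) * mellin (\<lambda>u. exp (- of_real (pi * u\<^sup>2))) s"
    unfolding h_def mellin_def by simp
  finally show ?thesis
    by (simp add: powr_minus field_simps)
qed

lemma cos_even_sums: "(\<lambda>n. (- 1) ^ n * z ^ (2 * n) / fact (2 * n)) sums cos (z :: complex)"
proof -
  have "(\<lambda>n. cos_coeff n *\<^sub>R z ^ n) sums cos z"
    by (rule cos_converges)
  then have "(\<lambda>n. cos_coeff (2 * n) *\<^sub>R z ^ (2 * n)) sums cos z"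
    by (subst sums_mono_reindex[of "\<lambda>n. 2 * n" "\<lambda>n. cos_coeff n *\<^sub>R z ^ n"])
       (auto simp: strict_mono_def cos_coeff_def elim!: evenE)
  then show ?thesis
    by (simp add: cos_coeff_def scaleR_conv_of_real)
qed

lemma sum_even_exp_le:
  fixes x :: real
  assumes "x \<ge> 0"
  shows "(\<Sum>n<N. x ^ (2 * n) / fact (2 * n)) \<le> exp x"
proof -
  have "(\<Sum>n<N. x ^ (2 * n) / fact (2 * n)) = (\<Sum>n\<in>(\<lambda>n. 2 * n) ` {..<N}. x ^ n /\<^sub>R fact n)"
    by (subst sum.reindex) (auto simp: inj_on_def field_simps)
  also have "\<dots> \<le> (\<Sum>n. x ^ n /\<^sub>R fact n)"
    using assms summable_exp[of x] by (intro sum_le_suminf) auto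
  finally show ?thesis by (simp add: exp_def)
qed

text \<open>
  The cosine series is integrated term by term against the Gaussian.  The \<open>n\<close>-th moment contributes
  \<open>\<Gamma>(s/2 + n) = (s/2)\<^sub>n \<Gamma>(s/2)\<close>, and \<open>(2 n)! = 4\<^sup>n (1/2)\<^sub>n n!\<close> turns the series into a Kummer
  function.
\<close>
lemma mellin_gauss_cos:
  assumes s: "Re s > 0"
  shows "mellin (gauss_cos w) s =
    of_real pi powr (- s / 2) * Gamma (s / 2) * hyp1F1 (s / 2) (1 / 2) (- w\<^sup>2 / 4) / 2"
proof -
  define k where "k = complex_of_real (sqrt pi) * w"
  have k2: "k\<^sup>2 = of_real pi * w\<^sup>2"
    by (simp add: k_def power_mult_distrib flip: of_real_power)
  define c where "c = (\<lambda>n. (- 1) ^ n * k ^ (2 * n) / fact (2 * n) :: complex)"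
  define g where "g = (\<lambda>u. exp (- complex_of_real (pi * u\<^sup>2)))"
  define W where "W = (\<lambda>r. exp (- (pi * (exp r)\<^sup>2) + norm k * \<bar>exp r\<bar>) * exp (Re s * r))"
  have W: "integrable lborel W"
  proof -
    have "integrable lborel (\<lambda>r. exp ((norm k)\<^sup>2 / 4) * (exp (- 2 * exp (2 * r)) * exp (Re s * r)))"
      using integrable_one_sided_majorant[of "Re s" 2] s by simp
    then show ?thesis
    proof (rule integrable_majorant)
      show "norm (W r) \<le> exp ((norm k)\<^sup>2 / 4) * (exp (- 2 * exp (2 * r)) * exp (Re s * r))" for r
        using mult_right_mono[OF gaussian_absorbs_linear[of "exp r" "norm k"], of "exp (Re s * r)"]
        by (simp add: W_def exp_double mult.assoc)
    qed (simp add: W_def)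
  qed
  have part: "norm (\<Sum>n<N. c n * (g (exp r) * exp ((s + 2 * of_nat n) * of_real r))) \<le> W r" for N r
  proof -
    have t: "norm (c n * (g (exp r) * exp ((s + 2 * of_nat n) * of_real r))) =
        exp (- (pi * (exp r)\<^sup>2)) * exp (Re s * r) * ((norm k * exp r) ^ (2 * n) / fact (2 * n))" for n
    proof -
      have "exp ((Re s + 2 * real n) * r) = exp (Re s * r) * exp r ^ (2 * n)"
        by (simp add: distrib_right exp_add exp_of_nat_mult[symmetric] mult.assoc)
      then show ?thesis
        by (simp add: c_def g_def norm_mult norm_divide norm_power power_mult_distrib field_simps)
    qed
    have "norm (\<Sum>n<N. c n * (g (exp r) * exp ((s + 2 * of_nat n) * of_real r))) \<le>
       (\<Sum>n<N. exp (- (pi * (exp r)\<^sup>2)) * exp (Re s * r) * ((norm k * exp r) ^ (2 * n) / fact (2 * n)))"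
      by (rule order_trans[OF norm_sum]) (simp only: t order_refl)
    also have "\<dots> = exp (- (pi * (exp r)\<^sup>2)) * exp (Re s * r) * (\<Sum>n<N. (norm k * exp r) ^ (2 * n) / fact (2 * n))"
      by (simp only: sum_distrib_left)
    also have "\<dots> \<le> exp (- (pi * (exp r)\<^sup>2)) * exp (Re s * r) * exp (norm k * exp r)"
      by (intro mult_left_mono sum_even_exp_le) auto
    also have "\<dots> = W r"
      unfolding W_def exp_add by simp
    finally show ?thesis .
  qed
  have int_n: "integrable lborel (\<lambda>r. g (exp r) * exp ((s + 2 * of_nat n) * of_real r))" for n
  proof (rule mellin_integrable[where C = 1])
    show "norm (g u) \<le> 1 * exp (- 2 * u\<^sup>2)" for u
      using pi_gt3 by (auto simp: g_def intro!: mult_right_mono)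
    show "g \<in> borel_measurable borel" unfolding g_def by measurable
  qed (use s in auto)
  have "(\<lambda>N. LBINT r. (\<Sum>n<N. c n * (g (exp r) * exp ((s + 2 * of_nat n) * of_real r)))) \<longlonglongrightarrow>
      (LBINT r. gauss_cos w (exp r) * exp (s * of_real r))"
  proof (rule integral_dominated_convergence[OF _ _ W])
    have "(\<lambda>n. c n * (g (exp r) * exp ((s + 2 * of_nat n) * of_real r))) sums (gauss_cos w (exp r) * exp (s * of_real r))" for r
    proof -
      have "(\<lambda>n. g (exp r) * exp (s * of_real r) * ((- 1) ^ n * (k * exp (of_real r)) ^ (2 * n) / fact (2 * n))) sums
          (g (exp r) * exp (s * of_real r) * cos (k * exp (of_real r)))"
        by (intro sums_mult cos_even_sums)
      moreover have "g (exp r) * exp (s * of_real r) * ((- 1) ^ n * (k * exp (of_real r)) ^ (2 * n) / fact (2 * n)) =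
         c n * (g (exp r) * exp ((s + 2 * of_nat n) * of_real r))" for n
      proof -
        have "exp ((s + 2 * of_nat n) * of_real r) = exp (s * of_real r) * exp (of_real r) ^ (2 * n)"
          by (simp add: distrib_right exp_add exp_of_nat_mult[symmetric] mult.assoc)
        then show ?thesis by (simp add: c_def power_mult_distrib field_simps)
      qed
      ultimately show ?thesis
        by (simp add: gauss_cos_def g_def k_def exp_of_real mult_ac)
    qed
    then show "AE r in lborel. (\<lambda>N. \<Sum>n<N. c n * (g (exp r) * exp ((s + 2 * of_nat n) * of_real r))) \<longlonglongrightarrow>
        gauss_cos w (exp r) * exp (s * of_real r)"
      by (simp add: sums_def)
  qed (use part in \<open>auto simp: g_def\<close>)
  moreover have "(LBINT r. (\<Sum>n<N. c n * (g (exp r) * exp ((s + 2 * of_nat n) * of_real r)))) =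
      (\<Sum>n<N. c n * mellin g (s + 2 * of_nat n))" for N
    using int_n by (subst Bochner_Integration.integral_sum) (auto simp: mellin_def)
  ultimately have sums: "(\<lambda>n. c n * mellin g (s + 2 * of_nat n)) sums mellin (gauss_cos w) s"
    by (simp add: sums_def mellin_def)
  have nz: "of_real pi powr (- s / 2) * Gamma (s / 2) \<noteq> 0"
    using s by (auto simp: Gamma_eq_zero_iff elim!: nonpos_Ints_cases)
  have "c n * mellin g (s + 2 * of_nat n) = of_real pi powr (- s / 2) * Gamma (s / 2) / 2 *
      (pochhammer (s / 2) n * (- w\<^sup>2 / 4) ^ n / (pochhammer (1 / 2) n * fact n))" for n
  proof -
    have m: "mellin g (s + 2 * of_nat n) = of_real pi powr (- (s + 2 * of_nat n) / 2) * Gamma ((s + 2 * of_nat n) / 2) / 2"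
      unfolding g_def by (rule mellin_gaussian) (use s in auto)
    have "of_real pi powr (- (s + 2 * of_nat n) / 2) = of_real pi powr (- s / 2) * of_real pi powr (- of_nat n)"
      by (simp add: powr_add[symmetric] add_divide_distrib diff_divide_distrib)
    also have "of_real pi powr (- of_nat n) = 1 / complex_of_real pi ^ n"
      by (simp add: powr_minus powr_nat field_simps)
    finally have 1: "of_real pi powr (- (s + 2 * of_nat n) / 2) = of_real pi powr (- s / 2) / complex_of_real pi ^ n"
      by simp
    have "s / 2 \<notin> \<int>\<^sub>\<le>\<^sub>0"
      using s by (auto elim!: nonpos_Ints_cases)
    then have 2: "Gamma ((s + 2 * of_nat n) / 2) = pochhammer (s / 2) n * Gamma (s / 2)"
      using nz by (simp add: pochhammer_Gamma add_divide_distrib)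
    have 3: "k ^ (2 * n) = of_real pi ^ n * (w\<^sup>2) ^ n"
      by (simp add: power_mult k2 power_mult_distrib)
    have 4: "(fact (2 * n) :: complex) = 4 ^ n * pochhammer (1 / 2) n * fact n"
      using fact_double[of n, where 'a = complex] by (simp add: power_mult)
    have 5: "(- w\<^sup>2 / 4) ^ n = (- 1) ^ n * (w\<^sup>2) ^ n / 4 ^ n"
      by (simp only: power_divide power_mult_distrib[symmetric] mult_minus1)
    show ?thesis
      unfolding m 1 2 c_def 3 4 5 by (simp add: field_simps)
  qed
  with sums have "(\<lambda>n. of_real pi powr (- s / 2) * Gamma (s / 2) / 2 *
      (pochhammer (s / 2) n * (- w\<^sup>2 / 4) ^ n / (pochhammer (1 / 2) n * fact n))) sums mellin (gauss_cos w) s"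
    by simp
  moreover from this have "summable (\<lambda>n. pochhammer (s / 2) n * (- w\<^sup>2 / 4) ^ n / (pochhammer (1 / 2) n * fact n))"
    using nz unfolding sums_iff summable_cmult_iff by auto
  ultimately have "mellin (gauss_cos w) s = of_real pi powr (- s / 2) * Gamma (s / 2) / 2 *
      (\<Sum>n. pochhammer (s / 2) n * (- w\<^sup>2 / 4) ^ n / (pochhammer (1 / 2) n * fact n))"
    by (simp only: sums_iff suminf_mult)
  then show ?thesis by (simp add: hyp1F1_def)
qed

section \<open>The generalized Bessel function as a convolution\<close>

lemma gauss_cos_exp_bounded:
  assumes "a > 0"
  obtains B where "\<And>\<rho>. norm (gauss_cos w (exp \<rho>)) * exp (a * \<rho>) \<le> B"
proof -
  obtain C where C: "C > 0" "\<And>u. norm (gauss_cos w u) \<le> C * exp (- 2 * u\<^sup>2)"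
    using gauss_cos_bound by blast
  have "norm (gauss_cos w (exp \<rho>)) * exp (a * \<rho>) \<le> C * exp (a\<^sup>2 / 16)" for \<rho>
  proof -
    have le: "- 2 * exp (2 * \<rho>) + a * \<rho> \<le> a\<^sup>2 / 16"
    proof (cases "\<rho> \<ge> 0")
      case True
      have "1 + 2 * \<rho> + (2 * \<rho>)\<^sup>2 / 2 \<le> exp (2 * \<rho>)"
        using True by (intro exp_lower_Taylor_quadratic) auto
      moreover have "0 \<le> (2 * \<rho> - a / 4)\<^sup>2" by simp
      ultimately show ?thesis using True by (simp add: power2_eq_square algebra_simps)
    next
      case False
      then have "a * \<rho> \<le> 0" using assms by (simp add: mult_nonneg_nonpos)
      moreover have "exp (2 * \<rho>) > 0" "a\<^sup>2 / 16 \<ge> 0" by auto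
      ultimately show ?thesis by linarith
    qed
    have "norm (gauss_cos w (exp \<rho>)) * exp (a * \<rho>) \<le> C * exp (- 2 * exp (2 * \<rho>)) * exp (a * \<rho>)"
      using C(2)[of "exp \<rho>"] by (intro mult_right_mono) (auto simp: exp_double)
    also have "\<dots> = C * exp (- 2 * exp (2 * \<rho>) + a * \<rho>)"
      by (simp only: exp_add mult.assoc)
    also have "\<dots> \<le> C * exp (a\<^sup>2 / 16)"
      using le C by (intro mult_left_mono) auto
    finally show ?thesis .
  qed
  then show ?thesis by (rule that)
qed

text \<open>
  Mellin inversion on the line \<open>Re s = c\<close>: after splitting off \<open>exp ((c - z) \<rho>)\<close>, the transform
  is the Fourier transform of a bounded continuous integrable function.
\<close>
lemma mellin_gauss_cos_inversion:
  fixes z :: complex and c y :: real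
  assumes c: "c > Re z"
  shows "integrable lborel (\<lambda>t. mellin (gauss_cos w) (Complex c t - z))"
    and "(LBINT t. mellin (gauss_cos w) (Complex c t - z) * exp (- Complex c t * of_real y)) =
         2 * of_real pi * gauss_cos w (exp y) * exp (- z * of_real y)"
proof -
  let ?a = "c - Re z"
  have a: "?a > 0" using c by simp
  define \<phi> where "\<phi> = (\<lambda>\<rho>. gauss_cos w (exp \<rho>) * exp ((of_real c - z) * of_real \<rho>))"
  have hat: "mellin (gauss_cos w) (Complex c t - z) = (LBINT \<rho>. \<phi> \<rho> * cis (t * \<rho>))" for t
    unfolding mellin_def \<phi>_def
    by (intro Bochner_Integration.integral_cong) (auto simp: Complex_eq cis_conv_exp exp_add[symmetric] algebra_simps)
  have "Complex c t - z = Complex ?a (- Im z + 1 * t)" for t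
    by (simp add: complex_eq_iff)
  then show int: "integrable lborel (\<lambda>t. mellin (gauss_cos w) (Complex c t - z))"
    using lborel_integrable_real_affine[OF mellin_gauss_cos_vertical_integrable[OF a], of 1 w "- Im z"] by simp
  obtain B where B: "\<And>\<rho>. norm (gauss_cos w (exp \<rho>)) * exp (?a * \<rho>) \<le> B"
    using gauss_cos_exp_bounded[OF a] by blast
  have inv: "(LBINT t. (LBINT \<rho>. \<phi> \<rho> * cis (t * \<rho>)) * cis (- t * y)) = of_real (2 * pi) * \<phi> y"
  proof (rule fourier_inversion)
    show "continuous_on UNIV \<phi>"
      unfolding \<phi>_def by (intro continuous_intros continuous_on_compose2[OF gauss_cos_continuous[of UNIV]]) auto
    show "integrable lborel \<phi>"
      unfolding \<phi>_def by (rule gauss_cos_mellin_integrable) (use c in simp)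
    show "norm (\<phi> r) \<le> B" for r
      using B[of r] by (simp add: \<phi>_def norm_mult)
    show "integrable lborel (\<lambda>t. LBINT r. \<phi> r * cis (t * r))"
      using int by (simp only: hat)
  qed
  have e: "exp (- Complex c t * of_real y) = cis (- t * y) * exp (- of_real (c * y))" for t
    by (simp add: Complex_eq cis_conv_exp exp_add[symmetric] algebra_simps)
  have "(LBINT t. mellin (gauss_cos w) (Complex c t - z) * exp (- Complex c t * of_real y)) =
     (LBINT t. (LBINT \<rho>. \<phi> \<rho> * cis (t * \<rho>)) * cis (- t * y) * exp (- of_real (c * y)))"
    by (simp only: hat e mult.assoc)
  also have "\<dots> = of_real (2 * pi) * \<phi> y * exp (- of_real (c * y))"
    unfolding integral_mult_left_zero inv ..
  also have "\<dots> = 2 * of_real pi * gauss_cos w (exp y) * (exp ((of_real c - z) * of_real y) * exp (- of_real (c * y)))"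
    by (simp add: \<phi>_def)
  also have "exp ((of_real c - z) * of_real y) * exp (- of_real (c * y)) = exp (- z * of_real y)"
    by (simp add: exp_add[symmetric] algebra_simps)
  finally show "(LBINT t. mellin (gauss_cos w) (Complex c t - z) * exp (- Complex c t * of_real y)) =
         2 * of_real pi * gauss_cos w (exp y) * exp (- z * of_real y)" .
qed

text \<open>
  The powers of 2 and of \<open>\<pi>\<close> cancel when the argument is written as \<open>2 \<pi> X\<close>.
\<close>
lemma bessel_integrand_eq:
  assumes X: "X > 0" and s: "Re s > \<bar>Re z\<bar>"
  shows "bessel_integrand z w (2 * pi * X) s =
     mellin (gauss_cos w) (s - z) * mellin (gauss_cos w) (s + z) * of_real X powr (- s)"
proof -
  have pi_powr: "of_real pi powr (- (s - z) / 2) * of_real pi powr (- (s + z) / 2) = complex_of_real pi powr (- s)"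
    by (simp add: powr_add[symmetric] field_simps)
  have x: "complex_of_real (2 * pi * X) powr (- s) = 2 powr (- s) * of_real pi powr (- s) * of_real X powr (- s)"
    using X powr_times_real[of "of_real 2" "of_real pi" "- s"] powr_times_real[of "of_real (2 * pi)" "of_real X" "- s"] by simp
  have "(2::complex) powr (s - 2) * 2 powr (- s) = 2 powr (- 2)"
    by (simp add: powr_add[symmetric])
  also have "(2::complex) powr (- 2) = 1 / 4"
    using powr_nat[of "2::complex" 2] by (simp add: powr_minus)
  finally have two: "(2::complex) powr (s - 2) * 2 powr (- s) = 1 / 4" .
  have "mellin (gauss_cos w) (s - z) * mellin (gauss_cos w) (s + z) * of_real X powr (- s) =
    (of_real pi powr (- (s - z) / 2) * of_real pi powr (- (s + z) / 2)) * (1 / 4) * of_real X powr (- s) *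
    (Gamma ((s - z) / 2) * Gamma ((s + z) / 2) * hyp1F1 ((s - z) / 2) (1 / 2) (- w\<^sup>2 / 4) * hyp1F1 ((s + z) / 2) (1 / 2) (- w\<^sup>2 / 4))"
    using s by (simp add: mellin_gauss_cos field_simps)
  also have "\<dots> = bessel_integrand z w (2 * pi * X) s"
    unfolding pi_powr two[symmetric] bessel_integrand_def x by (simp add: mult_ac)
  finally show ?thesis ..
qed

text \<open>
  One of the two Mellin transforms in the integrand is written out as an integral, the order of
  integration is exchanged, and the other one is inverted.  The result does not depend on the abscissa
  \<open>c\<close>, as the definition of the Bessel function requires.
\<close>
theorem gen_bessel_K_eq:
  assumes X: "X > 0"
  shows "gen_bessel_K z w (2 * pi * X) = of_real X powr (- z) *
    (LBINT r. gauss_cos w (exp r) * gauss_cos w (X * exp (- r)) * exp (2 * z * of_real r))"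
proof -
  define V where "V = of_real X powr (- z) *
    (LBINT r. gauss_cos w (exp r) * gauss_cos w (X * exp (- r)) * exp (2 * z * of_real r))"
  have main: "((\<lambda>t. bessel_integrand z w (2 * pi * X) (Complex c t) * \<i>) has_integral (2 * of_real pi * \<i> * V)) UNIV"
    if c: "c > \<bar>Re z\<bar>" for c
  proof -
    define f where "f = (\<lambda>t r. (mellin (gauss_cos w) (Complex c t - z) * of_real X powr (- Complex c t)) *
        (gauss_cos w (exp r) * exp ((Complex c t + z) * of_real r)))"
    have powX: "of_real X powr s = exp (s * of_real (ln X))" for s :: complex
      using X by (simp add: powr_def Ln_of_real)
    have int1: "integrable lborel (\<lambda>t. mellin (gauss_cos w) (Complex c t - z))"
      by (rule mellin_gauss_cos_inversion) (use c in simp)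
    have int2: "integrable lborel (\<lambda>r. gauss_cos w (exp r) * exp ((of_real c + z) * of_real r))"
      by (rule gauss_cos_mellin_integrable) (use c in simp)
    have int: "integrable (lborel \<Otimes>\<^sub>M lborel) (\<lambda>(t, r). f t r)"
    proof (rule Bochner_Integration.integrable_bound)
      show "integrable (lborel \<Otimes>\<^sub>M lborel) (\<lambda>(t, r). (mellin (gauss_cos w) (Complex c t - z) * exp (- of_real (c * ln X))) *
          (gauss_cos w (exp r) * exp ((of_real c + z) * of_real r)))"
        by (intro integrable_pair_mult integrable_mult_left int1 int2)
      show "AE x in lborel \<Otimes>\<^sub>M lborel. norm (case x of (t, r) \<Rightarrow> f t r) \<le> norm (case x of (t, r) \<Rightarrow>
          (mellin (gauss_cos w) (Complex c t - z) * exp (- of_real (c * ln X))) *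
          (gauss_cos w (exp r) * exp ((of_real c + z) * of_real r)))"
        by (intro AE_I2) (auto simp: f_def norm_mult powX)
      have "(\<lambda>t. mellin (gauss_cos w) (Complex c t - z)) \<in> borel_measurable borel"
        using int1 by auto
      then show "(\<lambda>(t, r). f t r) \<in> borel_measurable (lborel \<Otimes>\<^sub>M lborel)"
        unfolding f_def powX Complex_eq by measurable
    qed
    have inner: "(LBINT r. f t r) = bessel_integrand z w (2 * pi * X) (Complex c t)" for t
      unfolding f_def by (subst bessel_integrand_eq) (use c X in \<open>auto simp: mellin_def\<close>)
    have outer: "(LBINT t. f t r) = 2 * of_real pi * of_real X powr (- z) *
        (gauss_cos w (exp r) * gauss_cos w (X * exp (- r)) * exp (2 * z * of_real r))" for r
    proof -
      define y where "y = ln X - r"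
      have ey: "exp y = X * exp (- r)"
        using X by (simp add: y_def exp_diff exp_minus field_simps)
      have "of_real X powr (- Complex c t) * exp ((Complex c t + z) * of_real r) =
          exp (- Complex c t * of_real y) * exp (z * of_real r)" for t
        by (simp add: powX y_def exp_add[symmetric] algebra_simps)
      then have "f t r = gauss_cos w (exp r) * exp (z * of_real r) *
          (mellin (gauss_cos w) (Complex c t - z) * exp (- Complex c t * of_real y))" for t
      proof -
        assume eq: "\<And>t. of_real X powr (- Complex c t) * exp ((Complex c t + z) * of_real r) =
          exp (- Complex c t * of_real y) * exp (z * of_real r)"
        have "f t r = gauss_cos w (exp r) * mellin (gauss_cos w) (Complex c t - z) *
          (of_real X powr (- Complex c t) * exp ((Complex c t + z) * of_real r))"
          unfolding f_def by (simp only: mult_ac)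
        then show ?thesis
          unfolding eq by (simp only: mult_ac)
      qed
      then have "(LBINT t. f t r) = gauss_cos w (exp r) * exp (z * of_real r) *
          (2 * of_real pi * gauss_cos w (exp y) * exp (- z * of_real y))"
        using mellin_gauss_cos_inversion(2)[of z c w y] c by simp
      also have "exp (- z * of_real y) = of_real X powr (- z) * exp (z * of_real r)"
        by (simp add: powX y_def exp_add[symmetric] algebra_simps)
      also have "gauss_cos w (exp r) * exp (z * of_real r) * (2 * of_real pi * gauss_cos w (exp y) * (of_real X powr (- z) * exp (z * of_real r)))
        = 2 * of_real pi * of_real X powr (- z) * (gauss_cos w (exp r) * gauss_cos w (exp y) * (exp (z * of_real r) * exp (z * of_real r)))"
        by (simp add: mult_ac)
      also have "exp (z * of_real r) * exp (z * of_real r) = exp (2 * z * of_real r)"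
        by (simp add: exp_add[symmetric] algebra_simps)
      finally show ?thesis by (simp add: ey)
    qed
    have int_c: "integrable lborel (\<lambda>t. bessel_integrand z w (2 * pi * X) (Complex c t))"
      using lborel_pair.integrable_fst[OF int] by (simp only: inner)
    have "(LBINT t. bessel_integrand z w (2 * pi * X) (Complex c t)) = (LBINT r. LBINT t. f t r)"
      unfolding inner[symmetric] by (rule lborel_pair.Fubini_integral[OF int, symmetric])
    also have "\<dots> = 2 * of_real pi * V"
      unfolding outer V_def integral_mult_right_zero by (rule mult.assoc)
    finally have "(LBINT t. bessel_integrand z w (2 * pi * X) (Complex c t)) = 2 * of_real pi * V" .
    then have "(LBINT t. bessel_integrand z w (2 * pi * X) (Complex c t) * \<i>) = 2 * of_real pi * \<i> * V"
      by simp
    then show ?thesis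
      using has_integral_integral_lborel[OF integrable_mult_left[OF int_c, of \<i>]] by (simp add: mult_ac)
  qed
  have "gen_bessel_K z w (2 * pi * X) = V"
    unfolding gen_bessel_K_def
  proof (rule the_equality)
    show "\<forall>c>\<bar>Re z\<bar>. \<exists>I. ((\<lambda>t. bessel_integrand z w (2 * pi * X) (Complex c t) * \<i>) has_integral I) UNIV \<and>
        V = 1 / (2 * of_real pi * \<i>) * I"
      using main by (intro allI impI exI[of _ "2 * of_real pi * \<i> * V"]) auto
  next
    fix v assume v: "\<forall>c>\<bar>Re z\<bar>. \<exists>I. ((\<lambda>t. bessel_integrand z w (2 * pi * X) (Complex c t) * \<i>) has_integral I) UNIV \<and>
        v = 1 / (2 * of_real pi * \<i>) * I"
    \<comment> \<open>Any single admissible abscissa already determines the value.\<close>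
    define c where "c = \<bar>Re z\<bar> + 1"
    have c: "c > \<bar>Re z\<bar>" by (simp add: c_def)
    with v obtain I where "((\<lambda>t. bessel_integrand z w (2 * pi * X) (Complex c t) * \<i>) has_integral I) UNIV"
      "v = 1 / (2 * of_real pi * \<i>) * I" by blast
    moreover from this have "I = 2 * of_real pi * \<i> * V"
      using has_integral_unique[OF _ main[OF c]] by blast
    ultimately show "v = V" by simp
  qed
  then show ?thesis by (simp add: V_def)
qed

section \<open>Poisson summation for Gaussians\<close>

lemma integral_add_diff:
  fixes f g h :: "real \<Rightarrow> complex"
  assumes "continuous_on {a..b} f" "continuous_on {a..b} g" "continuous_on {a..b} h"
  shows "integral {a..b} (\<lambda>x. f x + (g x - h x)) = integral {a..b} f + (integral {a..b} g - integral {a..b} h)"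
  using assms
  by (simp add: Henstock_Kurzweil_Integration.integral_add Henstock_Kurzweil_Integration.integral_diff
      integrable_continuous_real continuous_on_diff)

lemma integral_add_add:
  fixes f g h :: "real \<Rightarrow> complex"
  assumes "continuous_on {a..b} f" "continuous_on {a..b} g" "continuous_on {a..b} h"
  shows "integral {a..b} (\<lambda>x. f x + (g x + h x)) = integral {a..b} f + (integral {a..b} g + integral {a..b} h)"
  using assms
  by (simp add: Henstock_Kurzweil_Integration.integral_add integrable_continuous_real continuous_on_add)

text \<open>
  Pointwise convergence of a Fourier series without kernels.  Put
  \<open>P(z) - P(0) = g(z) (exp (2 \<pi> \<i> z) - 1)\<close>; then \<open>g\<close> is holomorphic on a strip around
  \<open>[- 1/2, 1/2]\<close>, because there the second factor vanishes only at 0, and simply.  Up to the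
  contribution \<open>P(0)\<close> for \<open>k = 0\<close>, the Fourier coefficients of \<open>P\<close> are differences of consecutive
  coefficients of \<open>g\<close>.  So the partial sums telescope, and the coefficients of \<open>g\<close> tend to 0 by
  one integration by parts.
\<close>
lemma fourier_series_at_zero:
  fixes P :: "complex \<Rightarrow> complex" and c :: "int \<Rightarrow> complex"
  assumes hol: "P holomorphic_on UNIV" and per: "P (1 / 2) = P (- 1 / 2)"
    and c: "\<And>k. c k = integral {- 1 / 2..1 / 2} (\<lambda>x. P (of_real x) * cis (- 2 * pi * of_int k * x))"
  shows "(\<lambda>N. c 0 + (\<Sum>n<N. c (int (Suc n)) + c (- int (Suc n)))) \<longlonglongrightarrow> P 0"
proof -
  define E where "E = (\<lambda>z. exp (2 * of_real pi * \<i> * z))"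
  \<comment> \<open>The case distinctions fill the removable singularity at 0.\<close>
  define g where "g = (\<lambda>z. (if z = 0 then deriv P 0 else (P z - P 0) / (z - 0)) / (if z = 0 then deriv E 0 else (E z - E 0) / (z - 0)))"
  define U where "U = {z :: complex. \<bar>Re z\<bar> < 3 / 4}"
  have opU: "open U"
  proof -
    have "U = {z. Re z < 3 / 4} \<inter> {z. Re z > - 3 / 4}" by (auto simp: U_def)
    then show ?thesis by (simp only:) (intro open_Int open_halfspace_Re_lt open_halfspace_Re_gt)
  qed
  have dE: "(E has_field_derivative 2 * of_real pi * \<i> * E z) (at z)" for z
    unfolding E_def by (auto intro!: derivative_eq_intros)
  have E1: "E z \<noteq> 1" if "z \<in> U" "z \<noteq> 0" for z
  proof
    assume "E z = 1"
    then obtain n :: int where "Re (2 * of_real pi * \<i> * z) = 0" "Im (2 * of_real pi * \<i> * z) = of_int (2 * n) * pi"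
      unfolding E_def exp_eq_1 by auto
    then have z: "Im z = 0" "Re z = of_int n" by auto
    with that(1) have "n = 0" by (auto simp: U_def)
    with z that(2) show False by (auto simp: complex_eq_iff)
  qed
  have holg: "g holomorphic_on U"
    unfolding g_def
  proof (rule holomorphic_on_divide)
    show "(\<lambda>z. if z = 0 then deriv P 0 else (P z - P 0) / (z - 0)) holomorphic_on U"
      by (rule pole_lemma) (use hol opU in \<open>auto simp: interior_open U_def intro: holomorphic_on_subset\<close>)
    show "(\<lambda>z. if z = 0 then deriv E 0 else (E z - E 0) / (z - 0)) holomorphic_on U"
      by (rule pole_lemma) (use opU in \<open>auto simp: interior_open U_def E_def intro!: holomorphic_intros\<close>)
    show "(if z = 0 then deriv E 0 else (E z - E 0) / (z - 0)) \<noteq> 0" if "z \<in> U" for z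
      using E1[OF that] DERIV_imp_deriv[OF dE[of 0]] by (auto simp: E_def)
  qed
  have g_eq: "P z = P 0 + g z * (E z - 1)" if "z \<in> U" for z
    using E1[OF that] by (auto simp: g_def E_def)
  have inU: "of_real x \<in> U" if "x \<in> {- 1 / 2..1 / 2}" for x
    using that by (auto simp: U_def)
  have g_per: "g (1 / 2) = g (- 1 / 2)"
  proof -
    have E2: "E (1 / 2) = - 1" "E (- 1 / 2) = - 1"
      using exp_pi_i by (auto simp: E_def exp_minus)
    have "1 / 2 \<in> U" "- 1 / 2 \<in> U" by (auto simp: U_def)
    from g_eq[OF this(1)] g_eq[OF this(2)] per show ?thesis
      unfolding E2 by auto
  qed
  have contg: "continuous_on {- 1 / 2..1 / 2} (\<lambda>x::real. g (of_real x))"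
    by (rule continuous_on_compose2[OF holomorphic_on_imp_continuous_on[OF holg]]) (auto intro!: continuous_intros inU)
  have contdg: "continuous_on {- 1 / 2..1 / 2} (\<lambda>x::real. deriv g (of_real x))"
    by (rule continuous_on_compose2[OF holomorphic_on_imp_continuous_on[OF holomorphic_deriv[OF holg opU]]])
      (auto intro!: continuous_intros inU)
  have contP: "continuous_on A (\<lambda>x::real. P (of_real x))" for A
    by (rule continuous_on_compose2[OF holomorphic_on_imp_continuous_on[OF hol]]) (auto intro!: continuous_intros)
  have cont_cis: "continuous_on A (\<lambda>x. cis (r * x))" for r A
    by (auto simp: cis_conv_exp intro!: continuous_intros)
  define m where "m = (\<lambda>k::int. 2 * complex_of_real pi * \<i> * of_int k)"
  define e where "e = (\<lambda>k::int. \<lambda>x::real. cis (- 2 * pi * of_int k * x))"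
  have conte: "continuous_on A (e k)" for A k
    unfolding e_def by (rule cont_cis)
  define h where "h = (\<lambda>k. integral {- 1 / 2..1 / 2} (\<lambda>x. g (of_real x) * e k x))"
  define B where "B = integral {- 1 / 2..1 / 2} (\<lambda>x. norm (deriv g (of_real x)))"
  have de: "(e k has_vector_derivative (- m k * e k x)) (at x within S)" for k x S
  proof -
    have "((\<lambda>z. exp (- m k * z)) has_field_derivative
        (- m k * exp (- m k * of_real x))) (at (of_real x))"
      by (auto intro!: derivative_eq_intros)
    from has_vector_derivative_real_field[OF this] show ?thesis
      by (simp add: e_def m_def cis_conv_exp mult_ac)
  qed
  have e_half: "e k (1 / 2) = e k (- 1 / 2)" for k
  proof -
    have "e k (1 / 2) = e k (- 1 / 2) * cis (2 * pi * of_int (- k))"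
      by (simp add: e_def cis_mult)
    also have "cis (2 * pi * of_int (- k)) = 1"
      by (rule cis_multiple_2pi) auto
    finally show ?thesis by simp
  qed
  \<comment> \<open>Boundary terms of the integration by parts cancel since \<open>g\<close> takes equal values at \<open>1/2\<close> and \<open>- 1/2\<close>.\<close>
  have h_bound: "norm (m k * h k) \<le> B" for k
  proof -
    have "((\<lambda>x. g (of_real x) * (- m k * e k x) + deriv g (of_real x) * e k x)
        has_integral (g (of_real (1 / 2)) * e k (1 / 2) - g (of_real (- 1 / 2)) * e k (- 1 / 2))) {- 1 / 2..1 / 2}"
    proof (rule fundamental_theorem_of_calculus)
      fix x :: real assume x: "x \<in> {- 1 / 2..1 / 2}"
      have "(g has_field_derivative deriv g (of_real x)) (at (of_real x))"
        using holomorphic_derivI[OF holg opU inU[OF x]] .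
      from has_vector_derivative_mult[OF has_vector_derivative_real_field[OF this] de[of k x]]
      show "((\<lambda>x. g (of_real x) * e k x) has_vector_derivative
         g (of_real x) * (- m k * e k x) + deriv g (of_real x) * e k x) (at x within {- 1 / 2..1 / 2})" .
    qed auto
    then have f1: "integral {- 1 / 2..1 / 2} (\<lambda>x. g (of_real x) * (- m k * e k x) + deriv g (of_real x) * e k x) = 0"
      using e_half[of k] g_per by (simp add: integral_unique)
    have f2: "integral {- 1 / 2..1 / 2} (\<lambda>x. g (of_real x) * (- m k * e k x) + deriv g (of_real x) * e k x) =
       integral {- 1 / 2..1 / 2} (\<lambda>x. - m k * (g (of_real x) * e k x)) + integral {- 1 / 2..1 / 2} (\<lambda>x. deriv g (of_real x) * e k x)"
      by (subst Henstock_Kurzweil_Integration.integral_add[symmetric])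
        (intro integrable_continuous_real continuous_intros contg contdg conte refl | simp only: mult_ac)+
    have f3: "integral {- 1 / 2..1 / 2} (\<lambda>x. - m k * (g (of_real x) * e k x)) = - m k * h k"
      unfolding h_def by (rule Henstock_Kurzweil_Integration.integral_mult_right)
    have "- m k * h k + integral {- 1 / 2..1 / 2} (\<lambda>x. deriv g (of_real x) * e k x) = 0"
      unfolding f3[symmetric] f2[symmetric] by (rule f1)
    then have "m k * h k = integral {- 1 / 2..1 / 2} (\<lambda>x. deriv g (of_real x) * e k x)"
      by (simp only: mult_minus_left add.commute[of "- _"] diff_conv_add_uminus[symmetric] right_minus_eq)
    also have "norm \<dots> \<le> B"
      unfolding B_def
      by (rule integral_norm_bound_integral)
        (use contdg conte[of _ k] in \<open>auto intro!: integrable_continuous_real continuous_intros simp: norm_mult e_def\<close>)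
    finally show ?thesis .
  qed
  have h_le: "norm (h k) \<le> B / (2 * pi) / real_of_int \<bar>k\<bar>" if "k \<noteq> 0" for k
    using h_bound[of k] that pi_gt_zero by (simp add: m_def norm_mult field_simps)
  have c_eq: "c k = (if k = 0 then P 0 else 0) + h (k - 1) - h k" for k
  proof -
    have ee: "e k x * E (of_real x) = e (k - 1) x" for x
      by (simp add: e_def E_def cis_conv_exp exp_add[symmetric] algebra_simps)
    have "c k = integral {- 1 / 2..1 / 2} (\<lambda>x. P 0 * e k x + (g (of_real x) * e (k - 1) x - g (of_real x) * e k x))"
      unfolding c
    proof (rule Henstock_Kurzweil_Integration.integral_cong)
      fix x :: real assume x: "x \<in> {- 1 / 2..1 / 2}"
      have "P (of_real x) * e k x = P 0 * e k x + (g (of_real x) * (e k x * E (of_real x)) - g (of_real x) * e k x)"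
        by (subst g_eq[OF inU[OF x]]) (simp add: algebra_simps)
      then show "P (of_real x) * cis (- 2 * pi * of_int k * x) = P 0 * e k x + (g (of_real x) * e (k - 1) x - g (of_real x) * e k x)"
        unfolding ee by (simp add: e_def)
    qed
    also have "\<dots> = integral {- 1 / 2..1 / 2} (\<lambda>x. P 0 * e k x) + (h (k - 1) - h k)"
      unfolding h_def
      by (rule integral_add_diff) (intro continuous_intros contg conte)+
    also have "integral {- 1 / 2..1 / 2} (\<lambda>x. P 0 * e k x) = P 0 * integral {- 1 / 2..1 / 2} (e k)"
      by (rule Henstock_Kurzweil_Integration.integral_mult_right)
    also have "integral {- 1 / 2..1 / 2} (e k) = (if k = 0 then 1 else 0)"
    proof (cases "k = 0")
      case True
      then have "e k = (\<lambda>x. 1)" by (simp add: e_def)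
      then show ?thesis using True by simp
    next
      case False
      have "((\<lambda>x. - m k * e k x) has_integral (e k (1 / 2) - e k (- 1 / 2))) {- 1 / 2..1 / 2}"
        by (rule fundamental_theorem_of_calculus) (simp, rule de)
      then have "integral {- 1 / 2..1 / 2} (\<lambda>x. - m k * e k x) = 0"
        by (simp only: integral_unique e_half[of k] diff_self)
      then have "- m k * integral {- 1 / 2..1 / 2} (e k) = 0"
        by (simp only: Henstock_Kurzweil_Integration.integral_mult_right)
      then show ?thesis using False by (simp add: m_def)
    qed
    finally show ?thesis by simp
  qed
  have tele: "c 0 + (\<Sum>n<N. c (int (Suc n)) + c (- int (Suc n))) = P 0 + (h (- int (Suc N)) - h (int N))" for N
  proof (induction N)
    case 0
    then show ?case by (simp add: c_eq)
  next
    case (Suc N)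
    have 1: "c (int (Suc N)) = h (int N) - h (int (Suc N))"
      by (simp add: c_eq)
    have "- int (Suc N) - 1 = - int (Suc (Suc N))" by simp
    then have 2: "c (- int (Suc N)) = h (- int (Suc (Suc N))) - h (- int (Suc N))"
      using c_eq[of "- int (Suc N)"] by simp
    have "c 0 + (\<Sum>n<Suc N. c (int (Suc n)) + c (- int (Suc n))) =
        (c 0 + (\<Sum>n<N. c (int (Suc n)) + c (- int (Suc n)))) + (c (int (Suc N)) + c (- int (Suc N)))"
      by (simp only: sum.lessThan_Suc add.assoc)
    also have "\<dots> = P 0 + (h (- int (Suc (Suc N))) - h (int (Suc N)))"
      unfolding Suc.IH 1 2 by algebra
    finally show ?case .
  qed
  have lim: "(\<lambda>N. h (- int (Suc N))) \<longlonglongrightarrow> 0" "(\<lambda>N. h (int (Suc N))) \<longlonglongrightarrow> 0"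
  proof -
    have z: "(\<lambda>N. B / (2 * pi) / real (Suc N)) \<longlonglongrightarrow> 0" by real_asymp
    show "(\<lambda>N. h (- int (Suc N))) \<longlonglongrightarrow> 0"
    proof (rule Lim_null_comparison[OF always_eventually[OF allI] z])
      show "norm (h (- int (Suc N))) \<le> B / (2 * pi) / real (Suc N)" for N
        using h_le[of "- int (Suc N)"] by (simp add: ac_simps)
    qed
    show "(\<lambda>N. h (int (Suc N))) \<longlonglongrightarrow> 0"
    proof (rule Lim_null_comparison[OF always_eventually[OF allI] z])
      show "norm (h (int (Suc N))) \<le> B / (2 * pi) / real (Suc N)" for N
        using h_le[of "int (Suc N)"] by (simp add: ac_simps)
    qed
  qed
  then have "(\<lambda>N. h (int N)) \<longlonglongrightarrow> 0"
    by (simp only: filterlim_sequentially_Suc[of "\<lambda>N. h (int N)"])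
  with lim have "(\<lambda>N. P 0 + (h (- int (Suc N)) - h (int N))) \<longlonglongrightarrow> P 0 + (0 - 0)"
    by (intro tendsto_intros)
  then show ?thesis by (simp only: tele) simp
qed

definition gauss :: "real \<Rightarrow> complex \<Rightarrow> complex \<Rightarrow> complex" where
  "gauss a b z = exp (- (of_real a * z\<^sup>2) + b * z)"

text \<open>
  Completing the square: the real part of \<open>b\<close> is removed by a translation, and the imaginary
  part is the Fourier variable.
\<close>
lemma gaussian_integral:
  assumes a: "a > 0"
  shows "integrable lborel (\<lambda>x. gauss a b (of_real x))"
    and "(LBINT x. gauss a b (of_real x)) = of_real (sqrt (pi / a)) * exp (b\<^sup>2 / of_real (4 * a))"
proof -
  define p q where "p = Re b" and "q = Im b"
  have b: "b = of_real p + \<i> * of_real q"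
    by (simp add: p_def q_def complex_eq)
  define r where "r = sqrt (2 * a)"
  have r: "r > 0" "r\<^sup>2 = 2 * a" using a by (auto simp: r_def)
  have r2: "complex_of_real r * complex_of_real r = 2 * of_real a"
    using r(2) by (metis of_real_mult of_real_numeral power2_eq_square)
  let ?t = "p / (2 * a)"
  define K where "K = exp (complex_of_real (p\<^sup>2 / (4 * a)) + \<i> * of_real (q * p / (2 * a)))"
  have eq: "gauss a b (of_real (?t + 1 / r * u)) = K * (exp (- (of_real u)\<^sup>2 / 2) * cis (u * (q / r)))" for u
  proof -
    have "- (a * (?t + 1 / r * u)\<^sup>2) + p * (?t + 1 / r * u) = p\<^sup>2 / (4 * a) - u\<^sup>2 / 2"
    proof -
      have "a * (?t + 1 / r * u)\<^sup>2 = a * ?t\<^sup>2 + 2 * a * ?t * u / r + a * u\<^sup>2 / r\<^sup>2"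
        by (simp add: power2_sum power_divide algebra_simps)
      also have "a * u\<^sup>2 / r\<^sup>2 = u\<^sup>2 / 2" using a r by simp
      also have "2 * a * ?t * u / r = p * u / r" using a by simp
      also have "a * ?t\<^sup>2 = p\<^sup>2 / (4 * a)" using a by (simp add: power2_eq_square)
      finally show ?thesis using a by (simp add: power2_eq_square algebra_simps)
    qed
    then have 1: "complex_of_real (- (a * (?t + 1 / r * u)\<^sup>2) + p * (?t + 1 / r * u)) = of_real (p\<^sup>2 / (4 * a) - u\<^sup>2 / 2)"
      by (rule arg_cong)
    have "- (of_real a * (complex_of_real (?t + 1 / r * u))\<^sup>2) + b * of_real (?t + 1 / r * u) =
       of_real (- (a * (?t + 1 / r * u)\<^sup>2) + p * (?t + 1 / r * u)) + \<i> * of_real (q * (?t + 1 / r * u))"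
      unfolding b of_real_add of_real_minus of_real_mult of_real_power by (simp only: distrib_right add.assoc mult.assoc)
    also have "\<dots> = (of_real (p\<^sup>2 / (4 * a)) + \<i> * of_real (q * p / (2 * a))) + (- (of_real u)\<^sup>2 / 2 + \<i> * of_real (u * (q / r)))"
      unfolding 1 by (simp add: algebra_simps)
    finally show ?thesis
      unfolding gauss_def K_def cis_conv_exp by (simp only: exp_add)
  qed
  have "integrable lborel (\<lambda>u. gauss a b (of_real (?t + 1 / r * u)))"
    unfolding eq by (intro integrable_mult_right gaussian_fourier)
  then show "integrable lborel (\<lambda>x. gauss a b (of_real x))"
    using lborel_integrable_real_affine_iff[of "1 / r" "\<lambda>x. gauss a b (of_real x)" ?t] r by simp
  have "(LBINT x. gauss a b (of_real x)) = (1 / r) *\<^sub>R (LBINT u. gauss a b (of_real (?t + 1 / r * u)))"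
    using lborel_integral_real_affine[of "1 / r" "\<lambda>x. gauss a b (of_real x)" ?t] r by simp
  also have "\<dots> = of_real (1 / r) * (K * (of_real (sqrt (2 * pi)) * exp (- (of_real (q / r))\<^sup>2 / 2)))"
    unfolding eq integral_mult_right_zero gaussian_fourier(2) by (simp add: scaleR_conv_of_real)
  also have "\<dots> = of_real (sqrt (2 * pi) / r) * (K * exp (- (of_real (q / r))\<^sup>2 / 2))"
    by simp
  also have "sqrt (2 * pi) / r = sqrt (pi / a)"
    by (simp add: r_def real_sqrt_divide[symmetric])
  also have "K * exp (- (of_real (q / r))\<^sup>2 / 2) = exp (b\<^sup>2 / of_real (4 * a))"
  proof -
    have "(complex_of_real (q / r))\<^sup>2 = of_real (q\<^sup>2 / (2 * a))"
      using r(2) by (metis of_real_power power_divide)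
    moreover have b2: "b\<^sup>2 = of_real (p\<^sup>2 - q\<^sup>2) + \<i> * of_real (2 * p * q)"
      by (simp add: b power2_eq_square algebra_simps)
    ultimately show ?thesis
      unfolding K_def exp_add[symmetric] b2 by (simp add: add_divide_distrib diff_divide_distrib algebra_simps)
  qed
  finally show "(LBINT x. gauss a b (of_real x)) = of_real (sqrt (pi / a)) * exp (b\<^sup>2 / of_real (4 * a))" .
qed

text \<open>
  The translates of a Gaussian decay geometrically in the shift, uniformly on a disc, which gives the
  locally uniform convergence of the periodised Gaussian.
\<close>
lemma gauss_shift_bound:
  assumes a: "a > 0"
  obtains C where "\<And>z m. norm z \<le> R \<Longrightarrow> norm (gauss a b (z + of_real m)) \<le> C * exp (- \<bar>m\<bar>)"
proof -
  define B where "B = 2 * a * R + norm b + 1"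
  define C where "C = exp (a * R\<^sup>2 + norm b * R + B\<^sup>2 / (4 * a))"
  have "norm (gauss a b (z + of_real m)) \<le> C * exp (- \<bar>m\<bar>)" if z: "norm z \<le> R" for z m
  proof -
    have R: "R \<ge> 0" using z norm_ge_zero order_trans by blast
    have "Re ((z + of_real m)\<^sup>2) = Re (z\<^sup>2) + 2 * m * Re z + m\<^sup>2"
      by (simp add: power2_eq_square algebra_simps)
    moreover have "Re (z\<^sup>2) \<ge> - R\<^sup>2"
    proof -
      have "\<bar>Re (z\<^sup>2)\<bar> \<le> (norm z)\<^sup>2" using abs_Re_le_cmod[of "z\<^sup>2"] by (simp add: norm_power)
      also have "\<dots> \<le> R\<^sup>2" using z by (intro power_mono) auto
      finally show ?thesis by linarith
    qed
    moreover have "2 * m * Re z \<ge> - (2 * \<bar>m\<bar> * R)"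
    proof -
      have "\<bar>2 * m * Re z\<bar> \<le> 2 * \<bar>m\<bar> * R"
        unfolding abs_mult using abs_Re_le_cmod[of z] z by (intro mult_mono) auto
      then show ?thesis by linarith
    qed
    ultimately have "Re ((z + of_real m)\<^sup>2) \<ge> m\<^sup>2 - R\<^sup>2 - 2 * \<bar>m\<bar> * R" by linarith
    then have 1: "- (a * Re ((z + of_real m)\<^sup>2)) \<le> - (a * (m\<^sup>2 - R\<^sup>2 - 2 * \<bar>m\<bar> * R))"
      using a by simp
    have 2: "Re (b * (z + of_real m)) \<le> norm b * (R + \<bar>m\<bar>)"
    proof -
      have "norm (z + of_real m) \<le> R + \<bar>m\<bar>"
        using norm_triangle_ineq[of z "of_real m"] z by simp
      then show ?thesis
        using complex_Re_le_cmod[of "b * (z + of_real m)"] by (simp add: norm_mult) (meson mult_left_mono norm_ge_zero order_trans)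
    qed
    have 3: "- (a * m\<^sup>2) + B * \<bar>m\<bar> \<le> B\<^sup>2 / (4 * a)"
    proof -
      have "0 \<le> (2 * a * \<bar>m\<bar> - B)\<^sup>2" by simp
      then have "4 * a * (- (a * m\<^sup>2) + B * \<bar>m\<bar>) \<le> B\<^sup>2"
        by (simp add: power2_diff power_mult_distrib algebra_simps power2_eq_square[of a])
      then show ?thesis using a by (simp add: field_simps)
    qed
    have "Re (- (of_real a * (z + of_real m)\<^sup>2) + b * (z + of_real m)) \<le>
       (a * R\<^sup>2 + norm b * R + B\<^sup>2 / (4 * a)) + (- \<bar>m\<bar>)"
      using 1 2 3 by (simp add: B_def algebra_simps)
    then show ?thesis
      by (simp add: gauss_def C_def exp_add[symmetric])
  qed
  then show ?thesis by (rule that)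
qed

text \<open>
  The periodised Gaussian is entire, so its Fourier series at 0 converges to its value there.  Its
  Fourier coefficients over one period unfold to Gaussian integrals over the whole line.  The
  two symmetric partial sums have a common limit; the form with \<open>n\<close> and \<open>- n\<close> paired is the
  one that becomes a cosine series.
\<close>
lemma poisson_summation_gauss:
  fixes a :: real and b :: complex
  assumes a: "a > 0"
  obtains L where
    "(\<lambda>N. 1 + (\<Sum>n<N. gauss a b (of_nat (Suc n)) + gauss a b (- of_nat (Suc n)))) \<longlonglongrightarrow> L"
    "(\<lambda>N. of_real (sqrt (pi / a)) * (exp (b\<^sup>2 / of_real (4 * a)) +
       (\<Sum>n<N. exp ((b - 2 * of_real pi * \<i> * of_nat (Suc n))\<^sup>2 / of_real (4 * a))
             + exp ((b + 2 * of_real pi * \<i> * of_nat (Suc n))\<^sup>2 / of_real (4 * a))))) \<longlonglongrightarrow> L"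
proof -
  define G where "G = gauss a b"
  define f where "f = (\<lambda>n z. G (z + of_nat (Suc n)) + G (z - of_nat (Suc n)))"
  define P where "P = (\<lambda>z. G z + (\<Sum>n. f n z))"
  define S where "S = (\<lambda>N z. G z + (\<Sum>n<N. f n z))"
  have holG: "G holomorphic_on A" for A
    unfolding G_def gauss_def[abs_def] by (intro holomorphic_intros)
  have holf: "f n holomorphic_on A" for n A
    unfolding f_def G_def gauss_def by (intro holomorphic_intros)
  have unif: "uniform_limit (cball 0 R) S P sequentially" for R
  proof -
    obtain C where C: "\<And>z m. norm z \<le> R \<Longrightarrow> norm (G (z + of_real m)) \<le> C * exp (- \<bar>m\<bar>)"
      using gauss_shift_bound[OF a, of R b] unfolding G_def by blast
    have "uniform_limit (cball 0 R) (\<lambda>N z. \<Sum>n<N. f n z) (\<lambda>z. \<Sum>n. f n z) sequentially"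
    proof (rule Weierstrass_m_test)
      show "norm (f n z) \<le> 2 * C * exp (- real (Suc n))" if "z \<in> cball 0 R" for n z
      proof -
        have "norm (f n z) \<le> norm (G (z + of_real (real (Suc n)))) + norm (G (z + of_real (- real (Suc n))))"
          unfolding f_def using norm_triangle_ineq by (auto simp: algebra_simps)
        also have "\<dots> \<le> C * exp (- real (Suc n)) + C * exp (- real (Suc n))"
          using C[of z "real (Suc n)"] C[of z "- real (Suc n)"] that
          by (intro add_mono) (simp_all only: mem_cball dist_0_norm abs_of_nat abs_minus_cancel)
        finally show ?thesis by simp
      qed
      have "summable (\<lambda>n. exp (- 1 :: real) ^ Suc n)"
        by (subst summable_Suc_iff, rule summable_geometric) simp
      then have "summable (\<lambda>n. 2 * C * exp (- 1 :: real) ^ Suc n)"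
        by (rule summable_mult)
      moreover have "exp (- 1 :: real) ^ m = exp (- real m)" for m
        by (simp add: exp_of_nat_mult[symmetric])
      ultimately show "summable (\<lambda>n. 2 * C * exp (- real (Suc n)))" by (simp only:)
    qed
    then show ?thesis
      unfolding P_def S_def by (intro uniform_limit_intros)
  qed
  have holP: "P holomorphic_on UNIV"
  proof (rule holomorphic_uniform_sequence)
    show "S N holomorphic_on UNIV" for N
      unfolding S_def by (intro holomorphic_intros holG holf)
    show "\<exists>d>0. cball z d \<subseteq> UNIV \<and> uniform_limit (cball z d) S P sequentially" for z
    proof (intro exI[of _ 1] conjI)
      have "cball z 1 \<subseteq> cball 0 (norm z + 1)"
        unfolding cball_subset_cball_iff by (simp add: dist_norm)
      then show "uniform_limit (cball z 1) S P sequentially"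
        by (rule uniform_limit_on_subset[OF unif])
    qed auto
  qed auto
  have PN: "(\<lambda>N. S N z) \<longlonglongrightarrow> P z" for z
    using tendsto_uniform_limitI[OF unif[of "norm z"], of z] by simp
  have per: "P (1 / 2) = P (- 1 / 2)"
  proof -
    \<comment> \<open>Shifting the partial sum by 1 changes it by two far translates only.\<close>
    have tele: "S N (z + 1) - S N z = G (z + 1 + of_real (real N)) - G (z + of_real (- real N))" for N z
      by (induction N) (simp_all add: S_def f_def algebra_simps)
    obtain C where C: "\<And>z m. norm z \<le> 1 \<Longrightarrow> norm (G (z + of_real m)) \<le> C * exp (- \<bar>m\<bar>)"
      using gauss_shift_bound[OF a, of 1 b] unfolding G_def by blast
    have z: "(\<lambda>N. C * exp (- \<bar>real N\<bar>)) \<longlonglongrightarrow> 0"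
      by (auto intro!: tendsto_mult_right_zero) real_asymp
    have "(\<lambda>N. G (- 1 / 2 + 1 + of_real (real N))) \<longlonglongrightarrow> 0"
      by (rule Lim_null_comparison[OF always_eventually[OF allI] z]) (rule C, simp)
    moreover have "(\<lambda>N. G (- 1 / 2 + of_real (- real N))) \<longlonglongrightarrow> 0"
      by (rule Lim_null_comparison[OF always_eventually[OF allI] z]) (use C[of "- 1 / 2" "- real _"] in simp)
    ultimately have "(\<lambda>N. G (- 1 / 2 + 1 + of_real (real N)) - G (- 1 / 2 + of_real (- real N))) \<longlonglongrightarrow> 0 - 0"
      by (rule tendsto_diff)
    moreover have "(\<lambda>N. S N (- 1 / 2 + 1) - S N (- 1 / 2)) \<longlonglongrightarrow> P (- 1 / 2 + 1) - P (- 1 / 2)"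
      by (intro tendsto_diff PN)
    ultimately have "P (- 1 / 2 + 1) - P (- 1 / 2) = 0"
      unfolding tele using LIMSEQ_unique by fastforce
    then show ?thesis by simp
  qed
  define c where "c = (\<lambda>k::int. integral {- 1 / 2..1 / 2} (\<lambda>x. P (of_real x) * cis (- 2 * pi * of_int k * x)))"
  have c_val: "c k = of_real (sqrt (pi / a)) * exp ((b - 2 * of_real pi * \<i> * of_int k)\<^sup>2 / of_real (4 * a))" for k
  proof -
    define Q where "Q = (\<lambda>x::real. G (of_real x) * cis (- 2 * pi * of_int k * x))"
    have contG: "continuous_on A (\<lambda>x::real. G (of_real x))" for A
      by (rule continuous_on_compose2[OF holomorphic_on_imp_continuous_on[OF holG[of UNIV]]]) (auto intro!: continuous_intros)
    have contf: "continuous_on A (\<lambda>x::real. f n (of_real x))" for A n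
      by (rule continuous_on_compose2[OF holomorphic_on_imp_continuous_on[OF holf[of n UNIV]]]) (auto intro!: continuous_intros)
    have cont_cis: "continuous_on A (\<lambda>x. cis (r * x))" for r A
      by (auto simp: cis_conv_exp intro!: continuous_intros)
    have contQ: "continuous_on A Q" for A
      unfolding Q_def by (intro continuous_on_mult contG cont_cis)
    have cont_part: "continuous_on A (\<lambda>x. S N (of_real x) * cis (- 2 * pi * of_int k * x))" for A N
      unfolding S_def by (intro continuous_on_mult continuous_on_add continuous_on_sum contG contf cont_cis)
    have Q_gauss: "Q x = gauss a (b - 2 * of_real pi * \<i> * of_int k) (of_real x)" for x
      by (simp add: Q_def G_def gauss_def cis_conv_exp exp_add[symmetric] algebra_simps)
    have Q_shift: "G (of_real x + of_int m) * cis (- 2 * pi * of_int k * x) = Q (x + of_int m)" for x m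
    proof -
      have "cis (- 2 * pi * of_int k * (x + of_int m)) = cis (- 2 * pi * of_int k * x) * cis (2 * pi * of_int (- k * m))"
        by (simp add: cis_mult algebra_simps)
      also have "cis (2 * pi * of_int (- k * m)) = 1"
        by (rule cis_multiple_2pi) auto
      finally show ?thesis by (simp add: Q_def)
    qed
    have int_shift: "integral {- 1 / 2..1 / 2} (\<lambda>x. Q (x + r)) = integral {r - 1 / 2..r + 1 / 2} Q" for r
      using integral_shift[of "- 1 / 2" r "1 / 2" Q] contQ by (simp add: o_def add.commute)
    \<comment> \<open>Unfolding: the partial sum over one period is the Gaussian over a long interval.\<close>
    have part: "integral {- 1 / 2..1 / 2} (\<lambda>x. S N (of_real x) * cis (- 2 * pi * of_int k * x)) =
        integral {- real N - 1 / 2..real N + 1 / 2} Q" for N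
    proof (induction N)
      case 0
      then show ?case by (simp add: S_def Q_def)
    next
      case (Suc N)
      have "integral {- 1 / 2..1 / 2} (\<lambda>x. S (Suc N) (of_real x) * cis (- 2 * pi * of_int k * x)) =
         integral {- 1 / 2..1 / 2} (\<lambda>x. S N (of_real x) * cis (- 2 * pi * of_int k * x) +
           (Q (x + real (Suc N)) + Q (x + (- real (Suc N)))))"
      proof (rule Henstock_Kurzweil_Integration.integral_cong)
        fix x :: real
        show "S (Suc N) (of_real x) * cis (- 2 * pi * of_int k * x) =
          S N (of_real x) * cis (- 2 * pi * of_int k * x) + (Q (x + real (Suc N)) + Q (x + (- real (Suc N))))"
          using Q_shift[of x "int (Suc N)"] Q_shift[of x "- int (Suc N)"]
          by (simp add: S_def f_def algebra_simps)
      qed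
      also have "\<dots> = integral {- real N - 1 / 2..real N + 1 / 2} Q +
          (integral {real (Suc N) - 1 / 2..real (Suc N) + 1 / 2} Q + integral {- real (Suc N) - 1 / 2..- real (Suc N) + 1 / 2} Q)"
      proof -
        have "continuous_on {- 1 / 2..1 / 2} (\<lambda>x. Q (x + r))" for r
          by (rule continuous_on_compose2[OF contQ[of UNIV]]) (auto intro!: continuous_intros)
        then show ?thesis
          unfolding Suc.IH[symmetric] int_shift[symmetric] by (intro integral_add_add cont_part)
      qed
      also have "\<dots> = integral {- real (Suc N) - 1 / 2..real (Suc N) + 1 / 2} Q"
      proof -
        have 1: "integral {- real (Suc N) - 1 / 2..- real (Suc N) + 1 / 2} Q + integral {- real (Suc N) + 1 / 2..real N + 1 / 2} Q =
            integral {- real (Suc N) - 1 / 2..real N + 1 / 2} Q"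
          by (rule Henstock_Kurzweil_Integration.integral_combine) (auto intro!: integrable_continuous_real contQ)
        have 2: "integral {- real (Suc N) - 1 / 2..real N + 1 / 2} Q + integral {real N + 1 / 2..real (Suc N) + 1 / 2} Q =
            integral {- real (Suc N) - 1 / 2..real (Suc N) + 1 / 2} Q"
          by (rule Henstock_Kurzweil_Integration.integral_combine) (auto intro!: integrable_continuous_real contQ)
        have e: "- real (Suc N) + 1 / 2 = - real N - 1 / 2" "real (Suc N) - 1 / 2 = real N + 1 / 2" by auto
        show ?thesis unfolding 2[symmetric] 1[symmetric] unfolding e by simp
      qed
      finally show ?case .
    qed
    have intQ: "integrable lborel Q"
      using gaussian_integral(1)[OF a] by (simp only: Q_gauss[abs_def])
    have "(\<lambda>N. integral {- real N - 1 / 2..real N + 1 / 2} Q) \<longlonglongrightarrow> (LBINT x. Q x)"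
    proof -
      have eq: "integral {- real N - 1 / 2..real N + 1 / 2} Q = (LBINT x. indicator {- real N - 1 / 2..real N + 1 / 2} x *\<^sub>R Q x)" for N
      proof -
        have "set_integrable lborel {- real N - 1 / 2..real N + 1 / 2} Q"
          unfolding set_integrable_def using intQ by (intro integrable_mult_indicator) auto
        from set_borel_integral_eq_integral(2)[OF this] show ?thesis
          by (simp add: set_lebesgue_integral_def)
      qed
      show ?thesis
        unfolding eq
      proof (rule integral_dominated_convergence[where w = "\<lambda>x. norm (Q x)"])
        show "AE x in lborel. (\<lambda>N. indicator {- real N - 1 / 2..real N + 1 / 2} x *\<^sub>R Q x) \<longlonglongrightarrow> Q x"
        proof (intro AE_I2 tendsto_eventually)
          fix x :: real
          obtain M where M: "\<bar>x\<bar> \<le> real M" using real_arch_simple by blast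
          show "\<forall>\<^sub>F N in sequentially. indicator {- real N - 1 / 2..real N + 1 / 2} x *\<^sub>R Q x = Q x"
            using eventually_ge_at_top[of M]
          proof eventually_elim
            case (elim N)
            then have "real M \<le> real N" by simp
            with M have "x \<in> {- real N - 1 / 2..real N + 1 / 2}" by auto
            then show ?case by simp
          qed
        qed
      qed (use intQ in \<open>auto simp: indicator_def\<close>)
    qed
    moreover have "(\<lambda>N. integral {- 1 / 2..1 / 2} (\<lambda>x. S N (of_real x) * cis (- 2 * pi * of_int k * x))) \<longlonglongrightarrow> c k"
    proof -
      have "uniform_limit {- 1 / 2..1 / 2} (\<lambda>N x. S N (of_real x) * cis (- 2 * pi * of_int k * x))
          (\<lambda>x. P (of_real x) * cis (- 2 * pi * of_int k * x)) sequentially"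
      proof (rule uniform_limitI)
        fix \<epsilon> :: real assume "\<epsilon> > 0"
        from uniform_limitD[OF unif[of 1] this]
        show "\<forall>\<^sub>F N in sequentially. \<forall>x\<in>{- 1 / 2..1 / 2}.
            dist (S N (of_real x) * cis (- 2 * pi * of_int k * x)) (P (of_real x) * cis (- 2 * pi * of_int k * x)) < \<epsilon>"
        proof eventually_elim
          case (elim N)
          show ?case
          proof
            fix x :: real assume "x \<in> {- 1 / 2..1 / 2}"
            then have "complex_of_real x \<in> cball 0 1" by auto
            with elim have "dist (S N (of_real x)) (P (of_real x)) < \<epsilon>" by blast
            then show "dist (S N (of_real x) * cis (- 2 * pi * of_int k * x)) (P (of_real x) * cis (- 2 * pi * of_int k * x)) < \<epsilon>"
              by (simp add: dist_norm norm_mult flip: left_diff_distrib)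
          qed
        qed
      qed
      then obtain I J where IJ:
        "\<And>N. ((\<lambda>x. S N (of_real x) * cis (- 2 * pi * of_int k * x)) has_integral I N) {- 1 / 2..1 / 2}"
        "((\<lambda>x. P (of_real x) * cis (- 2 * pi * of_int k * x)) has_integral J) {- 1 / 2..1 / 2}"
        "I \<longlonglongrightarrow> J"
        by (rule uniform_limit_integral) (use cont_part in auto)
      then show ?thesis
        unfolding c_def IJ(1)[THEN integral_unique] IJ(2)[THEN integral_unique] by blast
    qed
    ultimately have "c k = (LBINT x. Q x)"
      unfolding part using LIMSEQ_unique by blast
    then show ?thesis
      unfolding Q_gauss gaussian_integral(2)[OF a] .
  qed
  have "(\<lambda>N. c 0 + (\<Sum>n<N. c (int (Suc n)) + c (- int (Suc n)))) \<longlonglongrightarrow> P 0"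
    by (rule fourier_series_at_zero[OF holP per]) (simp add: c_def)
  then have "(\<lambda>N. of_real (sqrt (pi / a)) * (exp (b\<^sup>2 / of_real (4 * a)) +
       (\<Sum>n<N. exp ((b - 2 * of_real pi * \<i> * of_nat (Suc n))\<^sup>2 / of_real (4 * a))
             + exp ((b + 2 * of_real pi * \<i> * of_nat (Suc n))\<^sup>2 / of_real (4 * a))))) \<longlonglongrightarrow> P 0"
  proof -
    assume lim: "(\<lambda>N. c 0 + (\<Sum>n<N. c (int (Suc n)) + c (- int (Suc n)))) \<longlonglongrightarrow> P 0"
    let ?S = "complex_of_real (sqrt (pi / a))"
    have c0: "c 0 = ?S * exp (b\<^sup>2 / of_real (4 * a))"
      using c_val[of 0] by simp
    have c_pos: "c (int (Suc n)) = ?S * exp ((b - 2 * of_real pi * \<i> * of_nat (Suc n))\<^sup>2 / of_real (4 * a))" for n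
      using c_val[of "int (Suc n)"] by (simp only: of_int_of_nat_eq)
    have c_neg: "c (- int (Suc n)) = ?S * exp ((b + 2 * of_real pi * \<i> * of_nat (Suc n))\<^sup>2 / of_real (4 * a))" for n
      using c_val[of "- int (Suc n)"] by (simp only: of_int_minus of_int_of_nat_eq mult_minus_right diff_minus_eq_add)
    show ?thesis
      using lim unfolding c0 c_pos c_neg distrib_left sum_distrib_left .
  qed
  moreover have "(\<lambda>N. 1 + (\<Sum>n<N. gauss a b (of_nat (Suc n)) + gauss a b (- of_nat (Suc n)))) \<longlonglongrightarrow> P 0"
    using PN[of 0] by (simp add: S_def f_def G_def) (simp add: gauss_def)
  ultimately show ?thesis by (rule that[rotated])
qed

section \<open>The theta function and its transformation\<close>

definition theta_tail :: "complex \<Rightarrow> real \<Rightarrow> complex" where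
  "theta_tail w y = (\<Sum>n. gauss_cos w (real (Suc n) * y))"

lemma inverse_squares_summable: "summable (\<lambda>n. inverse ((real (Suc n))\<^sup>2))"
  using inverse_power_summable[of 2, where 'a = real] by (subst summable_Suc_iff) auto

definition gauss_decay :: "real \<Rightarrow> real" where
  "gauss_decay y = exp (- y\<^sup>2) / y\<^sup>2"

text \<open>
  A bound that is summable over \<open>n\<close>, rapidly decreasing for \<open>y \<rightarrow> \<infinity>\<close> and of polynomial growth
  for \<open>y \<rightarrow> 0\<close>: half of the exponent is estimated by \<open>exp (- x) \<le> 1 / x\<close>.
\<close>
lemma gauss_cos_multiple_bound:
  obtains C where "C > 0"
    "\<And>n y. y > 0 \<Longrightarrow> norm (gauss_cos w (real (Suc n) * y)) \<le> C * gauss_decay y * inverse ((real (Suc n))\<^sup>2)"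
proof -
  obtain C where C: "C > 0" "\<And>u. norm (gauss_cos w u) \<le> C * exp (- 2 * u\<^sup>2)"
    using gauss_cos_bound by blast
  have "norm (gauss_cos w (real (Suc n) * y)) \<le> C * gauss_decay y * inverse ((real (Suc n))\<^sup>2)" if y: "y > 0" for n y
  proof -
    let ?x = "(real (Suc n) * y)\<^sup>2"
    have x: "?x > 0" using y by simp
    have "1 * y\<^sup>2 \<le> (real (Suc n))\<^sup>2 * y\<^sup>2"
      by (intro mult_right_mono one_le_power) auto
    then have "exp (- ?x) \<le> exp (- y\<^sup>2)" by (simp add: power_mult_distrib)
    moreover have "exp (- ?x) \<le> inverse ?x"
      using exp_ge_add_one_self[of ?x] x by (simp add: exp_minus del: exp_ge_add_one_self) 
    ultimately have "exp (- ?x) * exp (- ?x) \<le> exp (- y\<^sup>2) * inverse ?x"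
      using x by (intro mult_mono) auto
    also have "exp (- ?x) * exp (- ?x) = exp (- 2 * ?x)"
      by (simp add: exp_add[symmetric])
    finally have "C * exp (- 2 * ?x) \<le> C * (exp (- y\<^sup>2) * inverse ?x)"
      using C by (intro mult_left_mono) auto
    with C(2)[of "real (Suc n) * y"] have "norm (gauss_cos w (real (Suc n) * y)) \<le> C * (exp (- y\<^sup>2) * inverse ?x)"
      by linarith
    then show ?thesis by (simp add: gauss_decay_def power_mult_distrib divide_inverse mult_ac)
  qed
  with C(1) show ?thesis by (rule that)
qed

lemma theta_tail_summable:
  assumes "y > 0"
  shows "summable (\<lambda>n. norm (gauss_cos w (real (Suc n) * y)))"
proof -
  obtain C where C: "C > 0"
    "\<And>n y. y > 0 \<Longrightarrow> norm (gauss_cos w (real (Suc n) * y)) \<le> C * gauss_decay y * inverse ((real (Suc n))\<^sup>2)"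
    by (rule gauss_cos_multiple_bound[of w]) blast
  show ?thesis
    by (rule summable_comparison_test'[OF summable_mult[OF inverse_squares_summable], of 0 _ "C * gauss_decay y"])
      (use C(2)[OF assms] in auto)
qed

lemma theta_tail_bound:
  obtains C where "C > 0" "\<And>y. y > 0 \<Longrightarrow> norm (theta_tail w y) \<le> C * gauss_decay y"
proof -
  obtain C where C: "C > 0"
    "\<And>n y. y > 0 \<Longrightarrow> norm (gauss_cos w (real (Suc n) * y)) \<le> C * gauss_decay y * inverse ((real (Suc n))\<^sup>2)"
    by (rule gauss_cos_multiple_bound[of w]) blast
  define S where "S = (\<Sum>n. inverse ((real (Suc n))\<^sup>2))"
  have S: "S > 0"
    unfolding S_def by (rule suminf_pos[OF inverse_squares_summable]) simp
  have "norm (theta_tail w y) \<le> C * S * gauss_decay y" if y: "y > 0" for y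
  proof -
    have "norm (theta_tail w y) \<le> (\<Sum>n. norm (gauss_cos w (real (Suc n) * y)))"
      unfolding theta_tail_def by (rule summable_norm[OF theta_tail_summable[OF y]])
    also have "\<dots> \<le> (\<Sum>n. C * gauss_decay y * inverse ((real (Suc n))\<^sup>2))"
      by (intro suminf_le C(2) y theta_tail_summable summable_mult inverse_squares_summable)
    also have "\<dots> = C * gauss_decay y * S"
      unfolding S_def by (rule suminf_mult[OF inverse_squares_summable])
    finally show ?thesis by (simp add: mult_ac)
  qed
  then show ?thesis using C(1) S by (intro that[of "C * S"]) auto
qed

lemma theta_tail_measurable [measurable]: "theta_tail w \<in> borel_measurable borel"
  unfolding theta_tail_def[abs_def] by measurable

lemma gauss_cos_minus: "gauss_cos (- w) u = gauss_cos w u"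
  by (simp add: gauss_cos_def)

lemma theta_tail_twist_twice: "theta_tail (\<i> * (\<i> * w)) y = theta_tail w y"
  by (simp add: theta_tail_def mult.assoc[symmetric] gauss_cos_minus)

text \<open>
  Poisson summation for \<open>exp (- \<pi> y\<^sup>2 x\<^sup>2 + \<i> \<surd>\<pi> w y x)\<close>.  The linear term shifts the dual lattice
  in the imaginary direction, so that \<open>cos (\<surd>\<pi> w x)\<close> becomes \<open>cosh (\<surd>\<pi> w x) = cos (\<surd>\<pi> \<i> w x)\<close>.
\<close>
theorem theta_transformation:
  assumes y: "y > 0"
  shows "1 + 2 * theta_tail w y = exp (- w\<^sup>2 / 4) / of_real y * (1 + 2 * theta_tail (\<i> * w) (1 / y))"
proof -
  define a where "a = pi * y\<^sup>2"
  define k where "k = complex_of_real (sqrt pi) * w"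
  define b where "b = \<i> * k * of_real y"
  have a: "a > 0" using y by (simp add: a_def)
  have k2: "k\<^sup>2 = of_real pi * w\<^sup>2"
    by (simp add: k_def power_mult_distrib flip: of_real_power)
  have y0: "complex_of_real y \<noteq> 0" using y by simp
  obtain L where L:
    "(\<lambda>N. 1 + (\<Sum>n<N. gauss a b (of_nat (Suc n)) + gauss a b (- of_nat (Suc n)))) \<longlonglongrightarrow> L"
    "(\<lambda>N. of_real (sqrt (pi / a)) * (exp (b\<^sup>2 / of_real (4 * a)) +
       (\<Sum>n<N. exp ((b - 2 * of_real pi * \<i> * of_nat (Suc n))\<^sup>2 / of_real (4 * a))
             + exp ((b + 2 * of_real pi * \<i> * of_nat (Suc n))\<^sup>2 / of_real (4 * a))))) \<longlonglongrightarrow> L"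
    by (rule poisson_summation_gauss[OF a]) blast
  have lhs: "gauss a b (of_nat m) + gauss a b (- of_nat m) = 2 * gauss_cos w (real m * y)" for m
  proof -
    have g: "gauss a b (of_nat m) = exp (- of_real (pi * (real m * y)\<^sup>2)) * exp (\<i> * (k * of_real (real m * y)))"
      "gauss a b (- of_nat m) = exp (- of_real (pi * (real m * y)\<^sup>2)) * exp (- (\<i> * (k * of_real (real m * y))))"
      by (simp_all add: gauss_def a_def b_def exp_add[symmetric] power_mult_distrib algebra_simps)
    have gc: "gauss_cos w (real m * y) = exp (- of_real (pi * (real m * y)\<^sup>2)) *
        ((exp (\<i> * (k * of_real (real m * y))) + exp (- (\<i> * (k * of_real (real m * y))))) / 2)"
      unfolding gauss_cos_def k_def[symmetric] cos_exp_eq by simp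
    show ?thesis
      unfolding g gc by (simp only: distrib_left[symmetric]) simp
  qed
  have b2: "b\<^sup>2 / of_real (4 * a) = - w\<^sup>2 / 4"
    using y0 by (simp add: b_def power_mult_distrib k2 a_def)
  have cross: "2 * of_real pi * \<i> * of_nat m * b / of_real (2 * a) = - (k * of_real (real m / y))" for m
    using y0 by (simp add: b_def a_def power2_eq_square field_simps)
  have sq: "(2 * of_real pi * \<i> * of_nat m)\<^sup>2 / of_real (4 * a) = - of_real (pi * (real m / y)\<^sup>2)" for m
    using y0 by (simp add: a_def power2_eq_square field_simps)
  have rhs: "exp ((b - 2 * of_real pi * \<i> * of_nat m)\<^sup>2 / of_real (4 * a)) + exp ((b + 2 * of_real pi * \<i> * of_nat m)\<^sup>2 / of_real (4 * a)) =
      2 * exp (- w\<^sup>2 / 4) * gauss_cos (\<i> * w) (real m * (1 / y))" for m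
  proof -
    let ?d = "2 * of_real pi * \<i> * of_nat m"
    have a4: "2 * x / of_real (4 * a) = x / of_real (2 * a)" for x :: complex by simp
    have "(b - ?d)\<^sup>2 / of_real (4 * a) = b\<^sup>2 / of_real (4 * a) + ?d\<^sup>2 / of_real (4 * a) - 2 * (?d * b) / of_real (4 * a)"
      by (simp only: power2_diff add_divide_distrib diff_divide_distrib mult_ac)
    also have "\<dots> = - w\<^sup>2 / 4 + (- of_real (pi * (real m / y)\<^sup>2) + k * of_real (real m / y))"
      unfolding a4 b2 sq cross by simp
    finally have 1: "(b - ?d)\<^sup>2 / of_real (4 * a) = - w\<^sup>2 / 4 + (- of_real (pi * (real m / y)\<^sup>2) + k * of_real (real m / y))" .
    have "(b + ?d)\<^sup>2 / of_real (4 * a) = b\<^sup>2 / of_real (4 * a) + ?d\<^sup>2 / of_real (4 * a) + 2 * (?d * b) / of_real (4 * a)"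
      by (simp only: power2_sum add_divide_distrib mult_ac)
    also have "\<dots> = - w\<^sup>2 / 4 + (- of_real (pi * (real m / y)\<^sup>2) + - (k * of_real (real m / y)))"
      unfolding a4 b2 sq cross by simp
    finally have 2: "(b + ?d)\<^sup>2 / of_real (4 * a) = - w\<^sup>2 / 4 + (- of_real (pi * (real m / y)\<^sup>2) + - (k * of_real (real m / y)))" .
    have 3: "of_real (sqrt pi) * (\<i> * w) * of_real (real m / y) = \<i> * (k * of_real (real m / y))"
      by (simp add: k_def)
    have 4: "\<i> * (\<i> * x) = - x" for x by (simp add: mult.assoc[symmetric])
    show ?thesis
      unfolding 1 2 gauss_cos_def cos_exp_eq
      by (simp only: times_divide_eq_right mult_1_right 3 4 minus_minus exp_add mult_minus_right) (simp add: algebra_simps)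
  qed
  have sqrt: "sqrt (pi / a) = 1 / y"
    using y by (simp add: a_def real_sqrt_divide real_sqrt_mult)
  have sm: "summable (\<lambda>n. gauss_cos v (real (Suc n) * x))" if "x > 0" for v x
    using theta_tail_summable[OF that] by (rule summable_norm_cancel)
  have "(\<lambda>N. 1 + 2 * (\<Sum>n<N. gauss_cos w (real (Suc n) * y))) \<longlonglongrightarrow> 1 + 2 * theta_tail w y"
    unfolding theta_tail_def by (intro tendsto_intros summable_LIMSEQ sm y)
  moreover have "(\<lambda>N. 1 + 2 * (\<Sum>n<N. gauss_cos w (real (Suc n) * y))) \<longlonglongrightarrow> L"
    using L(1) unfolding lhs sum_distrib_left[symmetric] .
  moreover have "(\<lambda>N. of_real (1 / y) * (exp (- w\<^sup>2 / 4) + 2 * exp (- w\<^sup>2 / 4) * (\<Sum>n<N. gauss_cos (\<i> * w) (real (Suc n) * (1 / y)))))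
      \<longlonglongrightarrow> of_real (1 / y) * (exp (- w\<^sup>2 / 4) + 2 * exp (- w\<^sup>2 / 4) * theta_tail (\<i> * w) (1 / y))"
    unfolding theta_tail_def using y by (intro tendsto_intros summable_LIMSEQ sm) simp
  moreover have "(\<lambda>N. of_real (1 / y) * (exp (- w\<^sup>2 / 4) + 2 * exp (- w\<^sup>2 / 4) * (\<Sum>n<N. gauss_cos (\<i> * w) (real (Suc n) * (1 / y))))) \<longlonglongrightarrow> L"
    using L(2) unfolding rhs sum_distrib_left[symmetric] b2 sqrt .
  ultimately have "1 + 2 * theta_tail w y = of_real (1 / y) * (exp (- w\<^sup>2 / 4) + 2 * exp (- w\<^sup>2 / 4) * theta_tail (\<i> * w) (1 / y))"
    using LIMSEQ_unique by metis
  also have "\<dots> = exp (- w\<^sup>2 / 4) / of_real y * (1 + 2 * theta_tail (\<i> * w) (1 / y))"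
    by (simp add: field_simps)
  finally show ?thesis .
qed

section \<open>The completed zeta function with a parameter\<close>

definition theta_mellin_upper :: "complex \<Rightarrow> complex \<Rightarrow> complex" where
  "theta_mellin_upper w s = (LBINT r. indicator {0<..} r * theta_tail w (exp r) * exp (s * of_real r))"

lemma theta_upper_integrable:
  "integrable lborel (\<lambda>r. indicator {0<..} r * theta_tail w (exp r) * of_real (exp (\<sigma> * r)))"
proof -
  obtain C where C: "C > 0" "\<And>y. y > 0 \<Longrightarrow> norm (theta_tail w y) \<le> C * gauss_decay y"
    by (rule theta_tail_bound[of w]) blast
  define \<rho> where "\<rho> = max \<sigma> 1"
  show ?thesis
  proof (rule integrable_majorant)
    show "integrable lborel (\<lambda>r. C * (exp (- 1 * exp (2 * r)) * exp (\<rho> * r)))"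
      by (intro integrable_mult_right integrable_one_sided_majorant) (auto simp: \<rho>_def)
    fix r :: real
    show "norm (indicator {0<..} r * theta_tail w (exp r) * of_real (exp (\<sigma> * r))) \<le> C * (exp (- 1 * exp (2 * r)) * exp (\<rho> * r))"
    proof (cases "r > 0")
      case True
      have "norm (theta_tail w (exp r)) * exp (\<sigma> * r) \<le> (C * exp (- exp (2 * r))) * exp (\<rho> * r)"
      proof (intro mult_mono)
        have "norm (theta_tail w (exp r)) \<le> C * (exp (- (exp r)\<^sup>2) / (exp r)\<^sup>2)"
          using C(2)[of "exp r"] by (simp add: gauss_decay_def)
        also have "\<dots> \<le> C * (exp (- (exp r)\<^sup>2) / 1)"
          using True C(1) by (intro mult_left_mono divide_left_mono) auto
        finally show "norm (theta_tail w (exp r)) \<le> C * exp (- exp (2 * r))"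
          by (simp add: exp_double)
        show "exp (\<sigma> * r) \<le> exp (\<rho> * r)"
          using True by (simp add: \<rho>_def mult_right_mono)
      qed (use C in auto)
      then show ?thesis using True by (simp add: norm_mult mult.assoc)
    qed (use C in simp)
  qed simp
qed

lemma theta_mellin_upper_entire: "theta_mellin_upper w holomorphic_on A"
  unfolding theta_mellin_upper_def[abs_def]
  by (rule holomorphic_on_subset[OF bilateral_laplace_entire[OF theta_upper_integrable]]) simp

lemma theta_mellin_upper_integrable:
  "integrable lborel (\<lambda>r. indicator {0<..} r * theta_tail w (exp r) * exp (s * of_real r))"
  by (rule bilateral_laplace_integrable[OF theta_upper_integrable])

lemma integral_exp_lower:
  assumes s: "Re s > 0"
  shows "integrable lborel (\<lambda>r. indicator {..<0} r * exp (s * of_real r))"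
    and "(LBINT r. indicator {..<0} r * exp (s * of_real r)) = 1 / s"
proof -
  show int: "integrable lborel (\<lambda>r. indicator {..<0} r * exp (s * of_real r))"
  proof (rule integrable_majorant)
    show "integrable lborel (\<lambda>r. exp 1 * (exp (- 1 * exp (2 * r)) * exp (Re s * r)))"
      using s by (intro integrable_mult_right integrable_one_sided_majorant) auto
    fix r :: real
    show "norm (indicator {..<0} r * exp (s * of_real r)) \<le> exp 1 * (exp (- 1 * exp (2 * r)) * exp (Re s * r))"
    proof (cases "r < 0")
      case True
      then have "exp (2 * r) \<le> 1" by simp
      then have "1 * exp (Re s * r) \<le> exp (1 - exp (2 * r)) * exp (Re s * r)"
        by (intro mult_right_mono) auto
      then show ?thesis using True by (simp add: norm_mult exp_diff exp_minus divide_inverse mult_ac)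
    qed simp
  qed simp
  have s0: "s \<noteq> 0" using s by auto
  have ind: "indicator (einterval (- \<infinity>) 0) r *\<^sub>R x = indicator {..<0} r * x" for r :: real and x :: complex
    by (auto simp: indicator_def einterval_def zero_ereal_def)
  have "(LBINT r=-\<infinity>..0. exp (s * of_real r)) = 1 / s - 0"
  proof (rule interval_integral_FTC_integrable)
    fix r :: real
    have "((\<lambda>z. exp (s * z) / s) has_field_derivative exp (s * of_real r)) (at (of_real r))"
      using s0 by (auto intro!: derivative_eq_intros)
    from has_vector_derivative_real_field[OF this]
    show "((\<lambda>r. exp (s * of_real r) / s) has_vector_derivative exp (s * of_real r)) (at r)" .
    show "isCont (\<lambda>r::real. exp (s * of_real r)) r"
      by (intro continuous_intros)
  next
    show "set_integrable lborel (einterval (- \<infinity>) 0) (\<lambda>r. exp (s * complex_of_real r))"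
      unfolding set_integrable_def ind by (rule int)
    have "((\<lambda>r. exp (Re s * r) / norm s) \<longlongrightarrow> 0 / norm s) at_bot"
      using s0 by (intro tendsto_intros) (use s in \<open>auto, real_asymp\<close>)
    then have "((\<lambda>r. exp (Re s * r) / norm s) \<longlongrightarrow> 0) at_bot" by simp
    then have "((\<lambda>r::real. exp (s * of_real r) / s) \<longlongrightarrow> 0) at_bot"
      by (rule Lim_null_comparison[rotated]) (simp add: norm_divide)
    then show "(((\<lambda>r. exp (s * of_real r) / s) \<circ> real_of_ereal) \<longlongrightarrow> 0) (at_right (- \<infinity>))"
      by (simp add: ereal_tendsto_simps)
    have "((\<lambda>r::real. exp (s * of_real r) / s) \<longlongrightarrow> exp (s * of_real 0) / s) (at_left 0)"
      by (intro tendsto_intros s0)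
    then show "(((\<lambda>r. exp (s * of_real r) / s) \<circ> real_of_ereal) \<longlongrightarrow> 1 / s) (at_left 0)"
      unfolding zero_ereal_def by (simp add: ereal_tendsto_simps)
  qed simp
  then show "(LBINT r. indicator {..<0} r * exp (s * of_real r)) = 1 / s"
    by (simp add: interval_lebesgue_integral_def set_lebesgue_integral_def ind)
qed

definition dirichlet_zeta :: "complex \<Rightarrow> complex" where
  "dirichlet_zeta s = (\<Sum>n. 1 / of_nat (Suc n) powr s)"

text \<open>
  Translating \<open>r\<close> by the logarithm of \<open>n\<close> in the \<open>n\<close>-th term splits off the \<open>n\<close>-th term of the
  Dirichlet series.
\<close>
lemma theta_mellin_full:
  assumes s: "Re s > 1"
  shows "integrable lborel (\<lambda>r. theta_tail w (exp r) * exp (s * of_real r))"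
    and "(LBINT r. theta_tail w (exp r) * exp (s * of_real r)) = mellin (gauss_cos w) s * dirichlet_zeta s"
proof -
  define F where "F = (\<lambda>r. gauss_cos w (exp r) * exp (s * of_real r))"
  define f where "f = (\<lambda>n r. gauss_cos w (real (Suc n) * exp r) * exp (s * of_real r))"
  have F: "integrable lborel F"
    unfolding F_def by (rule gauss_cos_mellin_integrable) (use s in auto)
  have f_shift: "f n r = of_nat (Suc n) powr (- s) * F (ln (real (Suc n)) + 1 * r)" for n r
  proof -
    have "of_nat (Suc n) powr (- s) = exp (- s * of_real (ln (real (Suc n))))"
      unfolding powr_def using Ln_of_real[of "real (Suc n)"] by (simp del: of_nat_Suc)
    then show ?thesis
      by (simp add: f_def F_def exp_add distrib_left exp_minus field_simps)
  qed
  have int_f: "integrable lborel (f n)" for n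
    unfolding f_shift[abs_def] using lborel_integrable_real_affine[OF F, of 1] by simp
  have norm_f: "(LBINT r. norm (f n r)) = real (Suc n) powr (- Re s) * (LBINT r. norm (F r))" for n
  proof -
    have "norm (f n r) = real (Suc n) powr (- Re s) * norm (F (ln (real (Suc n)) + 1 * r))" for r
      unfolding f_shift norm_mult by (subst norm_powr_real_powr) auto
    then show ?thesis
      using lborel_integral_real_affine[of 1 "\<lambda>r. norm (F r)" "ln (real (Suc n))"] by simp
  qed
  have sum_powr: "summable (\<lambda>n. real (Suc n) powr (- Re s))"
    using s by (subst summable_Suc_iff, subst summable_real_powr_iff) simp
  have 1: "AE r in lborel. summable (\<lambda>n. norm (f n r))"
    by (intro AE_I2) (simp add: f_def norm_mult summable_mult2 theta_tail_summable del: of_nat_Suc)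
  have 2: "summable (\<lambda>n. LBINT r. norm (f n r))"
    unfolding norm_f by (rule summable_mult2[OF sum_powr])
  have tail: "(\<Sum>n. f n r) = theta_tail w (exp r) * exp (s * of_real r)" for r
    unfolding f_def theta_tail_def
    by (rule suminf_mult2[symmetric]) (rule summable_norm_cancel[OF theta_tail_summable], simp)
  show "integrable lborel (\<lambda>r. theta_tail w (exp r) * exp (s * of_real r))"
    using integrable_suminf[OF int_f 1 2] by (simp only: tail)
  have "(LBINT r. theta_tail w (exp r) * exp (s * of_real r)) = (\<Sum>n. LBINT r. f n r)"
    using integral_suminf[OF int_f 1 2] by (simp only: tail)
  also have "\<dots> = (\<Sum>n. 1 / of_nat (Suc n) powr s * mellin (gauss_cos w) s)"
  proof (rule arg_cong[where f = suminf], rule ext)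
    fix n
    show "(LBINT r. f n r) = 1 / of_nat (Suc n) powr s * mellin (gauss_cos w) s"
      unfolding f_shift integral_mult_right_zero mellin_def F_def[symmetric]
      using lborel_integral_real_affine[of 1 F "ln (real (Suc n))"]
      by (simp add: powr_minus divide_inverse del: of_nat_Suc)
  qed
  also have "\<dots> = dirichlet_zeta s * mellin (gauss_cos w) s"
    unfolding dirichlet_zeta_def
  proof (rule suminf_mult2[symmetric], rule summable_norm_cancel)
    show "summable (\<lambda>n. norm (1 / of_nat (Suc n) powr s))"
    proof -
      have "norm (1 / of_nat (Suc n) powr s) = real (Suc n) powr (- Re s)" for n
        unfolding norm_divide by (subst norm_powr_real_powr) (auto simp: powr_minus divide_inverse)
      with sum_powr show ?thesis by simp
    qed
  qed
  finally show "(LBINT r. theta_tail w (exp r) * exp (s * of_real r)) = mellin (gauss_cos w) s * dirichlet_zeta s"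
    by (simp only: mult.commute)
qed

text \<open>
  For \<open>w = 0\<close> this is \<open>s (s - 1) / 2\<close> times the product of \<open>\<Gamma>(s/2) \<zeta>(s)\<close> with the power
  \<open>- s / 2\<close> of \<open>\<pi>\<close>, that is, Riemann's \<open>\<xi>\<close>.  The two integrals
  over the half line come from Riemann's splitting of the Mellin integral at 1, and the factor
  \<open>s (s - 1)\<close> removes its two poles.
\<close>
definition xi :: "complex \<Rightarrow> complex \<Rightarrow> complex" where
  "xi w s = s * (s - 1) * (theta_mellin_upper w s + exp (- w\<^sup>2 / 4) * theta_mellin_upper (\<i> * w) (1 - s))
     - (s - 1) / 2 + exp (- w\<^sup>2 / 4) * s / 2"

lemma xi_entire: "xi w holomorphic_on A"
proof -
  have "(theta_mellin_upper (\<i> * w) \<circ> (\<lambda>s. 1 - s)) holomorphic_on A"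
    by (rule holomorphic_on_compose_gen[OF _ theta_mellin_upper_entire[of _ UNIV]]) (auto intro!: holomorphic_intros)
  then show ?thesis
    unfolding xi_def[abs_def] by (intro holomorphic_intros theta_mellin_upper_entire) (auto simp: o_def)
qed

lemma xi_functional_equation: "xi w s = exp (- w\<^sup>2 / 4) * xi (\<i> * w) (1 - s)"
proof -
  have tw: "theta_mellin_upper (\<i> * (\<i> * w)) t = theta_mellin_upper w t" for t
    unfolding theta_mellin_upper_def theta_tail_twist_twice ..
  define e where "e = exp (w\<^sup>2 / 4)"
  have e: "exp (- w\<^sup>2 / 4) = inverse e" "exp (- (\<i> * w)\<^sup>2 / 4) = e" "e \<noteq> 0"
    by (auto simp: e_def exp_minus[symmetric] power_mult_distrib)
  show ?thesis
    unfolding xi_def tw e(1,2) using e(3) by (simp add: field_simps)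
qed

lemma xi_twist_twice: "xi (\<i> * (\<i> * w)) s = xi w s"
proof -
  have tw: "theta_mellin_upper (\<i> * (\<i> * v)) t = theta_mellin_upper v t" for v t
    unfolding theta_mellin_upper_def theta_tail_twist_twice ..
  have "(\<i> * (\<i> * w))\<^sup>2 = w\<^sup>2" by (simp add: power_mult_distrib)
  then show ?thesis unfolding xi_def tw by (simp only:)
qed

text \<open>
  On the lower half line \<open>r < 0\<close> the transformation of the theta function expresses \<open>\<psi>\<^sub>w(exp r)\<close> by
  \<open>\<psi>\<^bsub>\<i>w\<^esub>(exp (- r))\<close> and two exponentials, which integrate to \<open>1 / s\<close> and \<open>1 / (s - 1)\<close>.
\<close>
lemma xi_eq_mellin:
  assumes s: "Re s > 1"
  shows "xi w s = s * (s - 1) * (LBINT r. theta_tail w (exp r) * exp (s * of_real r))"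
proof -
  define e where "e = exp (- w\<^sup>2 / 4)"
  \<comment> \<open>Each part lives on a half line; \<open>B\<close> enters the decomposition reflected at 0.\<close>
  define A where "A = (\<lambda>r::real. indicator {0<..} r * theta_tail w (exp r) * exp (s * of_real r))"
  define B where "B = (\<lambda>r::real. indicator {0<..} r * theta_tail (\<i> * w) (exp r) * exp ((1 - s) * of_real r))"
  define C where "C = (\<lambda>r::real. indicator {..<0} r * exp (s * of_real r) :: complex)"
  define D where "D = (\<lambda>r::real. indicator {..<0} r * exp ((s - 1) * of_real r) :: complex)"
  have intA: "integrable lborel A" and intB: "integrable lborel B"
    unfolding A_def B_def by (rule theta_mellin_upper_integrable)+
  have intB': "integrable lborel (\<lambda>r. B (- r))" and BB: "(LBINT r. B (- r)) = (LBINT r. B r)"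
    using lborel_integrable_real_affine[OF intB, of "- 1" 0] lborel_integral_real_affine[of "- 1" B 0] by auto
  have intC: "integrable lborel C" and C: "(LBINT r. C r) = 1 / s"
    unfolding C_def using integral_exp_lower[of s] s by auto
  have intD: "integrable lborel D" and D: "(LBINT r. D r) = 1 / (s - 1)"
    unfolding D_def using integral_exp_lower[of "s - 1"] s by auto
  have eq: "theta_tail w (exp r) * exp (s * of_real r) = A r + e * B (- r) - C r / 2 + e * D r / 2" if "r \<noteq> 0" for r
  proof (cases "r > 0")
    case True
    then show ?thesis by (simp add: A_def B_def C_def D_def)
  next
    case False
    with that have r: "r < 0" by simp
    have "1 + 2 * theta_tail w (exp r) = e * exp (- of_real r) * (1 + 2 * theta_tail (\<i> * w) (exp (- r)))"
    proof -
      have "1 / exp r = exp (- r)" by (simp add: exp_minus divide_inverse)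
      moreover have "exp (- w\<^sup>2 / 4) / of_real (exp r) = e * exp (- of_real r)"
        unfolding e_def exp_minus exp_of_real by (rule divide_inverse)
      ultimately show ?thesis
        using theta_transformation[of "exp r" w] by (simp only: exp_gt_zero simp_thms)
    qed
    then have th: "theta_tail w (exp r) = e * exp (- of_real r) * theta_tail (\<i> * w) (exp (- r)) - 1 / 2 + e * exp (- of_real r) / 2"
      by (simp add: field_simps)
    have "exp (- of_real r) * exp (s * of_real r) = exp ((s - 1) * of_real r)"
      by (simp add: exp_add[symmetric] algebra_simps)
    then show ?thesis
      using r unfolding th by (simp add: A_def B_def C_def D_def algebra_simps)
  qed
  have "(LBINT r. theta_tail w (exp r) * exp (s * of_real r)) = (LBINT r. A r + e * B (- r) - C r / 2 + e * D r / 2)"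
  proof (rule integral_cong_AE)
    show "AE r in lborel. theta_tail w (exp r) * exp (s * of_real r) = A r + e * B (- r) - C r / 2 + e * D r / 2"
      using AE_lborel_singleton[of 0] by eventually_elim (rule eq)
    show "(\<lambda>r. A r + e * B (- r) - C r / 2 + e * D r / 2) \<in> borel_measurable lborel"
      unfolding A_def B_def C_def D_def by measurable
  qed measurable
  also have "\<dots> = (LBINT r. A r) + e * (LBINT r. B r) - 1 / s / 2 + e * (1 / (s - 1)) / 2"
    using intA intB' intC intD by (simp add: BB C D)
  also have "(LBINT r. A r) = theta_mellin_upper w s"
    by (simp add: A_def theta_mellin_upper_def)
  also have "(LBINT r. B r) = theta_mellin_upper (\<i> * w) (1 - s)"
    by (simp add: B_def theta_mellin_upper_def)
  finally have int: "(LBINT r. theta_tail w (exp r) * exp (s * of_real r)) =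
      theta_mellin_upper w s + e * theta_mellin_upper (\<i> * w) (1 - s) - 1 / s / 2 + e * (1 / (s - 1)) / 2" .
  have nz: "s \<noteq> 0" "s - 1 \<noteq> 0" using s by auto
  show ?thesis
    unfolding int xi_def e_def[symmetric] using nz by (simp add: field_simps)
qed

lemma xi_right_half_plane:
  assumes s: "Re s > 1"
  shows "xi w s = (s - 1) * of_real pi powr (- s / 2) * Gamma (s / 2 + 1) * dirichlet_zeta s * hyp1F1 (s / 2) (1 / 2) (- w\<^sup>2 / 4)"
proof -
  have "s \<noteq> 0" "s / 2 \<notin> \<int>\<^sub>\<le>\<^sub>0" using s by (auto intro!: Re_pos_not_nonpos_Int)
  then have "Gamma (s / 2 + 1) = s / 2 * Gamma (s / 2)" by (intro Gamma_plus1)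
  moreover have "Re s > 0" using s by simp
  ultimately show ?thesis
    unfolding xi_eq_mellin[OF s] theta_mellin_full(2)[OF s] by (simp add: mellin_gauss_cos)
qed

text \<open>
  The parameter enters the Mellin transform only through the Kummer function, which is visible
  where the Dirichlet series converges; both sides are entire.
\<close>
lemma xi_factor: "xi w s = hyp1F1 (s / 2) (1 / 2) (- w\<^sup>2 / 4) * xi 0 s" (is "_ = ?g s")
proof (rule right_half_plane_identity[where f = "xi w" and g = ?g])
  have "((\<lambda>a. hyp1F1 a (1 / 2) (- w\<^sup>2 / 4)) \<circ> (\<lambda>s. s / 2)) holomorphic_on UNIV"
    by (rule holomorphic_on_compose_gen[OF _ hyp1F1_entire[of _ UNIV]]) (auto intro!: holomorphic_intros)
  then show "?g holomorphic_on UNIV"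
    by (intro holomorphic_intros xi_entire) (simp add: o_def)
  show "xi w s = ?g s" if "Re s > 1" for s
    unfolding xi_right_half_plane[OF that] by (simp add: hyp1F1_zero)
qed (rule xi_entire)

lemma xi_symmetric: "xi 0 (1 - s) = xi 0 s"
  using xi_functional_equation[of 0 s] by simp

text \<open>
  The right-hand side is holomorphic away from 1 because the reciprocal Gamma function is entire,
  and it agrees with the Dirichlet series for \<open>Re s > 1\<close>.  So the analytic continuation exists, and it is
  unique since the punctured plane is connected.
\<close>
theorem riemann_zeta_eq_xi:
  assumes "s \<noteq> 1"
  shows "riemann_zeta s = xi 0 s * of_real pi powr (s / 2) * rGamma (s / 2 + 1) / (s - 1)"
proof -
  define Z where "Z = (\<lambda>s. if s = 1 then 0 else xi 0 s * of_real pi powr (s / 2) * rGamma (s / 2 + 1) / (s - 1))"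
  have "(\<lambda>s. xi 0 s * of_real pi powr (s / 2) * rGamma (s / 2 + 1) / (s - 1)) holomorphic_on - {1}"
    by (intro holomorphic_intros xi_entire) auto
  then have holZ: "Z holomorphic_on - {1}"
    by (rule holomorphic_transform) (auto simp: Z_def)
  have Zsum: "Z s = (\<Sum>n. 1 / of_nat (Suc n) powr s)" if s: "Re s > 1" for s
  proof -
    have ne: "s \<noteq> 1" "s / 2 + 1 \<notin> \<int>\<^sub>\<le>\<^sub>0"
      using s by (auto intro!: Re_pos_not_nonpos_Int)
    have "of_real pi powr (- s / 2) * of_real pi powr (s / 2) = (1 :: complex)"
      by (simp add: powr_add[symmetric])
    moreover have "Gamma (s / 2 + 1) * rGamma (s / 2 + 1) = 1"
      using ne(2) by (simp add: rGamma_inverse_Gamma Gamma_eq_zero_iff)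
    moreover have "xi 0 s * of_real pi powr (s / 2) * rGamma (s / 2 + 1) = (s - 1) * dirichlet_zeta s *
        (of_real pi powr (- s / 2) * of_real pi powr (s / 2)) * (Gamma (s / 2 + 1) * rGamma (s / 2 + 1))"
      unfolding xi_right_half_plane[OF s] by (simp add: hyp1F1_zero mult_ac)
    ultimately have "(s - 1) * dirichlet_zeta s = xi 0 s * of_real pi powr (s / 2) * rGamma (s / 2 + 1)"
      by simp
    then have "dirichlet_zeta s = xi 0 s * of_real pi powr (s / 2) * rGamma (s / 2 + 1) / (s - 1)"
      using ne(1) by (simp only: nonzero_eq_divide_eq right_minus_eq mult.commute not_False_eq_True)
    then show ?thesis
      using ne(1) by (simp only: Z_def dirichlet_zeta_def if_False)
  qed
  have "riemann_zeta = Z"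
    unfolding riemann_zeta_def
  proof (rule the_equality)
    show "Z holomorphic_on - {1} \<and> (\<forall>s. Re s > 1 \<longrightarrow> Z s = (\<Sum>n. 1 / of_nat (Suc n) powr s)) \<and> Z 1 = 0"
      using holZ Zsum by (auto simp: Z_def)
  next
    fix f assume f: "f holomorphic_on - {1} \<and> (\<forall>s. Re s > 1 \<longrightarrow> f s = (\<Sum>n. 1 / of_nat (Suc n) powr s)) \<and> f 1 = 0"
    show "f = Z"
    proof
      fix s
      show "f s = Z s"
      proof (cases "s = 1")
        case True
        then show ?thesis using f by (simp add: Z_def)
      next
        case False
        show ?thesis
        proof (rule analytic_continuation_open[of "{s. Re s > 1}" "- {1}" f Z])
          show "{s. Re s > 1} \<noteq> {}" by (auto intro: exI[of _ 2])
          show "connected (- {1 :: complex})"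
            using connected_punctured_universe[of "1 :: complex"] by simp
        qed (use f holZ Zsum False in \<open>auto simp: open_halfspace_Re_gt\<close>)
      qed
    qed
  qed
  then have "riemann_zeta s = Z s" by (rule arg_cong)
  then show ?thesis using assms by (simp only: Z_def if_False)
qed

section \<open>The divisor series as a Mellin transform\<close>

text \<open>
  The product of two absolutely convergent series, arranged according to the product of the
  indices.
\<close>
lemma dirichlet_product_sums:
  fixes a b :: "nat \<Rightarrow> 'a :: {real_normed_field, banach, second_countable_topology}"
  assumes a: "summable (\<lambda>n. norm (a (Suc n)))" and b: "summable (\<lambda>n. norm (b (Suc n)))"
  shows "(\<lambda>n. \<Sum>d | d dvd Suc n. a d * b (Suc n div d)) sums ((\<Sum>n. a (Suc n)) * (\<Sum>n. b (Suc n)))"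
proof -
  define A B where "A = (\<Sum>n. a (Suc n))" and "B = (\<Sum>n. b (Suc n))"
  have sA: "((\<lambda>n. a (Suc n)) has_sum A) UNIV" and sB: "((\<lambda>n. b (Suc n)) has_sum B) UNIV"
    unfolding A_def B_def
    by (intro norm_summable_imp_has_sum a b summable_sums summable_norm_cancel[OF a] summable_norm_cancel[OF b])+
  have nA: "(\<lambda>n. norm (a (Suc n))) summable_on UNIV" and nB: "(\<lambda>n. norm (b (Suc n))) summable_on UNIV"
    using norm_summable_imp_summable_on[of "\<lambda>n. norm (a (Suc n))"] norm_summable_imp_summable_on[of "\<lambda>n. norm (b (Suc n))"] a b
    by simp_all
  define f where "f = (\<lambda>(i, j). a (Suc i) * b (Suc j))"
  have "(\<lambda>x. norm (f x)) summable_on UNIV \<times> UNIV"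
  proof (rule summable_on_SigmaI[where g = "\<lambda>i. norm (a (Suc i)) * (\<Sum>\<^sub>\<infinity>j. norm (b (Suc j)))"])
    show "((\<lambda>j. norm (f (i, j))) has_sum norm (a (Suc i)) * (\<Sum>\<^sub>\<infinity>j. norm (b (Suc j)))) UNIV" for i
      unfolding f_def prod.case norm_mult by (intro has_sum_cmult_right has_sum_infsum nB)
    show "(\<lambda>i. norm (a (Suc i)) * (\<Sum>\<^sub>\<infinity>j. norm (b (Suc j)))) summable_on UNIV"
      by (intro summable_on_cmult_left nA)
  qed simp
  then have "f summable_on UNIV \<times> UNIV"
    by (rule abs_summable_summable)
  then have "(f has_sum A * B) (UNIV \<times> UNIV)"
  proof (rule has_sum_SigmaI[rotated 2])
    show "((\<lambda>j. f (i, j)) has_sum a (Suc i) * B) UNIV" for i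
      unfolding f_def prod.case by (intro has_sum_cmult_right sB)
    show "((\<lambda>i. a (Suc i) * B) has_sum A * B) UNIV"
      by (intro has_sum_cmult_left sA)
  qed
  also have "?this \<longleftrightarrow> ((\<lambda>(n, d). a d * b (Suc n div d)) has_sum A * B) (SIGMA n:UNIV. {d. d dvd Suc n})"
  proof (rule has_sum_reindex_bij_witness[where j = "\<lambda>(i, j). (Suc i * Suc j - 1, Suc i)" and i = "\<lambda>(n, d). (d - 1, Suc n div d - 1)"])
    fix x :: "nat \<times> nat" assume "x \<in> (SIGMA n:UNIV. {d. d dvd Suc n})"
    then obtain n d e where x: "x = (n, d)" "Suc n = d * e" by (auto elim!: dvdE)
    then have "d > 0" "e > 0" by (auto intro!: Nat.gr0I)
    then show "(case case x of (n, d) \<Rightarrow> (d - 1, Suc n div d - 1) of (i, j) \<Rightarrow> (Suc i * Suc j - 1, Suc i)) = x"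
    proof -
      assume pos: "d > 0" "e > 0"
      then have "Suc n div d = e" using x(2) by simp
      then show ?thesis using pos x(1) by (simp add: x(2)[symmetric] del: mult_Suc mult_Suc_right)
    qed
  qed (auto simp: f_def simp del: mult_Suc mult_Suc_right)
  finally have "((\<lambda>(n, d). a d * b (Suc n div d)) has_sum A * B) (SIGMA n:UNIV. {d. d dvd Suc n})" .
  then have "((\<lambda>n. \<Sum>d | d dvd Suc n. a d * b (Suc n div d)) has_sum A * B) UNIV"
    by (rule has_sum_SigmaD) (auto intro!: has_sum_finiteI)
  then show ?thesis
    unfolding A_def B_def by (rule has_sum_imp_sums)
qed

text \<open>
  The argument \<open>c\<close> stands for \<open>\<surd>\<beta>\<close>.
\<close>
definition theta_product_mellin :: "complex \<Rightarrow> real \<Rightarrow> complex \<Rightarrow> complex" where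
  "theta_product_mellin w c z =
     (LBINT r. theta_tail w (c * exp r) * theta_tail w (c * exp (- r)) * exp (z * of_real r))"

lemma gauss_product_majorant_integrable:
  fixes c \<sigma> :: real
  assumes "c > 0"
  shows "integrable lborel (\<lambda>r. gauss_decay (c * exp r) * gauss_decay (c * exp (- r)) * exp (\<sigma> * r))"
proof -
  have "gauss_decay (c * exp r) * gauss_decay (c * exp (- r)) * exp (\<sigma> * r) =
      (1 / c ^ 4) * (exp (- c\<^sup>2 * exp (2 * r)) * exp (- c\<^sup>2 * exp (- 2 * r)) * exp (\<sigma> * r))" for r
  proof -
    have 1: "(c * exp r)\<^sup>2 = c\<^sup>2 * exp (2 * r)" "(c * exp (- r))\<^sup>2 = c\<^sup>2 * exp (- 2 * r)"
      by (simp_all add: power_mult_distrib exp_double[symmetric])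
    have 2: "(c\<^sup>2 * exp (2 * r)) * (c\<^sup>2 * exp (- 2 * r)) = c ^ 4"
      by (simp add: exp_minus power2_eq_square power4_eq_xxxx)
    show ?thesis
      unfolding gauss_decay_def 1 times_divide_times_eq 2 by simp
  qed
  moreover have "integrable lborel (\<lambda>r. (1 / c ^ 4) * (exp (- c\<^sup>2 * exp (2 * r)) * exp (- c\<^sup>2 * exp (- 2 * r)) * exp (\<sigma> * r)))"
    using integrable_two_sided_majorant[of "c\<^sup>2" \<sigma>] assms by (intro integrable_mult_right) auto
  ultimately show ?thesis by simp
qed

lemma theta_product_laplace_integrable:
  assumes c: "c > 0"
  shows "integrable lborel (\<lambda>r. (theta_tail w (c * exp r) * theta_tail w (c * exp (- r))) * of_real (exp (\<sigma> * r)))"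
proof -
  obtain C where C: "C > 0" "\<And>y. y > 0 \<Longrightarrow> norm (theta_tail w y) \<le> C * gauss_decay y"
    by (rule theta_tail_bound[of w]) blast
  let ?m = "\<lambda>r. gauss_decay (c * exp r) * gauss_decay (c * exp (- r)) * exp (\<sigma> * r)"
  show ?thesis
  proof (rule integrable_majorant)
    show "integrable lborel (\<lambda>r. C\<^sup>2 * ?m r)"
      by (intro integrable_mult_right gauss_product_majorant_integrable c)
    fix r :: real
    have "norm (theta_tail w (c * exp r)) * norm (theta_tail w (c * exp (- r))) * exp (\<sigma> * r) \<le>
        (C * gauss_decay (c * exp r)) * (C * gauss_decay (c * exp (- r))) * exp (\<sigma> * r)"
      using C c by (intro mult_right_mono mult_mono) (auto simp: gauss_decay_def)
    also have "\<dots> = C\<^sup>2 * ?m r"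
      by (simp add: power2_eq_square[of C])
    finally show "norm (theta_tail w (c * exp r) * theta_tail w (c * exp (- r)) * of_real (exp (\<sigma> * r))) \<le> C\<^sup>2 * ?m r"
      by (simp only: norm_mult norm_of_real abs_exp_cancel)
  qed simp
qed

lemma theta_product_mellin_entire:
  assumes "c > 0"
  shows "theta_product_mellin w c holomorphic_on A"
  unfolding theta_product_mellin_def[abs_def]
  by (rule holomorphic_on_subset[OF bilateral_laplace_entire[OF theta_product_laplace_integrable[OF assms]]]) simp

text \<open>
  The integrand that belongs to the divisor \<open>d\<close> of \<open>n = d m\<close>, up to the factor \<open>exp (z r)\<close>.
\<close>
definition gauss_cos_product :: "complex \<Rightarrow> real \<Rightarrow> nat \<Rightarrow> nat \<Rightarrow> real \<Rightarrow> complex" where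
  "gauss_cos_product w c d m r = gauss_cos w (real d * (c * exp r)) * gauss_cos w (real m * (c * exp (- r)))"

lemma gauss_cos_product_measurable [measurable]: "gauss_cos_product w c d m \<in> borel_measurable borel"
  unfolding gauss_cos_product_def[abs_def] by measurable

lemma gauss_cos_product_bound:
  assumes c: "c > 0"
  obtains C where "C > 0" "\<And>d m r. d > 0 \<Longrightarrow> m > 0 \<Longrightarrow> norm (gauss_cos_product w c d m r) \<le>
    C * (gauss_decay (c * exp r) * gauss_decay (c * exp (- r))) * (inverse ((real d)\<^sup>2) * inverse ((real m)\<^sup>2))"
proof -
  obtain C where C: "C > 0"
    "\<And>n y. y > 0 \<Longrightarrow> norm (gauss_cos w (real (Suc n) * y)) \<le> C * gauss_decay y * inverse ((real (Suc n))\<^sup>2)"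
    by (rule gauss_cos_multiple_bound[of w]) blast
  have C': "norm (gauss_cos w (real d * y)) \<le> C * gauss_decay y * inverse ((real d)\<^sup>2)" if "d > 0" "y > 0" for d y
    using C(2)[OF that(2), of "d - 1"] that(1) by simp
  have "norm (gauss_cos_product w c d m r) \<le>
      C\<^sup>2 * (gauss_decay (c * exp r) * gauss_decay (c * exp (- r))) * (inverse ((real d)\<^sup>2) * inverse ((real m)\<^sup>2))"
    if "d > 0" "m > 0" for d m r
  proof -
    have "norm (gauss_cos_product w c d m r) \<le>
        (C * gauss_decay (c * exp r) * inverse ((real d)\<^sup>2)) * (C * gauss_decay (c * exp (- r)) * inverse ((real m)\<^sup>2))"
      unfolding gauss_cos_product_def norm_mult using c C(1) that
      by (intro mult_mono C') (auto simp: gauss_decay_def)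
    also have "\<dots> = C\<^sup>2 * (gauss_decay (c * exp r) * gauss_decay (c * exp (- r))) * (inverse ((real d)\<^sup>2) * inverse ((real m)\<^sup>2))"
      by (simp only: power2_eq_square[of C] mult_ac)
    finally show ?thesis .
  qed
  then show ?thesis using C(1) by (intro that[of "C\<^sup>2"]) auto
qed

lemma gauss_cos_product_integrable:
  assumes c: "c > 0" and "d > 0" "m > 0"
  shows "integrable lborel (\<lambda>r. gauss_cos_product w c d m r * exp (z * of_real r))"
proof -
  obtain C where C: "C > 0" "\<And>d m r. d > 0 \<Longrightarrow> m > 0 \<Longrightarrow> norm (gauss_cos_product w c d m r) \<le>
      C * (gauss_decay (c * exp r) * gauss_decay (c * exp (- r))) * (inverse ((real d)\<^sup>2) * inverse ((real m)\<^sup>2))"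
    by (rule gauss_cos_product_bound[OF c, of w]) blast
  define K where "K = C * (inverse ((real d)\<^sup>2) * inverse ((real m)\<^sup>2))"
  show ?thesis
  proof (rule integrable_majorant)
    let ?h = "\<lambda>r. K * (gauss_decay (c * exp r) * gauss_decay (c * exp (- r)) * exp (Re z * r))"
    show "integrable lborel ?h"
      by (intro integrable_mult_right gauss_product_majorant_integrable c)
    fix r :: real
    have "norm (gauss_cos_product w c d m r * exp (z * of_real r)) \<le>
        C * (gauss_decay (c * exp r) * gauss_decay (c * exp (- r))) * (inverse ((real d)\<^sup>2) * inverse ((real m)\<^sup>2)) * exp (Re z * r)"
      using mult_right_mono[OF C(2)[OF assms(2,3)]] by (simp add: norm_mult)
    also have "\<dots> = ?h r" by (simp only: K_def mult_ac)
    finally show "norm (gauss_cos_product w c d m r * exp (z * of_real r)) \<le> ?h r" .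
  qed simp
qed

text \<open>
  In the convolution formula for the Bessel function at \<open>2 n \<pi> c\<^sup>2\<close> the translation of \<open>r\<close> by
  \<open>ln (d c)\<close> distributes \<open>n = d m\<close> symmetrically over the two factors.  It produces exactly the
  power of \<open>d\<close> that cancels the weight \<open>d\<close> to the \<open>- z\<close> of the divisor function, and all
  powers of \<open>n\<close> and \<open>c\<close> cancel as well.
\<close>
lemma right_term_eq:
  assumes c: "c > 0"
  shows "right_term w (c\<^sup>2) z (Suc n) =
      exp (w\<^sup>2 / 4) * (LBINT r. (\<Sum>d | d dvd Suc n. gauss_cos_product w c d (Suc n div d) r) * exp (z * of_real r))"
    and "integrable lborel (\<lambda>r. (\<Sum>d | d dvd Suc n. gauss_cos_product w c d (Suc n div d) r) * exp (z * of_real r))"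
proof -
  define X where "X = real (Suc n) * c\<^sup>2"
  have X: "X > 0" using c by (simp add: X_def)
  define I where "I = (\<lambda>d r. gauss_cos_product w c d (Suc n div d) r * exp (z * of_real r))"
  define G where "G = (\<lambda>r. gauss_cos w (exp r) * gauss_cos w (X * exp (- r)) * exp (z * of_real r))"
  have G_shift: "G (ln (real d * c) + 1 * r) = of_real (real d * c) powr z * I d r" if "d dvd Suc n" for d r
  proof -
    from that obtain m where m: "Suc n = d * m" by (auto elim!: dvdE)
    have d: "d > 0" "m > 0" using m by (auto intro!: Nat.gr0I)
    have dc: "real d * c > 0" using d c by simp
    have div: "Suc n div d = m" using m d by simp
    have 1: "exp (ln (real d * c) + 1 * r) = real d * (c * exp r)"
      using dc by (simp add: exp_add mult.assoc)
    have "exp (- (ln (real d * c) + 1 * r)) = inverse (real d * c) * exp (- r)"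
      using dc by (simp only: minus_add_distrib exp_add mult_1 exp_minus[of "ln _"] exp_ln)
    then have 2: "X * exp (- (ln (real d * c) + 1 * r)) = real m * (c * exp (- r))"
      unfolding X_def m using d c by (simp add: power2_eq_square field_simps)
    have "of_real (real d * c) powr z = exp (z * of_real (ln (real d * c)))"
      by (rule powr_of_real_eq_exp[OF dc])
    then have 3: "exp (z * of_real (ln (real d * c) + 1 * r)) = of_real (real d * c) powr z * exp (z * of_real r)"
      by (simp only: of_real_add mult_1 distrib_left exp_add)
    show ?thesis
      unfolding G_def I_def gauss_cos_product_def 1 2 3 div by (simp only: mult_ac)
  qed
  have int_I: "integrable lborel (I d)" if "d dvd Suc n" for d
    unfolding I_def using that
    by (intro gauss_cos_product_integrable c) (auto intro!: Nat.gr0I simp: dvd_div_eq_0_iff)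
  have I_val: "(LBINT r. G r) = of_real (real d * c) powr z * (LBINT r. I d r)" if d: "d dvd Suc n" for d
    using lborel_integral_real_affine[of 1 G "ln (real d * c)"] unfolding G_shift[OF d] by simp
  have sumI: "(\<Sum>d | d dvd Suc n. gauss_cos_product w c d (Suc n div d) r) * exp (z * of_real r) =
      (\<Sum>d | d dvd Suc n. I d r)" for r
    by (simp only: sum_distrib_right I_def)
  show "integrable lborel (\<lambda>r. (\<Sum>d | d dvd Suc n. gauss_cos_product w c d (Suc n div d) r) * exp (z * of_real r))"
    unfolding sumI by (intro Bochner_Integration.integrable_sum int_I) simp
  have powX: "of_real X powr s = of_nat (Suc n) powr s * of_real c powr (2 * s)" for s :: complex
  proof -
    have "of_real X powr s = of_real (real (Suc n)) powr s * of_real (c\<^sup>2) powr s"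
      unfolding X_def using powr_times_real[of "of_real (real (Suc n))" "of_real (c\<^sup>2)" s] c by simp
    also have "complex_of_real (c\<^sup>2) powr s = of_real c powr (2 * s)"
      by (rule powr_square[OF c])
    finally show ?thesis by simp
  qed
  have "right_term w (c\<^sup>2) z (Suc n) = (\<Sum>d | d dvd Suc n. of_nat d powr (- z)) * of_nat (Suc n) powr (z / 2) * exp (w\<^sup>2 / 4) *
      (of_real X powr (- (z / 2)) * (LBINT r. G r))"
  proof -
    have eq: "2 * real (Suc n) * pi * c\<^sup>2 = 2 * pi * X" by (simp add: X_def)
    have "gen_bessel_K (z / 2) w (2 * real (Suc n) * pi * c\<^sup>2) = of_real X powr (- (z / 2)) * (LBINT r. G r)"
      unfolding G_def eq gen_bessel_K_eq[OF X] by simp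
    then show ?thesis
      unfolding right_term_def divisor_sigma_def by (simp only:)
  qed
  also have "\<dots> = exp (w\<^sup>2 / 4) * (\<Sum>d | d dvd Suc n. (of_nat d powr (- z) * of_nat (Suc n) powr (z / 2) * of_real X powr (- (z / 2))) * (LBINT r. G r))"
    by (simp add: sum_distrib_left sum_distrib_right mult_ac)
  also have "(\<Sum>d | d dvd Suc n. (of_nat d powr (- z) * of_nat (Suc n) powr (z / 2) * of_real X powr (- (z / 2))) * (LBINT r. G r)) =
      (\<Sum>d | d dvd Suc n. LBINT r. I d r)"
  proof (rule sum.cong[OF refl])
    fix d assume "d \<in> {d. d dvd Suc n}"
    then have d: "d dvd Suc n" by simp
    then have d0: "d > 0" by (auto intro!: Nat.gr0I)
    have "of_real (real d * c) powr z = of_nat d powr z * of_real c powr z"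
      using powr_times_real[of "of_real (real d)" "of_real c" z] c by simp
    moreover have "of_nat d powr (- z) * of_nat d powr z = (1 :: complex)"
      "of_nat (Suc n) powr (z / 2) * of_nat (Suc n) powr (- (z / 2)) = (1 :: complex)"
      "of_real c powr (2 * - (z / 2)) * of_real c powr z = (1 :: complex)"
      using d0 c by (simp_all add: powr_add[symmetric] del: of_nat_Suc)
    ultimately have "of_nat d powr (- z) * of_nat (Suc n) powr (z / 2) * of_real X powr (- (z / 2)) * of_real (real d * c) powr z = 1"
      unfolding powX by algebra
    then show "(of_nat d powr (- z) * of_nat (Suc n) powr (z / 2) * of_real X powr (- (z / 2))) * (LBINT r. G r) = (LBINT r. I d r)"
      unfolding I_val[OF d] by (simp only: mult.assoc[symmetric] mult_1_left)
  qed
  also have "(\<Sum>d | d dvd Suc n. LBINT r. I d r) = (LBINT r. (\<Sum>d | d dvd Suc n. I d r))"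
    by (rule Bochner_Integration.integral_sum[symmetric]) (use int_I in simp)
  finally show "right_term w (c\<^sup>2) z (Suc n) = exp (w\<^sup>2 / 4) * (LBINT r. (\<Sum>d | d dvd Suc n. gauss_cos_product w c d (Suc n div d) r) * exp (z * of_real r))"
    unfolding sumI .
qed

text \<open>
  Summing over \<open>n\<close> under the integral recombines the divisor sums into a product of two theta tails.
  The exchange is justified by the majorant of \<open>gauss_cos_product_bound\<close>, which is
  rapidly decreasing at both ends and whose coefficients are again a convergent Dirichlet product.
\<close>
theorem right_term_sums:
  assumes c: "c > 0"
  shows "(\<lambda>n. right_term w (c\<^sup>2) z (Suc n)) sums (exp (w\<^sup>2 / 4) * theta_product_mellin w c z)"
proof -
  define F where "F = (\<lambda>n r. (\<Sum>d | d dvd Suc n. gauss_cos_product w c d (Suc n div d) r) * exp (z * of_real r))"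
  have int_F: "integrable lborel (F n)" for n
    unfolding F_def by (rule right_term_eq(2)[OF c])
  obtain C where C: "C > 0" "\<And>d m r. d > 0 \<Longrightarrow> m > 0 \<Longrightarrow> norm (gauss_cos_product w c d m r) \<le>
      C * (gauss_decay (c * exp r) * gauss_decay (c * exp (- r))) * (inverse ((real d)\<^sup>2) * inverse ((real m)\<^sup>2))"
    by (rule gauss_cos_product_bound[OF c, of w]) blast
  define h where "h = (\<lambda>r. gauss_decay (c * exp r) * gauss_decay (c * exp (- r)) * exp (Re z * r))"
  have int_h: "integrable lborel h"
    unfolding h_def by (rule gauss_product_majorant_integrable[OF c])
  define q where "q = (\<lambda>n. \<Sum>d | d dvd Suc n. inverse ((real d)\<^sup>2) * inverse ((real (Suc n div d))\<^sup>2))"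
  have q: "summable q"
    using sums_summable[OF dirichlet_product_sums[of "\<lambda>d. inverse ((real d)\<^sup>2)" "\<lambda>d. inverse ((real d)\<^sup>2)"]]
      inverse_squares_summable unfolding q_def by simp
  have F_le: "norm (F n r) \<le> C * q n * h r" for n r
  proof -
    have "norm (F n r) \<le> (\<Sum>d | d dvd Suc n. norm (gauss_cos_product w c d (Suc n div d) r)) * exp (Re z * r)"
      unfolding F_def norm_mult[of "sum _ _"] by (intro mult_mono norm_sum) (auto intro: sum_nonneg)
    also have "\<dots> \<le> (\<Sum>d | d dvd Suc n. C * (gauss_decay (c * exp r) * gauss_decay (c * exp (- r))) *
        (inverse ((real d)\<^sup>2) * inverse ((real (Suc n div d))\<^sup>2))) * exp (Re z * r)"
      by (intro mult_right_mono sum_mono C(2)) (auto intro!: Nat.gr0I simp: dvd_div_eq_0_iff)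
    also have "\<dots> = C * q n * h r"
      unfolding sum_distrib_left[symmetric] by (simp only: q_def h_def mult_ac)
    finally show ?thesis .
  qed
  have summ: "AE r in lborel. summable (\<lambda>n. norm (F n r))"
  proof (rule AE_I2)
    fix r
    show "summable (\<lambda>n. norm (F n r))"
      by (rule summable_comparison_test'[of "\<lambda>n. C * q n * h r" 0])
        (use F_le q in \<open>auto intro!: summable_mult summable_mult2\<close>)
  qed
  have summ_int: "summable (\<lambda>n. LBINT r. norm (F n r))"
  proof (rule summable_comparison_test'[of "\<lambda>n. C * q n * (LBINT r. h r)" 0])
    show "summable (\<lambda>n. C * q n * (LBINT r. h r))"
      by (intro summable_mult summable_mult2 q)
    fix n
    have "(LBINT r. norm (F n r)) \<le> (LBINT r. C * q n * h r)"
      by (intro integral_mono integrable_norm int_F integrable_mult_right int_h F_le)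
    then show "norm (LBINT r. norm (F n r)) \<le> C * q n * (LBINT r. h r)"
      by (simp add: integral_nonneg_AE)
  qed
  have F_sum: "(\<Sum>n. F n r) = theta_tail w (c * exp r) * theta_tail w (c * exp (- r)) * exp (z * of_real r)" for r
  proof -
    have "(\<lambda>n. \<Sum>d | d dvd Suc n. gauss_cos_product w c d (Suc n div d) r) sums
        (theta_tail w (c * exp r) * theta_tail w (c * exp (- r)))"
      unfolding theta_tail_def gauss_cos_product_def
      by (rule dirichlet_product_sums; rule theta_tail_summable) (use c in auto)
    then show ?thesis
      unfolding F_def by (intro sums_unique[symmetric] sums_mult2)
  qed
  have "(\<lambda>n. LBINT r. F n r) sums theta_product_mellin w c z"
    using sums_integral[OF int_F summ summ_int] unfolding F_sum theta_product_mellin_def .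
  then have "(\<lambda>n. exp (w\<^sup>2 / 4) * (LBINT r. F n r)) sums (exp (w\<^sup>2 / 4) * theta_product_mellin w c z)"
    by (rule sums_mult)
  then show ?thesis
    unfolding right_term_eq(1)[OF c] F_def .
qed

section \<open>The difference of the two series\<close>

text \<open>
  With \<open>P = \<theta>\<^sub>w(c v)\<close>, \<open>Q = \<theta>\<^sub>w(c / v)\<close> and their counterparts \<open>P'\<close>, \<open>Q'\<close> for \<open>(\<i> w, 1 / c)\<close>, the
  theta transformation gives \<open>A Q = v P'\<close> and \<open>B Q' = v P\<close>, hence also \<open>A P Q = B P' Q'\<close>.  So
  in \<open>A (P - 1) (Q - 1) - B (P' - 1) (Q' - 1)\<close> only terms linear in \<open>P\<close> and \<open>P'\<close> survive.
\<close>
lemma theta_product_difference: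
  fixes w :: complex and c v :: real
  assumes c: "c > 0" and v: "v > 0"
  defines "A \<equiv> of_real c * exp (w\<^sup>2 / 4)" and "B \<equiv> exp (- w\<^sup>2 / 4) / of_real c"
  shows "4 * A * (theta_tail w (c * v) * theta_tail w (c / v)) -
      4 * B * (theta_tail (\<i> * w) (v / c) * theta_tail (\<i> * w) (1 / (c * v))) =
    2 * (of_real v - A) * theta_tail w (c * v) - 2 * (of_real v - B) * theta_tail (\<i> * w) (v / c)"
proof -
  define E where "E = exp (- w\<^sup>2 / 4)"
  have E: "E \<noteq> 0" "exp (w\<^sup>2 / 4) = inverse E" by (simp_all add: E_def exp_minus)
  define p q p' q' where "p = theta_tail w (c * v)" and "q = theta_tail w (c / v)"
    and "p' = theta_tail (\<i> * w) (v / c)" and "q' = theta_tail (\<i> * w) (1 / (c * v))"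
  have nz: "complex_of_real c \<noteq> 0" "complex_of_real v \<noteq> 0" using c v by auto
  have 1: "of_real c * of_real v * (1 + 2 * p) = E * (1 + 2 * q')"
    using theta_transformation[of "c * v" w] c v nz by (simp add: p_def q'_def E_def field_simps)
  have 2: "of_real c * (1 + 2 * q) = E * of_real v * (1 + 2 * p')"
    using theta_transformation[of "c / v" w] c v nz by (simp add: q_def p'_def E_def field_simps)
  have A: "A = of_real c / E" and B: "B = E / of_real c"
    unfolding A_def B_def E(2) E_def[symmetric] by (simp_all add: divide_inverse)
  have q: "1 + 2 * q = E * of_real v * (1 + 2 * p') / of_real c"
    using 2 nz by (simp add: field_simps)
  have q': "1 + 2 * q' = of_real c * of_real v * (1 + 2 * p) / E"
    using 1 E by (simp add: field_simps)
  have "4 * A * (p * q) - 4 * B * (p' * q') = A * ((1 + 2 * p) - 1) * ((1 + 2 * q) - 1) - B * ((1 + 2 * p') - 1) * ((1 + 2 * q') - 1)"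
    by (simp add: algebra_simps)
  also have "\<dots> = 2 * (of_real v - A) * p - 2 * (of_real v - B) * p'"
    unfolding q q' A B using nz E by (simp add: field_simps)
  finally show ?thesis
    by (simp add: p_def q_def p'_def q'_def)
qed

lemma theta_mellin_scaled:
  assumes c: "c > 0" and s: "Re s > 1"
  shows "integrable lborel (\<lambda>r. theta_tail w (c * exp r) * exp (s * of_real r))"
    and "s * (s - 1) * (LBINT r. theta_tail w (c * exp r) * exp (s * of_real r)) = of_real c powr (- s) * xi w s"
proof -
  define f where "f = (\<lambda>r. theta_tail w (exp r) * exp (s * of_real r))"
  have powc: "of_real c powr (- s) = exp (- s * of_real (ln c))"
    by (rule powr_of_real_eq_exp[OF c])
  have eq: "theta_tail w (c * exp r) * exp (s * of_real r) = of_real c powr (- s) * f (ln c + 1 * r)" for r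
    unfolding f_def powc using c by (simp add: exp_add distrib_left exp_minus field_simps)
  have f: "integrable lborel f"
    unfolding f_def by (rule theta_mellin_full(1)[OF s])
  show "integrable lborel (\<lambda>r. theta_tail w (c * exp r) * exp (s * of_real r))"
    unfolding eq by (intro integrable_mult_right lborel_integrable_real_affine f) simp
  have "(LBINT r. theta_tail w (c * exp r) * exp (s * of_real r)) = of_real c powr (- s) * (LBINT r. f r)"
    unfolding eq integral_mult_right_zero using lborel_integral_real_affine[of 1 f "ln c"] by simp
  then show "s * (s - 1) * (LBINT r. theta_tail w (c * exp r) * exp (s * of_real r)) = of_real c powr (- s) * xi w s"
    unfolding xi_eq_mellin[OF s] f_def by (simp add: mult_ac)
qed

text \<open>
  Apart from a denominator \<open>z (z - 1) (z + 1)\<close>, this is \<open>\<surd>\<beta>\<close> times the sum of the two terms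
  that are subtracted from the series, in terms of \<open>xi\<close>.
\<close>
definition residual_terms :: "complex \<Rightarrow> real \<Rightarrow> complex \<Rightarrow> complex" where
  "residual_terms w c z = 2 * ((z + 1) * (exp (- w\<^sup>2 / 4) / of_real c) * of_real c powr z * xi (\<i> * w) z
     + (z - 1) * of_real c powr (- (z + 1)) * xi w (z + 1))"

lemma residual_terms_entire:
  assumes "c > 0"
  shows "residual_terms w c holomorphic_on A"
proof -
  have "(xi w \<circ> (\<lambda>z. z + 1)) holomorphic_on A"
    by (rule holomorphic_on_compose_gen[OF _ xi_entire[of _ UNIV]]) (auto intro!: holomorphic_intros)
  then show ?thesis
    unfolding residual_terms_def[abs_def] using assms by (intro holomorphic_intros xi_entire) (auto simp: o_def)
qed

text \<open>
  For \<open>Re z > 1\<close> the linear combination of theta tails from \<open>theta_product_difference\<close> is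
  integrated termwise; an extra factor \<open>v = exp r\<close> moves the argument of the Mellin transform from
  \<open>z\<close> to \<open>z + 1\<close>.  The polynomial factor clears the denominators \<open>s (s - 1)\<close> at \<open>s = z\<close> and
  \<open>s = z + 1\<close>, so both sides are entire.
\<close>
theorem theta_product_functional_equation:
  assumes c: "c > 0"
  shows "z * (z - 1) * (z + 1) * (4 * (of_real c * exp (w\<^sup>2 / 4)) * theta_product_mellin w c z -
      4 * (exp (- w\<^sup>2 / 4) / of_real c) * theta_product_mellin (\<i> * w) (1 / c) z) =
    residual_terms w c z - residual_terms (\<i> * w) (1 / c) z" (is "?f z = ?g z")
proof (rule right_half_plane_identity[where f = ?f and g = ?g])
  define A where "A = of_real c * exp (w\<^sup>2 / 4)"
  define B where "B = exp (- w\<^sup>2 / 4) / complex_of_real c"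
  have c': "1 / c > 0" using c by simp
  show "?f holomorphic_on UNIV"
    by (intro holomorphic_intros theta_product_mellin_entire c c')
  show "?g holomorphic_on UNIV"
    by (intro holomorphic_intros residual_terms_entire c c')
  fix z :: complex assume z: "Re z > 1"
  have z1: "Re (z + 1) > 1" using z by simp
  define M where "M = (\<lambda>w c s. LBINT r. theta_tail w (c * exp r) * exp (s * of_real r))"
  have i1: "integrable lborel (\<lambda>r. theta_tail w (c * exp r) * theta_tail w (c * exp (- r)) * exp (z * of_real r))"
    by (rule bilateral_laplace_integrable[OF theta_product_laplace_integrable[OF c]])
  have i2: "integrable lborel (\<lambda>r. theta_tail (\<i> * w) (1 / c * exp r) * theta_tail (\<i> * w) (1 / c * exp (- r)) * exp (z * of_real r))"
    by (rule bilateral_laplace_integrable[OF theta_product_laplace_integrable[OF c']])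
  note i3 = theta_mellin_scaled(1)[OF c z] theta_mellin_scaled(1)[OF c z1] theta_mellin_scaled(1)[OF c' z] theta_mellin_scaled(1)[OF c' z1]
  define p q p' q' where "p = (\<lambda>r. theta_tail w (c * exp r))" and "q = (\<lambda>r. theta_tail w (c * exp (- r)))"
    and "p' = (\<lambda>r. theta_tail (\<i> * w) (1 / c * exp r))" and "q' = (\<lambda>r. theta_tail (\<i> * w) (1 / c * exp (- r)))"
  note pq = p_def q_def p'_def q'_def
  have pointwise: "4 * A * (p r * q r * exp (z * of_real r)) -
      4 * B * (p' r * q' r * exp (z * of_real r)) =
     2 * (p r * exp ((z + 1) * of_real r)) - 2 * A * (p r * exp (z * of_real r))
     - 2 * (p' r * exp ((z + 1) * of_real r)) + 2 * B * (p' r * exp (z * of_real r))" for r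
  proof -
    have e: "c / exp r = c * exp (- r)" "exp r / c = 1 / c * exp r" "1 / (c * exp r) = 1 / c * exp (- r)"
      by (simp_all add: exp_minus field_simps)
    have ez: "exp ((z + 1) * of_real r) = of_real (exp r) * exp (z * of_real r)"
      by (simp add: distrib_right exp_add exp_of_real)
    have "4 * A * (p r * q r) -
        4 * B * (p' r * q' r) =
      2 * (of_real (exp r) - A) * p r - 2 * (of_real (exp r) - B) * p' r"
      using theta_product_difference[OF c, of "exp r" w] unfolding A_def[symmetric] B_def[symmetric] e by (simp add: pq)
    then have "(4 * A * (p r * q r) -
        4 * B * (p' r * q' r)) * exp (z * of_real r) =
      (2 * (of_real (exp r) - A) * p r - 2 * (of_real (exp r) - B) * p' r) * exp (z * of_real r)"
      by (rule arg_cong)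
    then show ?thesis unfolding ez by algebra
  qed
  have "4 * A * theta_product_mellin w c z - 4 * B * theta_product_mellin (\<i> * w) (1 / c) z =
     (LBINT r. 4 * A * (p r * q r * exp (z * of_real r)) -
      4 * B * (p' r * q' r * exp (z * of_real r)))"
    unfolding theta_product_mellin_def pq using i1 i2
    by (subst Bochner_Integration.integral_diff) (intro integrable_mult_right | simp)+
  also have "\<dots> = 2 * M w c (z + 1) - 2 * A * M w c z - 2 * M (\<i> * w) (1 / c) (z + 1) + 2 * B * M (\<i> * w) (1 / c) z"
    unfolding pointwise unfolding M_def pq using i3 by simp
  finally have D: "4 * A * theta_product_mellin w c z - 4 * B * theta_product_mellin (\<i> * w) (1 / c) z =
    2 * M w c (z + 1) - 2 * A * M w c z - 2 * M (\<i> * w) (1 / c) (z + 1) + 2 * B * M (\<i> * w) (1 / c) z" .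
  note pow = powr_reciprocal[OF c]
  have M1: "(z + 1) * z * M w c (z + 1) = of_real c powr (- (z + 1)) * xi w (z + 1)"
    using theta_mellin_scaled(2)[OF c z1, of w] by (simp add: M_def)
  have M2: "z * (z - 1) * M w c z = of_real c powr (- z) * xi w z"
    using theta_mellin_scaled(2)[OF c z, of w] by (simp add: M_def)
  have M3: "(z + 1) * z * M (\<i> * w) (1 / c) (z + 1) = of_real c powr (z + 1) * xi (\<i> * w) (z + 1)"
    using theta_mellin_scaled(2)[OF c' z1, of "\<i> * w"] unfolding M_def pow by (simp add: ac_simps)
  have M4: "z * (z - 1) * M (\<i> * w) (1 / c) z = of_real c powr z * xi (\<i> * w) z"
    using theta_mellin_scaled(2)[OF c' z, of "\<i> * w"] unfolding M_def pow by simp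
  have R1: "residual_terms w c z = 2 * ((z + 1) * B * (of_real c powr z * xi (\<i> * w) z) + (z - 1) * (of_real c powr (- (z + 1)) * xi w (z + 1)))"
    by (simp add: residual_terms_def B_def mult_ac)
  have A': "exp (- (\<i> * w)\<^sup>2 / 4) / of_real (1 / c) = A"
    using c by (simp add: A_def power_mult_distrib)
  have R2: "residual_terms (\<i> * w) (1 / c) z = 2 * ((z + 1) * A * (of_real c powr (- z) * xi w z) + (z - 1) * (of_real c powr (z + 1) * xi (\<i> * w) (z + 1)))"
    unfolding residual_terms_def A' pow xi_twist_twice minus_minus by (simp only: mult_ac)
  show "?f z = ?g z"
    unfolding A_def[symmetric] B_def[symmetric] D R1 R2 M1[symmetric] M2[symmetric] M3[symmetric] M4[symmetric] by algebra
qed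

section \<open>The transformation formula\<close>

text \<open>
  The left-hand side of the formula is the right-hand side for \<open>\<i> w\<close>, because \<open>(\<i> w)\<^sup>2 = - w\<^sup>2\<close>.
\<close>
lemma left_term_eq_right_term: "left_term w \<alpha> z n = right_term (\<i> * w) \<alpha> z n"
  by (simp add: left_term_def right_term_def power_mult_distrib)

lemma left_side_eq_right_side: "left_side w \<alpha> z = right_side (\<i> * w) \<alpha> z"
  by (simp add: left_side_def right_side_def left_term_eq_right_term power_mult_distrib)

text \<open>
  Outside the even integers both Gamma factors are finite, and the products of Gamma and zeta
  factors are values of \<open>xi 0\<close> divided by \<open>z (z - 1)\<close> and \<open>z (z + 1)\<close>.  The Kummer functions are
  absorbed by \<open>xi_factor\<close>: in the second term directly, in the first one after the functional
  equation \<open>s \<mapsto> 1 - s\<close>.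
\<close>
theorem right_side_eq:
  assumes c: "c > 0" and even: "\<not> (\<exists>k::int. z = 2 * of_int k)" and z: "z \<noteq> 1" "z \<noteq> - 1"
  shows "right_side w (c\<^sup>2) z = 4 * (of_real c * exp (w\<^sup>2 / 4)) * theta_product_mellin w c z - residual_terms w c z / (z * (z - 1) * (z + 1))"
proof -
  have half: "s / 2 \<notin> \<int>\<^sub>\<le>\<^sub>0" if "\<not> (\<exists>k::int. s = 2 * of_int k)" for s :: complex
  proof
    assume "s / 2 \<in> \<int>\<^sub>\<le>\<^sub>0"
    then obtain n where "s / 2 = of_int n" by (auto elim!: nonpos_Ints_cases)
    then have "s = 2 * of_int n" by (simp add: field_simps)
    with that show False by blast
  qed
  have even': "\<not> (\<exists>k::int. - z = 2 * of_int k)"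
  proof
    assume "\<exists>k::int. - z = 2 * of_int k"
    then obtain k :: int where "- z = 2 * of_int k" by blast
    then have "z = - (2 * of_int k)" by (metis minus_minus)
    then have "z = 2 * of_int (- k)" by simp
    with even show False by blast
  qed
  have z0: "z \<noteq> 0" using even by (metis mult_zero_right of_int_0)
  have gz: "Gamma (s / 2) * riemann_zeta s * of_real pi powr (- s / 2) = 2 * xi 0 s / (s * (s - 1))"
    if "\<not> (\<exists>k::int. s = 2 * of_int k)" "s \<noteq> 1" for s
  proof -
    have "of_real pi powr (s / 2) * of_real pi powr (- s / 2) = (1 :: complex)"
      by (simp add: powr_add[symmetric])
    moreover have "Gamma (s / 2) * rGamma (s / 2 + 1) = 2 / s"
      using Gamma_mult_rGamma_plus1[OF half[OF that(1)]] by simp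
    moreover have "Gamma (s / 2) * riemann_zeta s * of_real pi powr (- s / 2) =
        xi 0 s * (of_real pi powr (s / 2) * of_real pi powr (- s / 2)) * (Gamma (s / 2) * rGamma (s / 2 + 1)) / (s - 1)"
      unfolding riemann_zeta_eq_xi[OF that(2)] by (simp add: mult_ac)
    ultimately show ?thesis by simp
  qed
  note c2 = powr_square[OF c]
  have cc: "of_real c * of_real c powr s = of_real c powr (s + 1)" for s :: complex
    using c powr_add[of "of_real c" s 1] by (simp add: mult.commute)
  have "of_real c * (of_real (c\<^sup>2) powr (z / 2 - 1)) = of_real c powr (z - 1)"
    unfolding c2 cc by (simp add: right_diff_distrib)
  also have "\<dots> = of_real c powr z / of_real c"
    using c powr_diff[of "of_real c" z 1] by simp
  finally have p1: "of_real c * (of_real (c\<^sup>2) powr (z / 2 - 1)) = of_real c powr z / of_real c" .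
  have p2: "of_real c * (of_real (c\<^sup>2) powr (- z / 2 - 1)) = of_real c powr (- (z + 1))"
    unfolding c2 cc by (rule arg_cong[where f = "\<lambda>s. of_real c powr s"]) (simp add: algebra_simps)
  have x1: "hyp1F1 ((1 - z) / 2) (1 / 2) (- w\<^sup>2 / 4) * xi 0 z = exp (- w\<^sup>2 / 4) * xi (\<i> * w) z"
    using xi_factor[of w "1 - z"] xi_functional_equation[of w "1 - z"] xi_symmetric[of z] by simp
  have x2: "hyp1F1 ((1 + z) / 2) (1 / 2) (- w\<^sup>2 / 4) * xi 0 (- z) = xi w (z + 1)"
    using xi_factor[of w "z + 1"] xi_symmetric[of "- z"] by (simp add: add.commute)
  have g1: "Gamma (z / 2) * riemann_zeta z * of_real pi powr (- z / 2) = 2 * xi 0 z / (z * (z - 1))"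
    by (rule gz[OF even z(1)])
  have g2: "Gamma (- z / 2) * riemann_zeta (- z) * of_real pi powr (z / 2) = 2 * xi 0 (- z) / (z * (z + 1))"
  proof -
    have "- z \<noteq> 1" using z(2) by (metis minus_minus)
    from gz[OF even' this] have "Gamma (- z / 2) * riemann_zeta (- z) * of_real pi powr (z / 2) = 2 * xi 0 (- z) / (- z * (- z - 1))" by simp
    also have "- z * (- z - 1) = z * (z + 1)" by (simp add: algebra_simps)
    finally show ?thesis .
  qed
  have series: "(\<Sum>n. right_term w (c\<^sup>2) z (Suc n)) = exp (w\<^sup>2 / 4) * theta_product_mellin w c z"
    using right_term_sums[OF c] by (rule sums_unique[symmetric])
  have sq: "sqrt (c\<^sup>2) = c" using c by simp
  have "right_side w (c\<^sup>2) z = 4 * (of_real c * exp (w\<^sup>2 / 4)) * theta_product_mellin w c z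
     - (Gamma (z / 2) * riemann_zeta z * of_real pi powr (- z / 2)) * (of_real c * of_real (c\<^sup>2) powr (z / 2 - 1)) * hyp1F1 ((1 - z) / 2) (1 / 2) (- w\<^sup>2 / 4)
     - (Gamma (- z / 2) * riemann_zeta (- z) * of_real pi powr (z / 2)) * (of_real c * of_real (c\<^sup>2) powr (- z / 2 - 1)) * hyp1F1 ((1 + z) / 2) (1 / 2) (- w\<^sup>2 / 4)"
    unfolding right_side_def series sq by (simp only: right_diff_distrib mult_ac)
  also have "\<dots> = 4 * (of_real c * exp (w\<^sup>2 / 4)) * theta_product_mellin w c z
     - 2 * (of_real c powr z / of_real c) * (hyp1F1 ((1 - z) / 2) (1 / 2) (- w\<^sup>2 / 4) * xi 0 z) / (z * (z - 1))
     - 2 * of_real c powr (- (z + 1)) * (hyp1F1 ((1 + z) / 2) (1 / 2) (- w\<^sup>2 / 4) * xi 0 (- z)) / (z * (z + 1))"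
    unfolding g1 g2 p1 p2 by (simp add: mult_ac)
  also have "\<dots> = 4 * (of_real c * exp (w\<^sup>2 / 4)) * theta_product_mellin w c z - residual_terms w c z / (z * (z - 1) * (z + 1))"
  proof -
    have nz: "z \<noteq> 0" "z - 1 \<noteq> 0" "z + 1 \<noteq> 0"
      using z0 z by (auto simp: add_eq_0_iff2)
    have comb: "T - 2 * U / (z * (z - 1)) - 2 * V / (z * (z + 1)) = T - 2 * ((z + 1) * U + (z - 1) * V) / (z * (z - 1) * (z + 1))" for T U V
    proof -
      have U: "2 * U / (z * (z - 1)) = 2 * ((z + 1) * U) / (z * (z - 1) * (z + 1))"
        using mult_divide_mult_cancel_right[OF nz(3), of "2 * U" "z * (z - 1)"] by (simp only: mult_ac)
      have V: "2 * V / (z * (z + 1)) = 2 * ((z - 1) * V) / (z * (z - 1) * (z + 1))"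
        using mult_divide_mult_cancel_right[OF nz(2), of "2 * V" "z * (z + 1)"] by (simp only: mult_ac)
      show ?thesis
        unfolding U V by (simp only: distrib_left add_divide_distrib diff_diff_eq)
    qed
    have "residual_terms w c z = 2 * ((z + 1) * (of_real c powr z / of_real c * (exp (- w\<^sup>2 / 4) * xi (\<i> * w) z)) + (z - 1) * (of_real c powr (- (z + 1)) * xi w (z + 1)))"
      by (simp add: residual_terms_def mult_ac)
    then show ?thesis
      unfolding x1 x2 mult.assoc[of 2] comb by simp
  qed
  finally show ?thesis .
qed

lemma residual_terms_zero:
  assumes "c > 0"
  shows "residual_terms w c 0 = 0"
proof -
  have x: "xi w (0 + 1) = exp (- w\<^sup>2 / 4) * xi (\<i> * w) 0"
    using xi_functional_equation[of w 1] by simp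
  have p: "of_real c powr (- (0 + 1)) = 1 / complex_of_real c"
    by (simp add: powr_minus_divide)
  show ?thesis
    unfolding residual_terms_def x p using assms by simp
qed

theorem sides_agree:
  assumes c: "c > 0" and even: "\<not> (\<exists>k::int. z = 2 * of_int k)" and z: "z \<noteq> 1" "z \<noteq> - 1"
  shows "left_side w ((1 / c)\<^sup>2) z = right_side w (c\<^sup>2) z"
proof -
  have z0: "z \<noteq> 0" using even by (metis mult_zero_right of_int_0)
  have nz: "z * (z - 1) * (z + 1) \<noteq> 0" using z0 z by (auto simp: add_eq_0_iff2)
  define D where "D = z * (z - 1) * (z + 1)"
  have D: "D \<noteq> 0" using nz by (simp add: D_def)
  define P where "P = 4 * (of_real c * exp (w\<^sup>2 / 4)) * theta_product_mellin w c z"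
  define Q where "Q = 4 * (exp (- w\<^sup>2 / 4) / of_real c) * theta_product_mellin (\<i> * w) (1 / c) z"
  have "D * (P - Q) = residual_terms w c z - residual_terms (\<i> * w) (1 / c) z"
    unfolding D_def P_def Q_def by (rule theta_product_functional_equation[OF c])
  then have "P - residual_terms w c z / D = Q - residual_terms (\<i> * w) (1 / c) z / D"
    using D by (simp add: field_simps)
  moreover have "right_side w (c\<^sup>2) z = P - residual_terms w c z / D"
    unfolding P_def D_def by (rule right_side_eq[OF c even z])
  moreover have "left_side w ((1 / c)\<^sup>2) z = Q - residual_terms (\<i> * w) (1 / c) z / D"
  proof -
    have c': "1 / c > 0" using c by simp
    have "of_real (1 / c) * exp ((\<i> * w)\<^sup>2 / 4) = exp (- w\<^sup>2 / 4) / complex_of_real c"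
      by (simp add: power_mult_distrib)
    then show ?thesis
      unfolding left_side_eq_right_side right_side_eq[OF c' even z] Q_def D_def by (simp only:)
  qed
  ultimately show ?thesis by simp
qed

text \<open>
  Dividing the residual terms by \<open>z\<close> leaves an entire function since they vanish at 0.  Therefore the
  expression from \<open>right_side_eq\<close> extends continuously to every point other than 1 and \<open>- 1\<close>.
\<close>
lemma right_side_limit:
  assumes c: "c > 0" and z: "z \<noteq> 1" "z \<noteq> - 1" and ev: "\<forall>\<^sub>F s in at z. \<not> (\<exists>k::int. s = 2 * of_int k) \<and> s \<noteq> 1 \<and> s \<noteq> - 1"
  shows "\<exists>l. (right_side w (c\<^sup>2) \<longlongrightarrow> l) (at z)"
proof -
  define N where "N = (\<lambda>s. if s = 0 then deriv (residual_terms w c) 0 else (residual_terms w c s - residual_terms w c 0) / (s - 0))"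
  have holN: "N holomorphic_on UNIV"
    unfolding N_def by (rule pole_lemma) (auto intro: residual_terms_entire c)
  define R where "R = (\<lambda>s. 4 * (of_real c * exp (w\<^sup>2 / 4)) * theta_product_mellin w c s - N s / ((s - 1) * (s + 1)))"
  have "R holomorphic_on - {1, - 1}"
    unfolding R_def
    by (intro holomorphic_intros theta_product_mellin_entire c holomorphic_on_subset[OF holN]) (auto simp: add_eq_0_iff2)
  moreover have "open (- {1, - 1 :: complex})" by (intro open_Compl finite_imp_closed) auto
  ultimately have "isCont R z"
    using z by (intro continuous_on_interior[OF holomorphic_on_imp_continuous_on]) (auto simp: interior_open)
  then have lim: "(R \<longlongrightarrow> R z) (at z)" by (simp add: isCont_def)
  have "\<forall>\<^sub>F s in at z. right_side w (c\<^sup>2) s = R s"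
    using ev
  proof eventually_elim
    case (elim s)
    then have s0: "s \<noteq> 0" by (metis mult_zero_right of_int_0)
    have "right_side w (c\<^sup>2) s = 4 * (of_real c * exp (w\<^sup>2 / 4)) * theta_product_mellin w c s - residual_terms w c s / (s * (s - 1) * (s + 1))"
      using elim by (intro right_side_eq[OF c]) auto
    then show ?case
      using s0 by (simp add: R_def N_def residual_terms_zero[OF c] mult.assoc)
  qed
  then have "(right_side w (c\<^sup>2) \<longlongrightarrow> R z) (at z)"
    using lim by (simp add: tendsto_cong)
  then show ?thesis ..
qed

lemma eventually_not_even:
  assumes "z = 2 * of_int k"
  shows "\<forall>\<^sub>F s in at z. \<not> (\<exists>k::int. s = 2 * of_int k) \<and> s \<noteq> 1 \<and> s \<noteq> (- 1 :: complex)"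
  unfolding eventually_at
proof (intro exI[of _ 1] conjI ballI impI)
  fix s assume s: "s \<noteq> z \<and> dist s z < 1"
  have int: "n = 2 * k" if "s = of_int n" for n :: int
  proof -
    have "dist s z = \<bar>real_of_int (n - 2 * k)\<bar>"
      unfolding dist_norm that assms by (metis norm_of_int of_int_diff of_int_mult of_int_numeral)
    with s have "\<bar>real_of_int (n - 2 * k)\<bar> < 1" by simp
    then show ?thesis by linarith
  qed
  have not_int: "s \<noteq> of_int n" for n
  proof
    assume n: "s = of_int n"
    from int[OF n] n have "s = z" by (simp add: assms)
    with s show False by blast
  qed
  show "\<not> (\<exists>k::int. s = 2 * of_int k)"
    using not_int[of "2 * _"] by auto
  show "s \<noteq> 1" using not_int[of 1] by simp
  show "s \<noteq> - 1" using not_int[of "- 1"] by simp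
qed simp

theorem theorem1p5:
  fixes w z :: complex and \<alpha> \<beta> :: real
  assumes "z \<notin> {-1, 1}"
    and "\<alpha> > 0" and "\<beta> > 0" and "\<alpha> * \<beta> = 1"
  shows "summable (\<lambda>n. left_term w \<alpha> z (Suc n)) \<and>
         summable (\<lambda>n. right_term w \<beta> z (Suc n)) \<and>
         (if \<exists>k::int. z = 2 * of_int k
          then \<exists>l. (left_side w \<alpha> \<longlongrightarrow> l) (at z) \<and> (right_side w \<beta> \<longlongrightarrow> l) (at z)
          else left_side w \<alpha> z = right_side w \<beta> z)"
proof -
  define c where "c = sqrt \<beta>"
  have c: "c > 0" "1 / c > 0" and \<beta>: "\<beta> = c\<^sup>2"
    using assms(3) by (simp_all add: c_def)
  have \<alpha>: "\<alpha> = (1 / c)\<^sup>2"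
    using assms(4) c(1) by (simp add: \<beta> power_divide field_simps)
  have z: "z \<noteq> 1" "z \<noteq> - 1" using assms(1) by auto
  have right: "summable (\<lambda>n. right_term w \<beta> z (Suc n))"
    unfolding \<beta> using right_term_sums[OF c(1)] by (rule sums_summable)
  have left: "summable (\<lambda>n. left_term w \<alpha> z (Suc n))"
    unfolding \<alpha> left_term_eq_right_term using right_term_sums[OF c(2)] by (rule sums_summable)
  have "\<exists>l. (left_side w \<alpha> \<longlongrightarrow> l) (at z) \<and> (right_side w \<beta> \<longlongrightarrow> l) (at z)" if "\<exists>k::int. z = 2 * of_int k"
  proof -
    from that have ev: "\<forall>\<^sub>F s in at z. \<not> (\<exists>k::int. s = 2 * of_int k) \<and> s \<noteq> 1 \<and> s \<noteq> - 1"
      using eventually_not_even by blast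
    then obtain l where l: "(right_side w \<beta> \<longlongrightarrow> l) (at z)"
      unfolding \<beta> using right_side_limit[OF c(1) z] by blast
    have "\<forall>\<^sub>F s in at z. left_side w \<alpha> s = right_side w \<beta> s"
      using ev by eventually_elim (simp add: \<alpha> \<beta> sides_agree[OF c(1)])
    with l have "(left_side w \<alpha> \<longlongrightarrow> l) (at z)"
      by (simp add: tendsto_cong)
    with l show ?thesis by blast
  qed
  moreover have "left_side w \<alpha> z = right_side w \<beta> z" if "\<not> (\<exists>k::int. z = 2 * of_int k)"
    unfolding \<alpha> \<beta> by (rule sides_agree[OF c(1) that z])
  ultimately show ?thesis using left right by simp
qed

end
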